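(* Let $q>0$ and $h\in L^1_{loc}(\mathbb{R}^N)$. Then the problem $$-\mathrm{div}\left(\frac{\nabla u}{\sqrt{1+|\nabla u|^2}}\right)+|u|^{q-1}u=h\quad\text{on }\mathbb{R}^N$$ has at most one weak solution $v\in W^{1,1}_{loc}(\mathbb{R}^N)\cap L^q_{loc}(\mathbb{R}^N)$. Moreover, any such weak solution $v$ satisfies $$\inf_{\mathbb{R}^N}h\le |v|^{q-1}v\le\sup_{\mathbb{R}^N}h\quad\text{a.e. on }\mathbb{R}^N .$$
   Context: $C^1_0(\mathbb{R}^N)$ denotes compactly supported $C^1$ functions. A function $u\in W^{1,1}_{loc}(\mathbb{R}^N)\cap L^q_{loc}(\mathbb{R}^N)$ is a weak solution if $\int_{\mathbb{R}^N}\frac{\nabla u\cdot\nabla\phi}{\sqrt{1+|\nabla u|^2}}+\int_{\mathbb{R}^N}|u|^{q-1}u\,\phi=\int_{\mathbb{R}^N}h\phi$ for every $\phi\in C^1_0(\mathbb{R}^N)$. $|u|^{q-1}u$ is read as $0$ where $u=0$. $\inf$ and $\sup$ of $h$ are essential infimum and supremum, possibly $-\infty$, $+\infty$. *)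

theory Defs
  imports "HOL-Analysis.Analysis" "HOL-Probability.Essential_Supremum"
begin

definition Lp_loc :: "real \<Rightarrow> ('a::euclidean_space \<Rightarrow> 'b::euclidean_space) set" where
  "Lp_loc p = {f \<in> borel_measurable lebesgue.
     \<forall>K. compact K \<longrightarrow> set_integrable lebesgue K (\<lambda>x. norm (f x) powr p)}"

definition grad :: "('a::euclidean_space \<Rightarrow> real) \<Rightarrow> 'a \<Rightarrow> 'a" where
  "grad \<phi> x = (THE D. GDERIV \<phi> x :> D)"

definition C1_0 :: "('a::euclidean_space \<Rightarrow> real) set" where
  "C1_0 = {\<phi>. (\<forall>x. \<phi> differentiable (at x)) \<and> continuous_on UNIV (grad \<phi>) \<and>
     compact (closure (support_on UNIV \<phi>))}"

text \<open>Weak gradients are tested against compactly supported \<open>C\<^sup>1\<close> functions, as in Gilbarg and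
  Trudinger, \<^emph>\<open>Elliptic Partial Differential Equations of Second Order\<close>, Section 7.3. The
  identity is vector-valued: its \<open>i\<close>-th component is the usual one for the \<open>i\<close>-th partial
  derivative.\<close>

definition is_weak_grad :: "('a::euclidean_space \<Rightarrow> real) \<Rightarrow> ('a \<Rightarrow> 'a) \<Rightarrow> bool" where
  "is_weak_grad u g \<longleftrightarrow> g \<in> Lp_loc 1 \<and>
     (\<forall>\<phi>\<in>C1_0. (LINT x|lebesgue. u x *\<^sub>R grad \<phi> x) = - (LINT x|lebesgue. \<phi> x *\<^sub>R g x))"

definition W11_loc :: "('a::euclidean_space \<Rightarrow> real) set" where
  "W11_loc = {u \<in> Lp_loc 1. \<exists>g. is_weak_grad u g}"

text \<open>A weak gradient is only determined almost everywhere; any representative is chosen.\<close>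

definition weak_grad :: "('a::euclidean_space \<Rightarrow> real) \<Rightarrow> 'a \<Rightarrow> 'a" where
  "weak_grad u = (SOME g. is_weak_grad u g)"

text \<open>\<open>signed_pow q t\<close> is \<open>|t|\<^bsup>q-1\<^esup> t\<close>. It is \<open>0\<close> at \<open>t = 0\<close> for every \<open>q\<close>, because
  \<open>0 powr a = 0\<close>.\<close>

definition signed_pow :: "real \<Rightarrow> real \<Rightarrow> real" where
  "signed_pow q t = \<bar>t\<bar> powr (q - 1) * t"

definition weak_solution ::
    "real \<Rightarrow> ('a::euclidean_space \<Rightarrow> real) \<Rightarrow> ('a \<Rightarrow> real) \<Rightarrow> bool" where
  "weak_solution q h u \<longleftrightarrow> u \<in> W11_loc \<inter> Lp_loc q \<and>
     (\<forall>\<phi>\<in>C1_0.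
        (LINT x|lebesgue. (weak_grad u x \<bullet> grad \<phi> x) / sqrt (1 + (norm (weak_grad u x))\<^sup>2))
        + (LINT x|lebesgue. signed_pow q (u x) * \<phi> x)
        = (LINT x|lebesgue. h x * \<phi> x))"

definition essinf :: "'a measure \<Rightarrow> ('a \<Rightarrow> ereal) \<Rightarrow> ereal" where
  "essinf M f = - esssup M (\<lambda>x. - f x)"

end

theory Submission
  imports Defs
begin

text \<open>
  Uniqueness and the two bounds all follow from a comparison principle: if \<open>u\<close> and \<open>v\<close> solve the
  equation with right-hand sides \<open>h\<^sub>1 \<le> h\<^sub>2\<close> then \<open>u \<le> v\<close>; constants are solutions, which gives the
  bounds. Write \<open>s(t) = |t|\<^bsup>q-1\<^esup> t\<close>, \<open>a(p) = p / sqrt (1 + |p|\<^sup>2)\<close>, and subtract the equations,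
  tested with \<open>T(S(u) - S(v)) \<phi>\<close>, where \<open>S\<close> is increasing with \<open>S' = \<rho>\<close>, \<open>T\<close> is bounded and vanishes
  to order \<open>k\<close> at \<open>0\<close>, and \<open>\<phi>\<close> is a cutoff at scale \<open>R = \<epsilon>\<^bsup>-2\<^esup>\<close>.

  For \<open>q \<ge> 1\<close> one takes \<open>S(t) = t\<close>. For \<open>q < 1\<close> the difference \<open>s(u) - s(v)\<close> does not control \<open>u - v\<close>
  when both are large, and \<open>S\<close> has to flatten at infinity like \<open>s\<close>: \<open>\<rho>(t) = (M + |t|)\<^bsup>q-1\<^esup>\<close>. The price
  is that \<open>(a(\<xi>) - a(\<eta>)) \<bullet> (\<rho>(u) \<xi> - \<rho>(v) \<eta>)\<close> need not be nonnegative; expressed through the unit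
  normals of the graphs it is at least \<open>- (\<rho>(u) - \<rho>(v))\<^sup>2 / (2 (\<rho>(u) + \<rho>(v)))\<close>, and for large \<open>M\<close> this
  is absorbed by the zero-order term. In both cases \<open>S(u) - S(v) \<le> C (s(u) - s(v))\<^bsup>\<theta>\<^esup>\<close> with
  \<open>\<theta> = min 1 (1/q)\<close>.

  Since \<open>a\<close> is bounded and \<open>|\<nabla>\<phi>| \<le> \<epsilon> \<phi> + O(\<epsilon>\<^bsup>m+1\<^esup>)\<close>, the flux term is at most \<open>2 \<epsilon> T \<phi>\<close> up to a
  small error. Where \<open>s(u) - s(v) \<ge> 8 \<epsilon>\<close> it is absorbed, and elsewhere \<open>T = O(\<epsilon>\<^bsup>\<theta>k\<^esup>)\<close> beats the volume
  \<open>\<epsilon>\<^bsup>-2N\<^esup>\<close> of the support. Letting \<open>\<epsilon> \<rightarrow> 0\<close> gives \<open>\<integral> (s(u) - s(v)) T(S(u) - S(v)) = 0\<close>.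
  The nonlinear test function is justified by mollifying \<open>u\<close> and \<open>v\<close>.
\<close>

subsection \<open>Gradients of \<open>C\<^sup>1\<close> functions and cutoffs\<close>

text \<open>Mollified solutions are \<open>C^1\<close> on the whole space without compact support,
  so the chain and product rules are developed in this class; the cutoff factor brings test
  functions into \<open>C1_0\<close> afterwards.\<close>

definition is_C1 :: "('a::euclidean_space \<Rightarrow> real) \<Rightarrow> bool" where
  "is_C1 f \<longleftrightarrow> (\<forall>x. f differentiable (at x)) \<and> continuous_on UNIV (grad f)"

text \<open>\<open>grad\<close> is a definite description, so evaluating it rests on uniqueness: the
  derivative is unique as a linear map, and a vector is determined by its inner products.\<close>

lemma grad_eqI:
  assumes "GDERIV f x :> D" shows "grad f x = D"
  unfolding grad_def
proof (rule the_equality[where P = "\<lambda>D. GDERIV f x :> D", OF assms])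
  fix E assume "GDERIV f x :> E"
  with assms have "(\<lambda>h. h \<bullet> D) = (\<lambda>h. h \<bullet> E)"
    unfolding gderiv_def using has_derivative_unique by blast
  then show "E = D"
    by (metis inner_commute vector_eq_rdot)
qed

text \<open>Riesz representation in coordinates: a linear functional is the inner product with the
  vector assembled from its values on the basis.\<close>

lemma differentiable_GDERIV:
  assumes "f differentiable (at x)" shows "GDERIV f x :> grad f x"
proof -
  obtain f' where f': "(f has_derivative f') (at x)"
    using assms by (auto simp: differentiable_def)
  then have lin: "linear f'" by (rule has_derivative_linear)
  have "f' = (\<lambda>h. h \<bullet> (\<Sum>b\<in>Basis. f' b *\<^sub>R b))"
  proof
    fix h
    have "f' h = f' (\<Sum>b\<in>Basis. (h \<bullet> b) *\<^sub>R b)"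
      by (simp add: euclidean_representation)
    also have "\<dots> = (\<Sum>b\<in>Basis. (h \<bullet> b) * f' b)"
      by (simp add: linear_sum[OF lin] linear_cmul[OF lin])
    finally show "f' h = h \<bullet> (\<Sum>b\<in>Basis. f' b *\<^sub>R b)"
      by (simp add: inner_sum_right mult.commute)
  qed
  with f' have "GDERIV f x :> (\<Sum>b\<in>Basis. f' b *\<^sub>R b)"
    by (simp add: gderiv_def)
  then show ?thesis
    using grad_eqI by metis
qed

lemma is_C1_I:
  assumes "\<And>x. GDERIV f x :> D x" "continuous_on UNIV D"
  shows "is_C1 f" "grad f = D"
proof -
  show "grad f = D"
    using grad_eqI[OF assms(1)] by blast
  then show "is_C1 f"
    using assms by (auto simp: is_C1_def gderiv_def differentiable_def)
qed

lemma is_C1_GDERIV: "is_C1 f \<Longrightarrow> GDERIV f x :> grad f x"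
  by (simp add: is_C1_def differentiable_GDERIV)

lemma is_C1_continuous_grad: "is_C1 f \<Longrightarrow> continuous_on UNIV (grad f)"
  by (simp add: is_C1_def)

lemma is_C1_continuous: "is_C1 f \<Longrightarrow> continuous_on UNIV f"
  unfolding is_C1_def
  by (simp add: continuous_on_eq_continuous_at differentiable_imp_continuous_within)

lemma is_C1_const: "is_C1 (\<lambda>x. c)" and grad_const: "grad (\<lambda>x. c) = (\<lambda>x. 0)"
  using is_C1_I[of "\<lambda>x. c" "\<lambda>x. 0"] by (simp_all add: GDERIV_const)

lemma is_C1_diff:
  assumes "is_C1 f" "is_C1 g"
  shows "is_C1 (\<lambda>x. f x - g x)" "grad (\<lambda>x. f x - g x) = (\<lambda>x. grad f x - grad g x)"
  using is_C1_I[of "\<lambda>x. f x - g x" "\<lambda>x. grad f x - grad g x"] assms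
  by (simp_all add: GDERIV_diff is_C1_GDERIV continuous_on_diff is_C1_continuous_grad)

lemma is_C1_mult:
  assumes "is_C1 f" "is_C1 g"
  shows "is_C1 (\<lambda>x. f x * g x)"
    "grad (\<lambda>x. f x * g x) = (\<lambda>x. f x *\<^sub>R grad g x + g x *\<^sub>R grad f x)"
  using is_C1_I[of "\<lambda>x. f x * g x" "\<lambda>x. f x *\<^sub>R grad g x + g x *\<^sub>R grad f x"] assms
  by (simp_all add: GDERIV_mult is_C1_GDERIV continuous_on_add continuous_on_scaleR
      is_C1_continuous_grad is_C1_continuous)

lemma is_C1_compose:
  assumes "is_C1 f" "\<And>t. (T has_real_derivative T' t) (at t)" "continuous_on UNIV T'"
  shows "is_C1 (\<lambda>x. T (f x))" "grad (\<lambda>x. T (f x)) = (\<lambda>x. T' (f x) *\<^sub>R grad f x)"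
  using is_C1_I[of "\<lambda>x. T (f x)" "\<lambda>x. T' (f x) *\<^sub>R grad f x"] assms
  by (simp_all add: GDERIV_DERIV_compose is_C1_GDERIV continuous_on_scaleR
      is_C1_continuous_grad is_C1_continuous continuous_on_compose2[OF assms(3)])

lemma C1_0_I:
  assumes "is_C1 f" "\<And>x. x \<notin> cball a r \<Longrightarrow> f x = 0"
  shows "f \<in> C1_0"
proof -
  have "closure (support_on UNIV f) \<subseteq> cball a r"
    using assms(2) by (intro closure_minimal) (force simp: support_on_def)+
  then have "compact (closure (support_on UNIV f))"
    by (meson bounded_cball bounded_subset closed_closure compact_eq_bounded_closed)
  then show ?thesis
    using assms(1) by (simp add: C1_0_def is_C1_def)
qed

text \<open>The complement of a closed ball is open, so \<open>f\<close> vanishes in a whole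
  neighbourhood of \<open>x\<close>.\<close>

lemma grad_eq_0_outside:
  assumes "is_C1 f" "\<And>x. x \<notin> cball a r \<Longrightarrow> f x = 0" "x \<notin> cball a r"
  shows "grad f x = 0"
proof (rule grad_eqI)
  have "eventually (\<lambda>y. y \<in> - cball a r) (nhds x)"
    using assms(3) by (intro eventually_nhds_in_open) auto
  then have "eventually (\<lambda>y. y \<in> - cball a r) (at x)"
    unfolding eventually_at_filter by (rule eventually_mono) simp
  then have ev: "eventually (\<lambda>y. 0 = f y) (at x)"
    by (rule eventually_mono) (simp add: assms(2))
  have "(f has_derivative (\<lambda>h. 0)) (at x)"
    by (rule has_derivative_transform_eventually[OF has_derivative_const[of 0] ev])
      (use assms(2)[OF assms(3)] in simp_all)
  then show "GDERIV f x :> 0"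
    by (simp add: gderiv_def)
qed

section \<open>Powers of the positive part and the polynomial cutoff\<close>

text \<open>An exponent of at least 2 smooths the kink at 0. This is the common source of smoothness
  for the cutoff in space and for the truncation of values.\<close>

lemma DERIV_max_power:
  fixes t :: real
  assumes "2 \<le> m"
  shows "((\<lambda>t. (max 0 t) ^ m) has_real_derivative (real m * (max 0 t) ^ (m - 1))) (at t)"
proof -
  consider "t < 0" | "t > 0" | "t = 0" by linarith
  then show ?thesis
  proof cases
    case 1
    have "((\<lambda>t::real. 0) has_real_derivative 0) (at t)" by simp
    moreover have "eventually (\<lambda>s. s < 0) (nhds t)"
      using 1 by (intro eventually_nhds_in_open[of "{..<0}", simplified]) auto
    then have "eventually (\<lambda>s. 0 = (max 0 s) ^ m) (nhds t)"
      using assms by (auto elim!: eventually_mono simp: max_def)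
    ultimately have "((\<lambda>t. (max 0 t) ^ m) has_real_derivative 0) (at t)"
      by (simp only: DERIV_cong_ev[OF refl _ refl])
    then show ?thesis using 1 assms by (simp add: max_def power_0_left)
  next
    case 2
    have "((\<lambda>t::real. t ^ m) has_real_derivative (real m * t ^ (m - 1))) (at t)"
      by (auto intro!: derivative_eq_intros)
    moreover have "eventually (\<lambda>s. s > 0) (nhds t)"
      using 2 by (intro eventually_nhds_in_open[of "{0<..}", simplified]) auto
    then have "eventually (\<lambda>s. s ^ m = (max 0 s) ^ m) (nhds t)"
      by (auto elim!: eventually_mono simp: max_def)
    ultimately have "((\<lambda>t. (max 0 t) ^ m) has_real_derivative (real m * t ^ (m - 1))) (at t)"
      by (simp only: DERIV_cong_ev[OF refl _ refl])
    then show ?thesis using 2 by (simp add: max_def)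
  next
    case 3
    have lim: "((\<lambda>h::real. (max 0 h) ^ (m - 1)) \<longlongrightarrow> (max 0 0) ^ (m - 1)) (at 0)"
      by (intro tendsto_intros)
    \<comment> \<open>At the kink the difference quotient is dominated by
      \<open>(max 0 h) ^ (m - 1)\<close>, which tends to 0 because \<open>m - 1\<close> is
      positive.\<close>
    have "((\<lambda>h::real. (max 0 h) ^ m / h) \<longlongrightarrow> 0) (at 0)"
    proof (rule Lim_null_comparison)
      show "((\<lambda>h::real. (max 0 h) ^ (m - 1)) \<longlongrightarrow> 0) (at 0)"
        using lim assms by (simp add: zero_power)
      show "\<forall>\<^sub>F h in at 0. norm ((max 0 h) ^ m / h) \<le> (max 0 h) ^ (m - 1)"
      proof (intro always_eventually allI)
        fix h :: real
        obtain j where j: "m = Suc (Suc j)" using assms by (metis add_2_eq_Suc le_Suc_ex)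
        show "norm ((max 0 h) ^ m / h) \<le> (max 0 h) ^ (m - 1)"
          by (cases "h > 0") (auto simp: j max_def)
      qed
    qed
    then show ?thesis
      using 3 assms by (simp add: has_field_derivative_iff power_0_left)
  qed
qed

text \<open>A polynomial bump whose gradient carries the power \<open>m - 1\<close> of the same
  base. A large \<open>m\<close> therefore makes the gradient small relative to the function itself,
  up to a high-order error. The case \<open>m = 2\<close> also supplies the mollifying
  kernel.\<close>

definition cutoff :: "nat \<Rightarrow> real \<Rightarrow> 'a::euclidean_space \<Rightarrow> real" where
  "cutoff m R x = (max 0 (1 - (norm x)\<^sup>2 / R\<^sup>2)) ^ m"

lemma is_C1_cutoff:
  assumes "2 \<le> m"
  shows "is_C1 (cutoff m R :: 'a::euclidean_space \<Rightarrow> real)"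
    "grad (cutoff m R :: 'a \<Rightarrow> real) = (\<lambda>x. - ((2 * real m / R\<^sup>2) * (max 0 (1 - (norm x)\<^sup>2 / R\<^sup>2)) ^ (m - 1)) *\<^sub>R x)"
proof -
  \<comment> \<open>For \<open>R = 0\<close> division by zero makes the function constant and the
    claimed gradient zero, so the formula is consistent there too.\<close>
  have "GDERIV (\<lambda>x::'a. 1 - (norm x)\<^sup>2 / R\<^sup>2) x :> - (2 / R\<^sup>2) *\<^sub>R x" for x :: 'a
    unfolding gderiv_def power2_norm_eq_inner
    by (cases "R = 0")
      (auto intro!: derivative_eq_intros simp: inner_commute fun_eq_iff field_simps power2_eq_square)
  from GDERIV_DERIV_compose[OF this DERIV_max_power[OF assms]]
  have *: "GDERIV (cutoff m R) x :> - ((2 * real m / R\<^sup>2) * (max 0 (1 - (norm x)\<^sup>2 / R\<^sup>2)) ^ (m - 1)) *\<^sub>R x"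
    for x :: 'a
    unfolding cutoff_def by (simp add: mult_ac)
  have c: "continuous_on UNIV (\<lambda>x::'a. - ((2 * real m / R\<^sup>2) * (max 0 (1 - (norm x)\<^sup>2 / R\<^sup>2)) ^ (m - 1)) *\<^sub>R x)"
    by (cases "R = 0") (auto intro!: continuous_intros)
  show "is_C1 (cutoff m R :: 'a \<Rightarrow> real)"
    "grad (cutoff m R :: 'a \<Rightarrow> real) = (\<lambda>x. - ((2 * real m / R\<^sup>2) * (max 0 (1 - (norm x)\<^sup>2 / R\<^sup>2)) ^ (m - 1)) *\<^sub>R x)"
    using is_C1_I[OF * c] by auto
qed

lemma cutoff_nonneg: "0 \<le> cutoff m R x"
  by (simp add: cutoff_def)

lemma cutoff_le_1: "cutoff m R x \<le> 1"
  unfolding cutoff_def by (rule power_le_one) auto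

lemma cutoff_eq_0:
  assumes "0 < R" "0 < m" "x \<notin> cball 0 R" shows "cutoff m R x = 0"
proof -
  have "R\<^sup>2 \<le> (norm x)\<^sup>2" using assms by (intro power_mono) auto
  then have "1 - (norm x)\<^sup>2 / R\<^sup>2 \<le> 0" using assms by (simp add: field_simps)
  then show ?thesis using assms(2) by (simp add: cutoff_def max_def zero_power)
qed

subsection \<open>Continuity of translation in \<open>L\<^sup>1\<close>\<close>

lemma lborel_shift:
  fixes F :: "'a::euclidean_space \<Rightarrow> 'b::{banach, second_countable_topology}"
  assumes [measurable]: "F \<in> borel_measurable borel"
  shows "integrable lborel (\<lambda>x. F (x + y)) \<longleftrightarrow> integrable lborel F"
    "integral\<^sup>L lborel (\<lambda>x. F (x + y)) = integral\<^sup>L lborel F"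
proof -
  have d: "distr lborel borel (\<lambda>x. x + y) = lborel"
    using lborel_distr_plus[of y] by (simp add: add.commute[of _ y] fun_eq_iff cong: distr_cong)
  have "integrable (distr lborel borel (\<lambda>x. x + y)) F \<longleftrightarrow> integrable lborel (\<lambda>x. F (x + y))"
    by (subst integrable_distr_eq) auto
  then show "integrable lborel (\<lambda>x. F (x + y)) \<longleftrightarrow> integrable lborel F"
    by (simp add: d)
  have "integral\<^sup>L (distr lborel borel (\<lambda>x. x + y)) F = integral\<^sup>L lborel (\<lambda>x. F (x + y))"
    by (subst integral_distr) auto
  then show "integral\<^sup>L lborel (\<lambda>x. F (x + y)) = integral\<^sup>L lborel F"
    by (simp add: d)
qed

lemma lborel_reflect:
  fixes F :: "'a::euclidean_space \<Rightarrow> 'b::{banach, second_countable_topology}"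
  assumes [measurable]: "F \<in> borel_measurable borel"
  shows "integrable lborel (\<lambda>y. F (x - y)) \<longleftrightarrow> integrable lborel F"
    "integral\<^sup>L lborel (\<lambda>y. F (x - y)) = integral\<^sup>L lborel F"
proof -
  have "(lborel::'a measure) = density (distr lborel borel (\<lambda>y. x + (-1) *\<^sub>R y)) (\<lambda>_. 1)"
    using lborel_affine[of "-1" x] by simp
  then have d: "distr lborel borel (\<lambda>y. x - y) = (lborel::'a measure)"
    by (simp add: density_1)
  have "integrable (distr lborel borel (\<lambda>y. x - y)) F \<longleftrightarrow> integrable lborel (\<lambda>y. F (x - y))"
    by (subst integrable_distr_eq) auto
  then show "integrable lborel (\<lambda>y. F (x - y)) \<longleftrightarrow> integrable lborel F"
    by (simp add: d)
  have "integral\<^sup>L (distr lborel borel (\<lambda>y. x - y)) F = integral\<^sup>L lborel (\<lambda>y. F (x - y))"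
    by (subst integral_distr) auto
  then show "integral\<^sup>L lborel (\<lambda>y. F (x - y)) = integral\<^sup>L lborel F"
    by (simp add: d)
qed

lemma integrable_translate_diff:
  fixes f :: "'a::euclidean_space \<Rightarrow> 'b::{banach, second_countable_topology}"
  assumes "integrable lborel f"
  shows "integrable lborel (\<lambda>x. f (x + y) - f x)"
  using assms lborel_shift(1)[of f y] borel_measurable_integrable[OF assms] by simp

text \<open>Replacing \<open>f\<close> by \<open>g\<close> costs the L1 distance twice, once at
  \<open>x\<close> and once at \<open>x + y\<close>; translation invariance makes both errors equal.
  This drives the density argument for \<open>translate_L1\<close>.\<close>

lemma translate_diff_perturb:
  fixes f g :: "'a::euclidean_space \<Rightarrow> 'b::{banach, second_countable_topology}"
  assumes f: "integrable lborel f" and g: "integrable lborel g"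
  shows "(\<integral>x. norm (f (x + y) - f x) \<partial>lborel) \<le>
    (\<integral>x. norm (g (x + y) - g x) \<partial>lborel) + 2 * (\<integral>x. norm (f x - g x) \<partial>lborel)"
proof -
  have fg: "integrable lborel (\<lambda>x. f x - g x)" using f g by simp
  have [measurable]: "f \<in> borel_measurable borel" "g \<in> borel_measurable borel"
    using f g by auto
  have fgs: "integrable lborel (\<lambda>x. f (x + y) - g (x + y))"
    using fg lborel_shift(1)[of "\<lambda>x. f x - g x" y] by simp
  have "(\<integral>x. norm (f (x + y) - f x) \<partial>lborel) \<le>
     (\<integral>x. norm (g (x + y) - g x) + (norm (f (x + y) - g (x + y)) + norm (f x - g x)) \<partial>lborel)"
  proof (rule integral_mono)
    fix x
    have "norm ((g (x + y) - g x) + ((f (x + y) - g (x + y)) - (f x - g x))) \<le>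
        norm (g (x + y) - g x) + (norm (f (x + y) - g (x + y)) + norm (f x - g x))"
      by (intro norm_triangle_le add_left_mono norm_triangle_ineq4)
    then show "norm (f (x + y) - f x) \<le>
        norm (g (x + y) - g x) + (norm (f (x + y) - g (x + y)) + norm (f x - g x))"
      by (simp add: algebra_simps)
  qed (use integrable_translate_diff[OF f] integrable_translate_diff[OF g] fg fgs in auto)
  also have "\<dots> = (\<integral>x. norm (g (x + y) - g x) \<partial>lborel) + ((\<integral>x. norm (f (x + y) - g (x + y)) \<partial>lborel) +
      (\<integral>x. norm (f x - g x) \<partial>lborel))"
    using integrable_translate_diff[OF g] fg fgs by simp
  also have "(\<integral>x. norm (f (x + y) - g (x + y)) \<partial>lborel) = (\<integral>x. norm (f x - g x) \<partial>lborel)"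
    using lborel_shift(2)[of "\<lambda>x. norm (f x - g x)" y] by simp
  finally show ?thesis by simp
qed

text \<open>For indicators \<open>|a - b| = a + b - 2ab\<close>, so only the overlap integral needs
  a limit. On \<open>U\<close> openness gives pointwise convergence, and off \<open>U\<close> the
  product vanishes, although the shifted indicator alone may fail to converge on the
  boundary.\<close>

lemma translate_L1_open:
  fixes U :: "'a::euclidean_space set"
  assumes U: "open U" "emeasure lborel U < \<infinity>" and Y: "Y \<longlonglongrightarrow> 0"
  shows "(\<lambda>n. \<integral>x. \<bar>indicat_real U (x + Y n) - indicat_real U x\<bar> \<partial>lborel) \<longlonglongrightarrow> 0"
proof -
  have [measurable]: "U \<in> sets borel" using U by simp
  have iU: "integrable lborel (indicat_real U)"
    using U by simp
  have iUs: "integrable lborel (\<lambda>x. indicat_real U (x + y))" for y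
    using iU lborel_shift(1)[of "indicat_real U" y] by simp
  have ip: "integrable lborel (\<lambda>x. indicat_real U (x + y) * indicat_real U x)" for y
    by (rule Bochner_Integration.integrable_bound[OF iU]) (auto simp: indicator_def)
  have "(\<lambda>n. \<integral>x. indicat_real U (x + Y n) * indicat_real U x \<partial>lborel) \<longlonglongrightarrow>
      (\<integral>x. indicat_real U x \<partial>lborel)"
  proof (rule integral_dominated_convergence[where w = "indicat_real U"])
    show "AE x in lborel. (\<lambda>n. indicat_real U (x + Y n) * indicat_real U x) \<longlonglongrightarrow> indicat_real U x"
    proof (rule AE_I2)
      fix x
      show "(\<lambda>n. indicat_real U (x + Y n) * indicat_real U x) \<longlonglongrightarrow> indicat_real U x"
      proof (cases "x \<in> U")
        case True
        have "(\<lambda>n. x + Y n) \<longlonglongrightarrow> x" using tendsto_add[OF tendsto_const Y, of x] by simp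
        then have "eventually (\<lambda>n. x + Y n \<in> U) sequentially"
          using U(1) True by (simp add: topological_tendstoD)
        then show ?thesis
          using True by (intro tendsto_eventually) (auto elim!: eventually_mono)
      qed simp
    qed
  qed (auto simp: iU indicator_def)
  then have "(\<lambda>n. 2 * (\<integral>x. indicat_real U x \<partial>lborel) -
      2 * (\<integral>x. indicat_real U (x + Y n) * indicat_real U x \<partial>lborel)) \<longlonglongrightarrow> 0"
    by (auto intro!: tendsto_eq_intros)
  moreover have "(\<integral>x. \<bar>indicat_real U (x + Y n) - indicat_real U x\<bar> \<partial>lborel) =
     2 * (\<integral>x. indicat_real U x \<partial>lborel) -
      2 * (\<integral>x. indicat_real U (x + Y n) * indicat_real U x \<partial>lborel)" for n
  proof -
    have "(\<integral>x. \<bar>indicat_real U (x + Y n) - indicat_real U x\<bar> \<partial>lborel) =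
      (\<integral>x. indicat_real U (x + Y n) + indicat_real U x -
        2 * (indicat_real U (x + Y n) * indicat_real U x) \<partial>lborel)"
      by (intro Bochner_Integration.integral_cong) (auto simp: indicator_def)
    also have "\<dots> = (\<integral>x. indicat_real U (x + Y n) \<partial>lborel) + (\<integral>x. indicat_real U x \<partial>lborel) -
        2 * (\<integral>x. indicat_real U (x + Y n) * indicat_real U x \<partial>lborel)"
      using iU iUs ip by simp
    finally show ?thesis
      using lborel_shift(2)[of "indicat_real U" "Y n"] by simp
  qed
  ultimately show ?thesis by simp
qed

text \<open>Induction over integrable functions: indicators reduce to open sets by outer regularity,
  sums to the triangle inequality, limits to L1 approximation. The quantifier over \<open>Y\<close>
  stays inside so that the induction hypotheses cover all null sequences.\<close>

lemma translate_L1: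
  fixes f :: "'a::euclidean_space \<Rightarrow> 'b::{banach, second_countable_topology}"
  assumes "integrable lborel f"
  shows "\<forall>Y. Y \<longlonglongrightarrow> 0 \<longrightarrow> (\<lambda>n. \<integral>x. norm (f (x + Y n) - f x) \<partial>lborel) \<longlonglongrightarrow> 0"
  using assms
proof (induction rule: integrable_induct)
  case (base A c)
  then have A[measurable]: "A \<in> sets borel" and fin: "emeasure lborel A < \<infinity>" by auto
  show ?case
  proof (intro allI impI LIMSEQ_I)
    fix Y :: "nat \<Rightarrow> 'a" and e :: real
    assume Y: "Y \<longlonglongrightarrow> 0" and e: "0 < e"
    \<comment> \<open>One \<open>d\<close> comes from the open set and two from the exchange of
      \<open>A\<close> for \<open>U\<close>, so \<open>3 * d * norm c < e\<close> is wanted; the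
      \<open>+ 1\<close> guards against \<open>c = 0\<close>.\<close>
    define d where "d = e / (4 * (norm c + 1))"
    have d: "0 < d" "norm c * d * 4 < e"
      using e by (auto simp: d_def field_simps add_pos_nonneg intro!: divide_pos_pos)
    obtain U where U: "open U" "A \<subseteq> U" "emeasure lborel (U - A) < d"
      using outer_regular_lborel[OF A d(1)] by blast
    have [measurable]: "U \<in> sets borel" using U by simp
    have "emeasure lborel U = emeasure lborel A + emeasure lborel (U - A)"
      using U(2) by (subst plus_emeasure) (auto simp: Un_absorb1)
    then have finU: "emeasure lborel U < \<infinity>"
      using fin U(3) by (auto simp: less_top[symmetric])
    have iA: "integrable lborel (indicat_real A)" and iU: "integrable lborel (indicat_real U)"
      using fin finU by auto
    have "(\<integral>x. norm (indicat_real A x - indicat_real U x) \<partial>lborel) = (\<integral>x. indicat_real (U - A) x \<partial>lborel)"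
      using U(2) by (intro Bochner_Integration.integral_cong) (auto simp: indicator_def)
    also have "\<dots> = measure lborel (U - A)" by simp
    also have "\<dots> < d"
    proof -
      have "emeasure lborel (U - A) \<noteq> \<infinity>" using U(3) by auto
      then show ?thesis
        using U(3) by (simp add: emeasure_eq_ennreal_measure ennreal_less_iff)
    qed
    finally have AU: "(\<integral>x. norm (indicat_real A x - indicat_real U x) \<partial>lborel) < d" .
    obtain N where N: "\<And>n. n \<ge> N \<Longrightarrow> (\<integral>x. \<bar>indicat_real U (x + Y n) - indicat_real U x\<bar> \<partial>lborel) < d"
      using LIMSEQ_D[OF translate_L1_open[OF U(1) finU Y] d(1)] by auto
    show "\<exists>N. \<forall>n\<ge>N. norm ((\<integral>x. norm (indicator A (x + Y n) *\<^sub>R c - indicator A x *\<^sub>R c) \<partial>lborel) - 0) < e"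
    proof (intro exI allI impI)
      fix n assume "N \<le> n"
      then have "(\<integral>x. norm (indicat_real A (x + Y n) - indicat_real A x) \<partial>lborel) < 3 * d"
        using translate_diff_perturb[OF iA iU, of "Y n"] N[of n] AU by simp
      then have "norm c * (\<integral>x. norm (indicat_real A (x + Y n) - indicat_real A x) \<partial>lborel) \<le> norm c * (3 * d)"
        by (intro mult_left_mono) auto
      also have "\<dots> < e"
      proof -
        have "0 \<le> norm c * d" using d(1) by simp
        moreover have "norm c * (3 * d) = 3 * (norm c * d)" by simp
        ultimately show ?thesis using d(2) by linarith
      qed
      finally have "norm c * (\<integral>x. norm (indicat_real A (x + Y n) - indicat_real A x) \<partial>lborel) < e" .
      moreover have "(\<integral>x. norm (indicator A (x + Y n) *\<^sub>R c - indicator A x *\<^sub>R c) \<partial>lborel) =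
        norm c * (\<integral>x. norm (indicat_real A (x + Y n) - indicat_real A x) \<partial>lborel)"
        by (simp flip: scaleR_diff_left integral_mult_right_zero add: mult.commute)
      moreover have "0 \<le> (\<integral>x. norm (indicator A (x + Y n) *\<^sub>R c - indicator A x *\<^sub>R c) \<partial>lborel)"
        by (rule Bochner_Integration.integral_nonneg) auto
      ultimately show "norm ((\<integral>x. norm (indicator A (x + Y n) *\<^sub>R c - indicator A x *\<^sub>R c) \<partial>lborel) - 0) < e"
        by simp
    qed
  qed
next
  case (add f g)
  show ?case
  proof (intro allI impI)
    fix Y :: "nat \<Rightarrow> 'a" assume Y: "Y \<longlonglongrightarrow> 0"
    have lim0: "(\<lambda>n. (\<integral>x. norm (f (x + Y n) - f x) \<partial>lborel) + (\<integral>x. norm (g (x + Y n) - g x) \<partial>lborel)) \<longlonglongrightarrow> 0"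
      using add Y by (intro tendsto_add_zero) auto
    have "(\<integral>x. norm ((f (x + Y n) + g (x + Y n)) - (f x + g x)) \<partial>lborel) \<le>
       (\<integral>x. norm (f (x + Y n) - f x) \<partial>lborel) + (\<integral>x. norm (g (x + Y n) - g x) \<partial>lborel)" for n
    proof -
      have "(\<integral>x. norm ((f (x + Y n) + g (x + Y n)) - (f x + g x)) \<partial>lborel) \<le>
        (\<integral>x. norm (f (x + Y n) - f x) + norm (g (x + Y n) - g x) \<partial>lborel)"
        using integrable_translate_diff[OF add.hyps(1), of "Y n"] integrable_translate_diff[OF add.hyps(2), of "Y n"]
          integrable_translate_diff[OF Bochner_Integration.integrable_add[OF add.hyps], of "Y n"]
        by (intro integral_mono) (auto simp: add_diff_add norm_triangle_ineq)
      then show ?thesis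
        using integrable_translate_diff[OF add.hyps(1), of "Y n"] integrable_translate_diff[OF add.hyps(2), of "Y n"]
        by simp
    qed
    then show "(\<lambda>n. \<integral>x. norm ((f (x + Y n) + g (x + Y n)) - (f x + g x)) \<partial>lborel) \<longlonglongrightarrow> 0"
      by (intro Lim_null_comparison[OF always_eventually lim0] allI) (simp add: abs_of_nonneg)
  qed
next
  case (lim f s)
  \<comment> \<open>The approximants provided by the induction rule satisfy
    \<open>norm (s i x) \<le> 2 * norm (f x)\<close>, which explains the dominating function
    \<open>3 * norm (f x)\<close>.\<close>
  have conv: "(\<lambda>i. \<integral>x. norm (f x - s i x) \<partial>lborel) \<longlonglongrightarrow> (\<integral>x. 0 \<partial>(lborel::'a measure))"
  proof (rule integral_dominated_convergence[where w = "\<lambda>x. 3 * norm (f x)"])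
    show "AE x in lborel. (\<lambda>i. norm (f x - s i x)) \<longlonglongrightarrow> 0"
    proof (rule AE_I2)
      fix x :: 'a
      have "(\<lambda>i. norm (f x - s i x)) \<longlonglongrightarrow> norm (f x - f x)"
        using lim.hyps(2)[of x] by (intro tendsto_intros) simp
      then show "(\<lambda>i. norm (f x - s i x)) \<longlonglongrightarrow> 0" by simp
    qed
    show "AE x in lborel. norm (norm (f x - s i x)) \<le> 3 * norm (f x)" for i
    proof (rule AE_I2)
      fix x :: 'a
      show "norm (norm (f x - s i x)) \<le> 3 * norm (f x)"
        using lim.hyps(3)[of x i] norm_triangle_ineq4[of "f x" "s i x"] by simp
    qed
  qed (use lim in auto)
  show ?case
  proof (intro allI impI LIMSEQ_I)
    fix Y :: "nat \<Rightarrow> 'a" and e :: real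
    assume Y: "Y \<longlonglongrightarrow> 0" and e: "0 < e"
    obtain i where i: "(\<integral>x. norm (f x - s i x) \<partial>lborel) < e / 3"
      using LIMSEQ_D[OF conv, of "e / 3"] e by auto
    have "(\<lambda>n. \<integral>x. norm (s i (x + Y n) - s i x) \<partial>lborel) \<longlonglongrightarrow> 0"
      using lim.IH[of i] Y by blast
    from LIMSEQ_D[OF this, of "e/3"] e obtain N where
      N: "\<And>n. n \<ge> N \<Longrightarrow> (\<integral>x. norm (s i (x + Y n) - s i x) \<partial>lborel) < e / 3"
      by auto
    show "\<exists>N. \<forall>n\<ge>N. norm ((\<integral>x. norm (f (x + Y n) - f x) \<partial>lborel) - 0) < e"
    proof (intro exI allI impI)
      fix n assume "N \<le> n"
      then show "norm ((\<integral>x. norm (f (x + Y n) - f x) \<partial>lborel) - 0) < e"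
        using translate_diff_perturb[OF lim.hyps(4) lim.hyps(1)[of i], of "Y n"] N[of n] i by simp
    qed
  qed
qed

lemma translate_L1_uniform:
  fixes f :: "'a::euclidean_space \<Rightarrow> 'b::{banach, second_countable_topology}"
  assumes "integrable lborel f" "0 < e"
  obtains d where "0 < d" "\<And>y. norm y \<le> d \<Longrightarrow> (\<integral>x. norm (f (x + y) - f x) \<partial>lborel) < e"
proof -
  have "continuous (at 0) (\<lambda>y. \<integral>x. norm (f (x + y) - f x) \<partial>lborel)"
    unfolding continuous_at_sequentially using translate_L1[OF assms(1)] by (simp add: o_def)
  then obtain d where "0 < d" and d: "\<And>y. dist y 0 < d \<Longrightarrow> dist (\<integral>x. norm (f (x + y) - f x) \<partial>lborel) 0 < e"
    using assms(2) unfolding continuous_at_eps_delta by (auto simp: dist_norm)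
  have "(\<integral>x. norm (f (x + y) - f x) \<partial>lborel) < e" if "norm y \<le> d / 2" for y
    using d[of y] that \<open>0 < d\<close> by auto
  with that[of "d / 2"] \<open>0 < d\<close> show thesis by auto
qed

subsection \<open>Convolution with a \<open>C\<^sup>1\<close> kernel\<close>

text \<open>Because \<open>k\<close> has unit mass, \<open>f x\<close> can be moved under the
  convolution integral; Tonelli then averages the translation errors of \<open>f\<close> over the
  support of \<open>k\<close>. Nonnegative integrals are used so that the order can be exchanged
  before any finiteness is known.\<close>

lemma convolution_L1_close:
  fixes f :: "'a::euclidean_space \<Rightarrow> 'b::{banach, second_countable_topology}" and k :: "'a \<Rightarrow> real"
  assumes f: "integrable lborel f" and k: "integrable lborel k" "\<And>x. 0 \<le> k x" "integral\<^sup>L lborel k = 1"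
    and supp: "\<And>x. norm x > d \<Longrightarrow> k x = 0"
    and close: "\<And>y. norm y \<le> d \<Longrightarrow> (\<integral>x. norm (f (x + y) - f x) \<partial>lborel) \<le> e"
  shows "(\<integral>\<^sup>+x. norm ((\<integral>y. k (x - y) *\<^sub>R f y \<partial>lborel) - f x) \<partial>lborel) \<le> ennreal e"
proof -
  have [measurable]: "f \<in> borel_measurable borel" "k \<in> borel_measurable borel"
    using f k by auto
  \<comment> \<open>An infinite right-hand side is trivial; a finite one is exactly the
    integrability that allows the Bochner integral to be split.\<close>
  have pw: "ennreal (norm ((\<integral>y. k (x - y) *\<^sub>R f y \<partial>lborel) - f x)) \<le>
      (\<integral>\<^sup>+y. ennreal (k y) * ennreal (norm (f (x - y) - f x)) \<partial>lborel)" (is "_ \<le> ?G x") for x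
  proof (cases "?G x = \<infinity>")
    case False
    have G: "?G x = (\<integral>\<^sup>+y. ennreal (norm (k y *\<^sub>R (f (x - y) - f x))) \<partial>lborel)"
      by (intro nn_integral_cong) (simp add: k(2) ennreal_mult)
    have i1: "integrable lborel (\<lambda>y. k y *\<^sub>R (f (x - y) - f x))"
      using False unfolding G by (intro integrableI_bounded) (auto simp: less_top)
    have i2: "integrable lborel (\<lambda>y. k y *\<^sub>R f x)" using k(1) by simp
    have "(\<integral>y. k (x - y) *\<^sub>R f y \<partial>lborel) = (\<integral>y. k y *\<^sub>R f (x - y) \<partial>lborel)"
      using lborel_reflect(2)[of "\<lambda>y. k y *\<^sub>R f (x - y)" x] by simp
    also have "\<dots> = (\<integral>y. k y *\<^sub>R (f (x - y) - f x) + k y *\<^sub>R f x \<partial>lborel)"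
      by (simp add: algebra_simps)
    also have "\<dots> = (\<integral>y. k y *\<^sub>R (f (x - y) - f x) \<partial>lborel) + f x"
      using i1 i2 k(1,3) by simp
    finally have "(\<integral>y. k (x - y) *\<^sub>R f y \<partial>lborel) - f x = (\<integral>y. k y *\<^sub>R (f (x - y) - f x) \<partial>lborel)"
      by simp
    then show ?thesis
      using integral_norm_bound_ennreal[OF i1] G by simp
  qed simp
  have "(\<integral>\<^sup>+x. norm ((\<integral>y. k (x - y) *\<^sub>R f y \<partial>lborel) - f x) \<partial>lborel) \<le>
      (\<integral>\<^sup>+x. \<integral>\<^sup>+y. ennreal (k y) * ennreal (norm (f (x - y) - f x)) \<partial>lborel \<partial>lborel)"
    by (intro nn_integral_mono pw)
  also have "\<dots> = (\<integral>\<^sup>+y. \<integral>\<^sup>+x. ennreal (k y) * ennreal (norm (f (x - y) - f x)) \<partial>lborel \<partial>lborel)"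
    by (rule lborel_pair.Fubini') measurable
  also have "\<dots> \<le> (\<integral>\<^sup>+y. ennreal (k y) * ennreal e \<partial>lborel)"
  proof (rule nn_integral_mono)
    fix y :: 'a
    show "(\<integral>\<^sup>+x. ennreal (k y) * ennreal (norm (f (x - y) - f x)) \<partial>lborel) \<le> ennreal (k y) * ennreal e"
    proof (cases "norm y \<le> d")
      case True
      have "(\<integral>\<^sup>+x. ennreal (norm (f (x - y) - f x)) \<partial>lborel) = ennreal (\<integral>x. norm (f (x - y) - f x) \<partial>lborel)"
        using integrable_translate_diff[OF f, of "- y"] by (intro nn_integral_eq_integral) auto
      also have "\<dots> \<le> ennreal e"
        using close[of "- y"] True by (simp add: ennreal_leI)
      finally show ?thesis
        by (simp add: nn_integral_cmult mult_left_mono)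
    qed (use supp in simp)
  qed
  also have "\<dots> = ennreal e"
    using k by (simp add: nn_integral_multc nn_integral_eq_integral)
  finally show ?thesis .
qed

text \<open>Borel measurability, unlike Lebesgue measurability, is stable under the compositions
  with \<open>x - y\<close> on the product space that convolution and Tonelli require.\<close>

definition loc_int :: "('a::euclidean_space \<Rightarrow> 'b::{banach, second_countable_topology}) \<Rightarrow> bool" where
  "loc_int f \<longleftrightarrow> f \<in> borel_measurable borel \<and> (\<forall>R. integrable lborel (\<lambda>x. indicat_real (cball 0 R) x *\<^sub>R f x))"

lemma loc_int_norm:
  assumes "loc_int f" shows "integrable lborel (\<lambda>x. indicat_real (cball 0 R) x * norm (f x))"
proof -
  have "integrable lborel (\<lambda>x. norm (indicat_real (cball 0 R) x *\<^sub>R f x))"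
    by (rule integrable_norm) (use assms in \<open>simp add: loc_int_def\<close>)
  then show ?thesis by simp
qed

lemma dominated_loc_int:
  fixes f :: "'a::euclidean_space \<Rightarrow> 'b::{banach, second_countable_topology}" and g :: "nat \<Rightarrow> 'a \<Rightarrow> 'c::{banach, second_countable_topology}"
  assumes "loc_int f" "\<And>n. g n \<in> borel_measurable borel" "g' \<in> borel_measurable borel"
    and bound: "\<And>n y. norm (g n y) \<le> C * (indicat_real (cball 0 R) y * norm (f y))"
    and lim: "\<And>y. (\<lambda>n. g n y) \<longlonglongrightarrow> g' y"
  shows "(\<lambda>n. \<integral>y. g n y \<partial>lborel) \<longlonglongrightarrow> (\<integral>y. g' y \<partial>lborel)"
  by (rule integral_dominated_convergence[where w = "\<lambda>y. C * (indicat_real (cball 0 R) y * norm (f y))"])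
    (use assms loc_int_norm[OF assms(1), of R] in auto)

lemma bounded_of_support:
  fixes K :: "'a::euclidean_space \<Rightarrow> 'b::real_normed_vector"
  assumes "continuous_on UNIV K" "\<And>x. norm x > d \<Longrightarrow> K x = 0"
  obtains L where "0 \<le> L" "\<And>x. norm (K x) \<le> L"
proof -
  have "compact (K ` cball 0 d)"
    using assms(1) by (intro compact_continuous_image) (auto intro: continuous_on_subset)
  then have "bounded (K ` cball 0 d)" by (rule compact_imp_bounded)
  then obtain L where L: "\<And>x. x \<in> cball 0 d \<Longrightarrow> norm (K x) \<le> L"
    unfolding bounded_iff by blast
  have "norm (K x) \<le> max 0 L" for x
    using L[of x] assms(2)[of x] norm_ge_zero[of "K x"] by (cases "norm x > d") auto
  with that[of "max 0 L"] show thesis by auto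
qed

text \<open>A convergent sequence of base points is bounded by some \<open>B\<close>, so all shifted
  kernels live in the ball of radius \<open>B + d\<close> and share one dominating function.\<close>

lemma continuous_convolution:
  fixes u :: "'a::euclidean_space \<Rightarrow> real" and K :: "'a \<Rightarrow> 'a"
  assumes u: "loc_int u" and K: "continuous_on UNIV K" "\<And>x. norm x > d \<Longrightarrow> K x = 0"
  shows "continuous_on UNIV (\<lambda>x. \<integral>y. u y *\<^sub>R K (x - y) \<partial>lborel)"
proof -
  have [measurable]: "u \<in> borel_measurable borel" "K \<in> borel_measurable borel"
    using u K(1) by (auto simp: loc_int_def intro: borel_measurable_continuous_onI)
  obtain L where L: "0 \<le> L" "\<And>x. norm (K x) \<le> L"
    using bounded_of_support[OF K] by blast
  have "continuous (at x) (\<lambda>x. \<integral>y. u y *\<^sub>R K (x - y) \<partial>lborel)" for x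
    unfolding continuous_at_sequentially
  proof (intro allI impI)
    fix X assume X: "X \<longlonglongrightarrow> x"
    then obtain B where B: "\<And>n. norm (X n) \<le> B"
      using convergent_imp_Bseq[of X] unfolding convergent_def Bseq_def by auto
    show "((\<lambda>x. \<integral>y. u y *\<^sub>R K (x - y) \<partial>lborel) \<circ> X) \<longlonglongrightarrow> (\<integral>y. u y *\<^sub>R K (x - y) \<partial>lborel)"
      unfolding o_def
    proof (rule dominated_loc_int[OF u, where C = L and R = "B + d"])
      fix n y
      show "norm (u y *\<^sub>R K (X n - y)) \<le> L * (indicat_real (cball 0 (B + d)) y * norm (u y))"
      proof (cases "norm y \<le> B + d")
        case True
        then show ?thesis using mult_left_mono[OF L(2)[of "X n - y"], of "\<bar>u y\<bar>"] by (simp add: mult.commute)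
      next
        case False
        then have "norm (X n - y) > d"
          using B[of n] norm_triangle_sub[of y "X n"] by (simp add: norm_minus_commute)
        then show ?thesis using K(2) L(1) by simp
      qed
    next
      fix y
      have "isCont K (x - y)" using K(1) by (simp add: continuous_on_eq_continuous_at)
      then show "(\<lambda>n. u y *\<^sub>R K (X n - y)) \<longlonglongrightarrow> u y *\<^sub>R K (x - y)"
        using X by (intro tendsto_intros isCont_tendsto_compose[of _ K])
    qed measurable
  qed
  then show ?thesis by (simp add: continuous_on_eq_continuous_at)
qed

text \<open>Differentiation under the integral: \<open>k\<close> is Lipschitz, so the normalised
  first-order remainder of \<open>k\<close> is bounded uniformly, tends to 0 pointwise, and
  dominated convergence applies.\<close>

lemma GDERIV_convolution:
  fixes u k :: "'a::euclidean_space \<Rightarrow> real"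
  assumes u: "loc_int u" and k: "is_C1 k" "\<And>x. norm x > d \<Longrightarrow> k x = 0"
  shows "GDERIV (\<lambda>x. \<integral>y. k (x - y) * u y \<partial>lborel) x :> (\<integral>y. u y *\<^sub>R grad k (x - y) \<partial>lborel)"
proof -
  have ck: "continuous_on UNIV k" and cg: "continuous_on UNIV (grad k)"
    using k(1) by (simp_all add: is_C1_continuous is_C1_continuous_grad)
  have g0: "grad k x = 0" if "norm x > d" for x
    using grad_eq_0_outside[OF k(1), of 0 d x] k(2) that by simp
  have [measurable]: "u \<in> borel_measurable borel" "k \<in> borel_measurable borel" "grad k \<in> borel_measurable borel"
    using u ck cg by (auto simp: loc_int_def intro: borel_measurable_continuous_onI)
  obtain L where L: "0 \<le> L" "\<And>x. norm (grad k x) \<le> L"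
    using bounded_of_support[OF cg g0] by blast
  obtain L' where L': "0 \<le> L'" "\<And>x. norm (k x) \<le> L'"
    using bounded_of_support[OF ck k(2)] by blast
  have lip: "\<bar>k a - k b\<bar> \<le> L * norm (a - b)" for a b
  proof -
    have "norm (k a - k b) \<le> L * norm (a - b)"
    proof (rule differentiable_bound[of UNIV])
      fix x show "(k has_derivative (\<lambda>h. h \<bullet> grad k x)) (at x within UNIV)"
        using is_C1_GDERIV[OF k(1), of x] by (simp add: gderiv_def)
      show "onorm (\<lambda>h. h \<bullet> grad k x) \<le> L"
      proof (rule onorm_le)
        fix h show "norm (h \<bullet> grad k x) \<le> L * norm h"
          using Cauchy_Schwarz_ineq2[of h "grad k x"] mult_left_mono[OF L(2)[of x], of "norm h"]
          by (simp add: mult.commute)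
      qed
    qed auto
    then show ?thesis by simp
  qed
  have ik: "integrable lborel (\<lambda>y. k (z - y) * u y)" for z
  proof (rule Bochner_Integration.integrable_bound)
    show "integrable lborel (\<lambda>y. L' * (indicat_real (cball 0 (norm z + d)) y * norm (u y)))"
      using loc_int_norm[OF u] by simp
    show "AE y in lborel. norm (k (z - y) * u y) \<le> norm (L' * (indicat_real (cball 0 (norm z + d)) y * norm (u y)))"
    proof (rule AE_I2)
      fix y
      show "norm (k (z - y) * u y) \<le> norm (L' * (indicat_real (cball 0 (norm z + d)) y * norm (u y)))"
      proof (cases "norm y \<le> norm z + d")
        case True
        then show ?thesis using mult_right_mono[OF L'(2)[of "z - y"], of "\<bar>u y\<bar>"] L'(1) by (simp add: abs_mult)
      next
        case False
        then have "norm (z - y) > d"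
          using norm_triangle_sub[of y z] by (simp add: norm_minus_commute)
        then show ?thesis using k(2) L'(1) by simp
      qed
    qed
  qed measurable
  have ig: "integrable lborel (\<lambda>y. u y *\<^sub>R grad k (z - y))" for z
  proof (rule Bochner_Integration.integrable_bound)
    show "integrable lborel (\<lambda>y. L * (indicat_real (cball 0 (norm z + d)) y * norm (u y)))"
      using loc_int_norm[OF u] by simp
    show "AE y in lborel. norm (u y *\<^sub>R grad k (z - y)) \<le> norm (L * (indicat_real (cball 0 (norm z + d)) y * norm (u y)))"
    proof (rule AE_I2)
      fix y
      show "norm (u y *\<^sub>R grad k (z - y)) \<le> norm (L * (indicat_real (cball 0 (norm z + d)) y * norm (u y)))"
      proof (cases "norm y \<le> norm z + d")
        case True
        then show ?thesis using mult_left_mono[OF L(2)[of "z - y"], of "\<bar>u y\<bar>"] L(1) by (simp add: abs_mult mult.commute)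
      next
        case False
        then have "norm (z - y) > d"
          using norm_triangle_sub[of y z] by (simp add: norm_minus_commute)
        then show ?thesis using g0 L(1) by simp
      qed
    qed
  qed measurable
  let ?U = "\<lambda>x. \<integral>y. k (x - y) * u y \<partial>lborel" and ?D = "\<integral>y. u y *\<^sub>R grad k (x - y) \<partial>lborel"
  have "((\<lambda>h. (?U (x + h) - ?U x - h \<bullet> ?D) /\<^sub>R norm h) \<longlongrightarrow> 0) (at 0)"
    unfolding tendsto_at_iff_sequentially
  proof (intro allI impI)
    fix X :: "nat \<Rightarrow> 'a" assume X0: "\<forall>i. X i \<in> UNIV - {0}" and X: "X \<longlonglongrightarrow> 0"
    then obtain B where B: "\<And>n. norm (X n) \<le> B"
      using convergent_imp_Bseq[of X] unfolding convergent_def Bseq_def by auto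
    then have B0: "0 \<le> B" by (metis norm_ge_zero order_trans)
    \<comment> \<open>The remainder of the first-order expansion of \<open>k\<close> at
      \<open>a\<close>, divided by \<open>norm h\<close>. The Lipschitz constant \<open>L\<close>
      and the bound \<open>L\<close> on the gradient give \<open>2 * L\<close>.\<close>
    define r where "r a h = (k (a + h) - k a - h \<bullet> grad k a) / norm h" for a h
    have [measurable]: "(\<lambda>y. r (x - y) h) \<in> borel_measurable borel" for h
      unfolding r_def by measurable
    have rb: "\<bar>r a h\<bar> \<le> 2 * L" for a h
    proof (cases "h = 0")
      case False
      have "\<bar>h \<bullet> grad k a\<bar> \<le> norm h * L"
        by (meson Cauchy_Schwarz_ineq2 L(2) mult_left_mono norm_ge_zero order_trans)
      then have "\<bar>k (a + h) - k a - h \<bullet> grad k a\<bar> \<le> 2 * L * norm h"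
        using lip[of "a + h" a] abs_triangle_ineq4[of "k (a + h) - k a" "h \<bullet> grad k a"]
        by (simp add: algebra_simps)
      then show ?thesis using False by (simp add: r_def field_simps)
    qed (simp add: r_def L)
    have eq: "(?U (x + h) - ?U x - h \<bullet> ?D) /\<^sub>R norm h = (\<integral>y. r (x - y) h * u y \<partial>lborel)" for h
    proof -
      have "(\<integral>y. r (x - y) h * u y \<partial>lborel) =
        (\<integral>y. inverse (norm h) * (k (x + h - y) * u y - k (x - y) * u y - h \<bullet> (u y *\<^sub>R grad k (x - y))) \<partial>lborel)"
        by (intro Bochner_Integration.integral_cong) (auto simp: r_def algebra_simps divide_inverse)
      also have "\<dots> = inverse (norm h) * (?U (x + h) - ?U x - h \<bullet> ?D)"
        using ik[of "x + h"] ik[of x] ig[of x] by (simp del: inner_scaleR_right)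
      finally show ?thesis by simp
    qed
    have "(\<lambda>n. \<integral>y. r (x - y) (X n) * u y \<partial>lborel) \<longlonglongrightarrow> (\<integral>y. 0 \<partial>(lborel::'a measure))"
    proof (rule dominated_loc_int[OF u, where C = "2 * L" and R = "norm x + B + d"])
      fix n y
      show "norm (r (x - y) (X n) * u y) \<le> 2 * L * (indicat_real (cball 0 (norm x + B + d)) y * norm (u y))"
      proof (cases "norm y \<le> norm x + B + d")
        case True
        then show ?thesis using mult_right_mono[OF rb[of "x - y" "X n"], of "\<bar>u y\<bar>"] by (simp add: abs_mult)
      next
        case False
        then have *: "norm (x - y) > d + B"
          using norm_triangle_sub[of y x] by (simp add: norm_minus_commute)
        then have "norm (x - y) > d" using B0 by simp
        moreover have "norm (x - y + X n) > d"
          using * B[of n] norm_diff_ineq[of "x - y" "X n"] by simp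
        ultimately show ?thesis using k(2) g0 L(1) by (simp add: r_def)
      qed
    next
      fix y
      have "(k has_derivative (\<lambda>h. h \<bullet> grad k (x - y))) (at (x - y))"
        using is_C1_GDERIV[OF k(1)] by (simp add: gderiv_def)
      then have "((\<lambda>h. norm (r (x - y) h)) \<longlongrightarrow> 0) (at 0)"
        by (simp add: has_derivative_at r_def)
      then have "((\<lambda>h. r (x - y) h) \<longlongrightarrow> 0) (at 0)"
        by (rule tendsto_norm_zero_cancel)
      then have "(\<lambda>n. r (x - y) (X n)) \<longlonglongrightarrow> 0"
        using X0 X unfolding tendsto_at_iff_sequentially by (auto simp: o_def)
      then show "(\<lambda>n. r (x - y) (X n) * u y) \<longlonglongrightarrow> 0"
        by (rule tendsto_mult_left_zero)
    qed measurable
    then show "((\<lambda>h. (?U (x + h) - ?U x - h \<bullet> ?D) /\<^sub>R norm h) \<circ> X) \<longlonglongrightarrow> 0"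
      by (simp only: o_def eq) simp
  qed
  then have "((\<lambda>h. norm (?U (x + h) - ?U x - h \<bullet> ?D) / norm h) \<longlongrightarrow> 0) (at 0)"
    by (subst (asm) tendsto_norm_zero_iff[symmetric]) (simp add: divide_inverse mult.commute abs_mult)
  then show ?thesis
    by (simp add: gderiv_def has_derivative_at bounded_linear_inner_left)
qed

subsection \<open>Approximation of functions with a weak gradient\<close>

text \<open>A lower bound on half the radius, independent of \<open>R\<close>. It makes the mass of
  the kernel positive, and later keeps the cutoff away from 0 on a fixed ball while \<open>R\<close>
  grows.\<close>

lemma cutoff_ge:
  assumes "0 < R" "norm x \<le> R / 2" shows "(3/4) ^ m \<le> cutoff m R x"
proof -
  have "(norm x)\<^sup>2 \<le> (R / 2)\<^sup>2" using assms by (intro power_mono) auto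
  then have "3/4 \<le> 1 - (norm x)\<^sup>2 / R\<^sup>2" using assms by (simp add: field_simps power2_eq_square)
  then show ?thesis unfolding cutoff_def by (intro power_mono) (auto simp: le_max_iff_disj)
qed

lemma cutoff_measurable [measurable]: "cutoff m R \<in> borel_measurable borel"
  unfolding cutoff_def by measurable

lemma integrable_cutoff:
  assumes "0 < R" "0 < m"
  shows "integrable lborel (cutoff m R :: 'a::euclidean_space \<Rightarrow> real)"
proof (rule Bochner_Integration.integrable_bound)
  show "integrable lborel (indicat_real (cball (0::'a) R))"
    using emeasure_lborel_cball_finite[of "0::'a" R] by simp
  show "AE x in lborel. norm (cutoff m R x) \<le> norm (indicat_real (cball (0::'a) R) x)"
  proof (rule AE_I2)
    fix x :: 'a
    show "norm (cutoff m R x) \<le> norm (indicat_real (cball (0::'a) R) x)"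
      using cutoff_eq_0[OF assms, of x] cutoff_le_1[of m R x] cutoff_nonneg[of m R x]
      by (cases "x \<in> cball 0 R") auto
  qed
qed measurable

lemma integral_cutoff_pos:
  assumes "0 < R" "0 < m"
  shows "0 < integral\<^sup>L lborel (cutoff m R :: 'a::euclidean_space \<Rightarrow> real)"
proof -
  have fin: "emeasure lborel (ball (0::'a) (R / 2)) < \<infinity>"
    using emeasure_lborel_ball_finite[of "0::'a" "R / 2"] by simp
  have "0 < (3/4) ^ m * measure lborel (ball (0::'a) (R / 2))"
    using content_ball_pos[of "R / 2" "0::'a"] assms by simp
  also have "\<dots> = (\<integral>x. (3/4) ^ m * indicat_real (ball (0::'a) (R / 2)) x \<partial>lborel)"
    by simp
  also have "\<dots> \<le> (\<integral>x. cutoff m R (x::'a) \<partial>lborel)"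
  proof (rule integral_mono)
    show "integrable lborel (\<lambda>x. (3/4) ^ m * indicat_real (ball (0::'a) (R / 2)) x)"
      using fin by simp
    show "(3/4) ^ m * indicat_real (ball (0::'a) (R / 2)) x \<le> cutoff m R x" for x
      using cutoff_ge[OF assms(1), of x m] cutoff_nonneg[of m R x]
      by (cases "x \<in> ball 0 (R / 2)") auto
  qed (rule integrable_cutoff[OF assms])
  finally show ?thesis .
qed

text \<open>Exponent 2 yields a \<open>C^1\<close> kernel, so its translates qualify as test
  functions for weak gradients.\<close>

definition mollifier :: "real \<Rightarrow> 'a::euclidean_space \<Rightarrow> real" where
  "mollifier d x = cutoff 2 d x * inverse (integral\<^sup>L lborel (cutoff 2 d :: 'a \<Rightarrow> real))"

lemma mollifier:
  assumes "0 < d"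
  shows "is_C1 (mollifier d :: 'a::euclidean_space \<Rightarrow> real)"
    "integrable lborel (mollifier d :: 'a \<Rightarrow> real)" "integral\<^sup>L lborel (mollifier d :: 'a \<Rightarrow> real) = 1"
    "\<And>x::'a. 0 \<le> mollifier d x" "\<And>x::'a. norm x > d \<Longrightarrow> mollifier d x = 0"
proof -
  note pos = integral_cutoff_pos[OF assms, of 2, where 'a = 'a]
  show "is_C1 (mollifier d :: 'a \<Rightarrow> real)"
    unfolding mollifier_def[abs_def] by (intro is_C1_mult is_C1_cutoff is_C1_const) simp
  show "integrable lborel (mollifier d :: 'a \<Rightarrow> real)" "integral\<^sup>L lborel (mollifier d :: 'a \<Rightarrow> real) = 1"
    using integrable_cutoff[OF assms, of 2, where 'a = 'a] pos by (auto simp: mollifier_def[abs_def])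
  show "0 \<le> mollifier d x" for x :: 'a
    using pos by (simp add: mollifier_def cutoff_nonneg)
  show "mollifier d x = 0" if "norm x > d" for x :: 'a
    using that assms by (simp add: mollifier_def cutoff_eq_0)
qed

text \<open>For \<open>x\<close> in the ball of radius \<open>r\<close> and a kernel radius of at
  most 1, the convolution sees \<open>f\<close> only on the ball of radius \<open>r + 1\<close>.
  There \<open>f\<close> agrees with the integrable function \<open>F\<close>, to which continuity
  of translation applies.\<close>

lemma mollify_converges:
  fixes f :: "'a::euclidean_space \<Rightarrow> 'b::{banach, second_countable_topology}"
  assumes f: "loc_int f"
  shows "(\<lambda>n. \<integral>x. indicat_real (cball 0 r) x *
    norm ((\<integral>y. mollifier (1 / real (Suc n)) (x - y) *\<^sub>R f y \<partial>lborel) - f x) \<partial>lborel) \<longlonglongrightarrow> 0"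
proof (rule LIMSEQ_I)
  fix e :: real assume e: "0 < e"
  define F where "F x = indicat_real (cball 0 (r + 1)) x *\<^sub>R f x" for x
  have F: "integrable lborel F"
    using f by (simp add: F_def[abs_def] loc_int_def)
  obtain d where d: "0 < d" "\<And>y. norm y \<le> d \<Longrightarrow> (\<integral>x. norm (F (x + y) - F x) \<partial>lborel) < e / 2"
    using translate_L1_uniform[OF F, of "e / 2"] e by auto
  obtain N where N: "1 / real (Suc N) < d"
    using nat_approx_posE[OF d(1)] by auto
  show "\<exists>N. \<forall>n\<ge>N. norm ((\<integral>x. indicat_real (cball 0 r) x *
    norm ((\<integral>y. mollifier (1 / real (Suc n)) (x - y) *\<^sub>R f y \<partial>lborel) - f x) \<partial>lborel) - 0) < e"
  proof (intro exI allI impI)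
    fix n assume "N \<le> n"
    define \<delta> where "\<delta> = 1 / real (Suc n)"
    have "\<delta> \<le> 1 / real (Suc N)" unfolding \<delta>_def using \<open>N \<le> n\<close> by (intro divide_left_mono) auto
    then have \<delta>: "0 < \<delta>" "\<delta> \<le> d" "\<delta> \<le> 1" using N by (auto simp: \<delta>_def)
    have eqF: "(\<integral>y. mollifier \<delta> (x - y) *\<^sub>R f y \<partial>lborel) = (\<integral>y. mollifier \<delta> (x - y) *\<^sub>R F y \<partial>lborel)"
      if "x \<in> cball 0 r" for x
    proof (intro Bochner_Integration.integral_cong refl)
      fix y
      have "norm (x - y) > \<delta>" if "y \<notin> cball 0 (r + 1)"
        using that \<open>x \<in> cball 0 r\<close> \<delta>(3) norm_triangle_sub[of y x] by (simp add: norm_minus_commute)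
      then show "mollifier \<delta> (x - y) *\<^sub>R f y = mollifier \<delta> (x - y) *\<^sub>R F y"
        using mollifier(5)[OF \<delta>(1), of "x - y"] by (cases "y \<in> cball 0 (r + 1)") (auto simp: F_def)
    qed
    have "(\<integral>\<^sup>+x. ennreal (indicat_real (cball 0 r) x * norm ((\<integral>y. mollifier \<delta> (x - y) *\<^sub>R f y \<partial>lborel) - f x)) \<partial>lborel)
      \<le> (\<integral>\<^sup>+x. ennreal (norm ((\<integral>y. mollifier \<delta> (x - y) *\<^sub>R F y \<partial>lborel) - F x)) \<partial>lborel)"
      by (intro nn_integral_mono ennreal_leI) (auto simp: indicator_def eqF F_def)
    also have "\<dots> \<le> ennreal (e / 2)"
    proof (rule convolution_L1_close[OF F, where d = \<delta>])
      show "(\<integral>x. norm (F (x + y) - F x) \<partial>lborel) \<le> e / 2" if "norm y \<le> \<delta>" for y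
        using d(2)[of y] \<delta>(2) that by simp
    qed (use mollifier[OF \<delta>(1)] in auto)
    finally have "(\<integral>x. indicat_real (cball 0 r) x *
        norm ((\<integral>y. mollifier \<delta> (x - y) *\<^sub>R f y \<partial>lborel) - f x) \<partial>lborel) \<le> e / 2"
      using e by (intro integral_real_bounded) auto
    moreover have "0 \<le> (\<integral>x. indicat_real (cball 0 r) x *
        norm ((\<integral>y. mollifier \<delta> (x - y) *\<^sub>R f y \<partial>lborel) - f x) \<partial>lborel)"
      by (rule Bochner_Integration.integral_nonneg) auto
    ultimately show "norm ((\<integral>x. indicat_real (cball 0 r) x *
      norm ((\<integral>y. mollifier (1 / real (Suc n)) (x - y) *\<^sub>R f y \<partial>lborel) - f x) \<partial>lborel) - 0) < e"
      using e by (simp add: \<delta>_def)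
  qed
qed

text \<open>Real-valued representatives are chosen coordinate by coordinate; the finitely many
  exceptional null sets are then united.\<close>

lemma lebesgue_borel_representative:
  fixes f :: "'a::euclidean_space \<Rightarrow> 'b::euclidean_space"
  assumes "f \<in> borel_measurable lebesgue"
  obtains f' where "f' \<in> borel_measurable borel" "AE x in lebesgue. f x = f' x"
proof -
  have "\<exists>g. g \<in> borel_measurable lborel \<and> (AE x in lborel. f x \<bullet> b = g x)" for b
    using completion_ex_borel_measurable_real[of "\<lambda>x. f x \<bullet> b" lborel] assms by auto
  then obtain g where g: "\<And>b. g b \<in> borel_measurable lborel" "\<And>b. AE x in lborel. f x \<bullet> b = g b x"
    by metis
  show thesis
  proof
    show "(\<lambda>x. \<Sum>b\<in>Basis. g b x *\<^sub>R b) \<in> borel_measurable borel"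
      using g(1) by (intro borel_measurable_sum borel_measurable_scaleR) auto
    have "AE x in lborel. \<forall>b\<in>Basis. f x \<bullet> b = g b x"
      using g(2) by (simp add: AE_finite_all)
    then have "AE x in lborel. f x = (\<Sum>b\<in>Basis. g b x *\<^sub>R b)"
      by eventually_elim (metis (mono_tags, lifting) euclidean_representation sum.cong)
    then show "AE x in lebesgue. f x = (\<Sum>b\<in>Basis. g b x *\<^sub>R b)"
      by (rule AE_completion)
  qed
qed

lemma Lp_loc_1_integrable:
  fixes f :: "'a::euclidean_space \<Rightarrow> 'b::euclidean_space"
  assumes "f \<in> Lp_loc 1"
  shows "integrable lebesgue (\<lambda>x. indicat_real (cball a R) x *\<^sub>R f x)"
proof -
  have [measurable]: "f \<in> borel_measurable lebesgue" using assms by (simp add: Lp_loc_def)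
  have "integrable lebesgue (\<lambda>x. indicat_real (cball a R) x * norm (f x))"
    using assms by (auto simp: Lp_loc_def set_integrable_def)
  then show ?thesis
  proof (rule Bochner_Integration.integrable_bound)
    show "(\<lambda>x. indicat_real (cball a R) x *\<^sub>R f x) \<in> borel_measurable lebesgue"
      by (intro borel_measurable_scaleR borel_measurable_indicator) auto
  qed auto
qed

lemma loc_int_representative:
  fixes f :: "'a::euclidean_space \<Rightarrow> 'b::euclidean_space"
  assumes "f \<in> Lp_loc 1"
  obtains f' where "loc_int f'" "AE x in lebesgue. f x = f' x"
proof -
  have fm[measurable]: "f \<in> borel_measurable lebesgue" using assms by (simp add: Lp_loc_def)
  obtain f' where f': "f' \<in> borel_measurable borel" "AE x in lebesgue. f x = f' x"
    using lebesgue_borel_representative[OF fm] .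
  have m: "(\<lambda>x. indicat_real (cball 0 R) x *\<^sub>R f' x) \<in> borel_measurable lborel" for R
    using f'(1) by (intro borel_measurable_scaleR borel_measurable_indicator) auto
  have "integrable lborel (\<lambda>x. indicat_real (cball 0 R) x *\<^sub>R f' x)" for R
  proof -
    have "integrable lebesgue (\<lambda>x. indicat_real (cball 0 R) x *\<^sub>R f' x)"
      using Lp_loc_1_integrable[OF assms, of 0 R] f'(2) measurable_completion[OF m[of R]]
      by (subst integrable_cong_AE[where g = "\<lambda>x. indicat_real (cball 0 R) x *\<^sub>R f x"])
        (auto elim!: eventually_mono)
    then show ?thesis
      using integrable_completion[OF m] by simp
  qed
  with that f' show thesis by (auto simp: loc_int_def)
qed

lemma measurable_ball_norm_diff:
  fixes f g :: "'a::euclidean_space \<Rightarrow> 'b::euclidean_space"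
  assumes "f \<in> borel_measurable lebesgue" "g \<in> borel_measurable lebesgue"
  shows "(\<lambda>x. indicat_real (cball a r) x * norm (f x - g x)) \<in> borel_measurable lebesgue"
  using assms
  by (intro borel_measurable_times borel_measurable_indicator borel_measurable_norm
      borel_measurable_diff) auto

text \<open>\<open>U n\<close> is the mollification of \<open>u\<close>. Its gradient is the
  mollification of \<open>g\<close>, since the reflected and shifted kernel is a legitimate test
  function in \<open>is_weak_grad\<close>; both then converge in L1 on balls.\<close>

lemma weak_grad_approx:
  fixes u :: "'a::euclidean_space \<Rightarrow> real"
  assumes u: "u \<in> Lp_loc 1" and g: "is_weak_grad u g"
  obtains U where "\<And>n. is_C1 (U n)"
    "\<And>r. (\<lambda>n. \<integral>x. indicat_real (cball 0 r) x * norm (U n x - u x) \<partial>lebesgue) \<longlonglongrightarrow> 0"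
    "\<And>r. (\<lambda>n. \<integral>x. indicat_real (cball 0 r) x * norm (grad (U n) x - g x) \<partial>lebesgue) \<longlonglongrightarrow> 0"
proof -
  have g1: "g \<in> Lp_loc 1" using g by (simp add: is_weak_grad_def)
  have um: "u \<in> borel_measurable lebesgue" and gm: "g \<in> borel_measurable lebesgue"
    using u g1 by (simp_all add: Lp_loc_def)
  obtain u' where u': "loc_int u'" "AE x in lebesgue. u x = u' x"
    using loc_int_representative[OF u] .
  obtain g' where g': "loc_int g'" "AE x in lebesgue. g x = g' x"
    using loc_int_representative[OF g1] .
  have [measurable]: "u' \<in> borel_measurable borel" "g' \<in> borel_measurable borel"
    using u' g' by (auto simp: loc_int_def)
  define k :: "nat \<Rightarrow> 'a \<Rightarrow> real" where "k n = mollifier (1 / real (Suc n))" for n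
  define U where "U n x = (\<integral>y. k n (x - y) * u' y \<partial>lborel)" for n x
  have kpos: "0 < 1 / real (Suc n)" for n by simp
  note kprop = mollifier[OF kpos, where 'a = 'a, folded k_def]
  have kC1: "is_C1 (k n)" for n by (rule kprop(1))
  have ck: "continuous_on UNIV (k n)" and cg: "continuous_on UNIV (grad (k n))" for n
    using kC1 by (simp_all add: is_C1_continuous is_C1_continuous_grad)
  have [measurable]: "k n \<in> borel_measurable borel" "grad (k n) \<in> borel_measurable borel" for n
    using ck cg by (auto intro: borel_measurable_continuous_onI)
  have gk0: "grad (k n) x = 0" if "norm x > 1 / real (Suc n)" for n x
    using grad_eq_0_outside[OF kC1[of n], of 0 "1 / real (Suc n)" x] kprop(5) that by simp
  have GD: "GDERIV (U n) x :> (\<integral>y. u' y *\<^sub>R grad (k n) (x - y) \<partial>lborel)" for n x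
    unfolding U_def by (rule GDERIV_convolution[OF u'(1) kC1 kprop(5)])
  have cD: "continuous_on UNIV (\<lambda>x. \<integral>y. u' y *\<^sub>R grad (k n) (x - y) \<partial>lborel)" for n
    by (rule continuous_convolution[OF u'(1) cg gk0])
  have UC1: "is_C1 (U n)" and gU: "grad (U n) = (\<lambda>x. \<integral>y. u' y *\<^sub>R grad (k n) (x - y) \<partial>lborel)" for n
    using is_C1_I[OF GD cD] by auto
  \<comment> \<open>Testing with \<open>y \<mapsto> k n (x - y)\<close>: the minus sign from
    differentiating in \<open>y\<close> cancels the one in \<open>is_weak_grad\<close>, and the
    derivative moves from the kernel to \<open>g\<close>.\<close>
  have gU': "grad (U n) x = (\<integral>y. k n (x - y) *\<^sub>R g' y \<partial>lborel)" for n x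
  proof -
    let ?\<phi> = "\<lambda>y. k n (x - y)"
    have "GDERIV ?\<phi> y :> - grad (k n) (x - y)" for y
    proof -
      have "((\<lambda>y. x - y) has_derivative (\<lambda>h. - h)) (at y)"
        by (auto intro!: derivative_eq_intros)
      moreover have "(k n has_derivative (\<lambda>h. h \<bullet> grad (k n) (x - y))) (at (x - y))"
        using is_C1_GDERIV[OF kC1] by (simp add: gderiv_def)
      ultimately show ?thesis
        unfolding gderiv_def by (auto dest: has_derivative_compose)
    qed
    moreover have "continuous_on UNIV (\<lambda>y. - grad (k n) (x - y))"
      by (intro continuous_intros continuous_on_compose2[OF cg]) auto
    ultimately have \<phi>: "is_C1 ?\<phi>" "grad ?\<phi> = (\<lambda>y. - grad (k n) (x - y))"
      by (rule is_C1_I)+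
    have "?\<phi> \<in> C1_0"
      by (rule C1_0_I[OF \<phi>(1), of x "1 / real (Suc n)"]) (simp add: dist_norm kprop(5))
    then have "(\<integral>y. u y *\<^sub>R grad ?\<phi> y \<partial>lebesgue) = - (\<integral>y. ?\<phi> y *\<^sub>R g y \<partial>lebesgue)"
      using g by (simp add: is_weak_grad_def)
    also have "(\<integral>y. ?\<phi> y *\<^sub>R g y \<partial>lebesgue) = (\<integral>y. ?\<phi> y *\<^sub>R g' y \<partial>lebesgue)"
    proof (rule integral_cong_AE)
      show "(\<lambda>y. ?\<phi> y *\<^sub>R g y) \<in> borel_measurable lebesgue"
        using gm by (intro borel_measurable_scaleR) (auto intro!: measurable_completion)
      show "(\<lambda>y. ?\<phi> y *\<^sub>R g' y) \<in> borel_measurable lebesgue"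
        by (rule measurable_completion) measurable
    qed (use g'(2) in \<open>auto elim!: eventually_mono\<close>)
    also have "\<dots> = (\<integral>y. ?\<phi> y *\<^sub>R g' y \<partial>lborel)"
      by (rule integral_completion) measurable
    also have "(\<integral>y. u y *\<^sub>R grad ?\<phi> y \<partial>lebesgue) = (\<integral>y. u' y *\<^sub>R (- grad (k n) (x - y)) \<partial>lebesgue)"
      unfolding \<phi>(2)
    proof (rule integral_cong_AE)
      have "(\<lambda>y. - grad (k n) (x - y)) \<in> borel_measurable lebesgue"
        by (rule measurable_completion) measurable
      then show "(\<lambda>y. u y *\<^sub>R - grad (k n) (x - y)) \<in> borel_measurable lebesgue"
        using um by (intro borel_measurable_scaleR)
      show "(\<lambda>y. u' y *\<^sub>R - grad (k n) (x - y)) \<in> borel_measurable lebesgue"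
        by (rule measurable_completion) measurable
    qed (use u'(2) in \<open>auto elim!: eventually_mono\<close>)
    also have "\<dots> = (\<integral>y. u' y *\<^sub>R (- grad (k n) (x - y)) \<partial>lborel)"
      by (rule integral_completion) measurable
    finally show ?thesis by (simp add: gU)
  qed
  show thesis
  proof
    fix r
    have mB: "U n \<in> borel_measurable borel" "grad (U n) \<in> borel_measurable borel"
        "u' \<in> borel_measurable borel" "g' \<in> borel_measurable borel" for n
      using UC1 u'(1) g'(1)
      by (auto intro!: borel_measurable_continuous_onI is_C1_continuous is_C1_continuous_grad simp: loc_int_def)
    then have mL: "U n \<in> borel_measurable lebesgue" "grad (U n) \<in> borel_measurable lebesgue"
        "u' \<in> borel_measurable lebesgue" "g' \<in> borel_measurable lebesgue" for n
      by (simp_all add: measurable_completion)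
    have "(\<integral>x. indicat_real (cball 0 r) x * norm (U n x - u x) \<partial>lebesgue) =
      (\<integral>x. indicat_real (cball 0 r) x * norm ((\<integral>y. k n (x - y) *\<^sub>R u' y \<partial>lborel) - u' x) \<partial>lborel)" for n
    proof -
      have "(\<integral>x. indicat_real (cball 0 r) x * norm (U n x - u x) \<partial>lebesgue) =
        (\<integral>x. indicat_real (cball 0 r) x * norm (U n x - u' x) \<partial>lebesgue)"
      proof (rule integral_cong_AE)
        show "AE x in lebesgue. indicat_real (cball 0 r) x * norm (U n x - u x) =
            indicat_real (cball 0 r) x * norm (U n x - u' x)"
          using u'(2) by eventually_elim simp
      qed (intro measurable_ball_norm_diff mL um)+
      also have "\<dots> = (\<integral>x. indicat_real (cball 0 r) x * norm (U n x - u' x) \<partial>lborel)"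
      proof (rule integral_completion)
        show "(\<lambda>x. indicat_real (cball 0 r) x * norm (U n x - u' x)) \<in> borel_measurable lborel"
          by (intro borel_measurable_times borel_measurable_indicator measurable_compose[OF _ borel_measurable_norm]
              borel_measurable_diff) (use mB in simp_all)
      qed
      finally show ?thesis by (simp add: U_def)
    qed
    then show "(\<lambda>n. \<integral>x. indicat_real (cball 0 r) x * norm (U n x - u x) \<partial>lebesgue) \<longlonglongrightarrow> 0"
      using mollify_converges[OF u'(1), of r] by (simp add: k_def)
    have "(\<integral>x. indicat_real (cball 0 r) x * norm (grad (U n) x - g x) \<partial>lebesgue) =
      (\<integral>x. indicat_real (cball 0 r) x * norm ((\<integral>y. k n (x - y) *\<^sub>R g' y \<partial>lborel) - g' x) \<partial>lborel)" for n
    proof -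
      have "(\<integral>x. indicat_real (cball 0 r) x * norm (grad (U n) x - g x) \<partial>lebesgue) =
        (\<integral>x. indicat_real (cball 0 r) x * norm (grad (U n) x - g' x) \<partial>lebesgue)"
      proof (rule integral_cong_AE)
        show "AE x in lebesgue. indicat_real (cball 0 r) x * norm (grad (U n) x - g x) =
            indicat_real (cball 0 r) x * norm (grad (U n) x - g' x)"
          using g'(2) by eventually_elim simp
      qed (intro measurable_ball_norm_diff mL gm)+
      also have "\<dots> = (\<integral>x. indicat_real (cball 0 r) x * norm (grad (U n) x - g' x) \<partial>lborel)"
      proof (rule integral_completion)
        show "(\<lambda>x. indicat_real (cball 0 r) x * norm (grad (U n) x - g' x)) \<in> borel_measurable lborel"
          by (intro borel_measurable_times borel_measurable_indicator measurable_compose[OF _ borel_measurable_norm]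
              borel_measurable_diff) (use mB in simp_all)
      qed
      finally show ?thesis by (simp add: gU')
    qed
    then show "(\<lambda>n. \<integral>x. indicat_real (cball 0 r) x * norm (grad (U n) x - g x) \<partial>lebesgue) \<longlonglongrightarrow> 0"
      using mollify_converges[OF g'(1), of r] by (simp add: k_def)
  qed (rule UC1)
qed

subsection \<open>Pointwise inequalities\<close>

definition flux :: "'a::euclidean_space \<Rightarrow> 'a" where
  "flux p = p /\<^sub>R sqrt (1 + (norm p)\<^sup>2)"

text \<open>This bound lets the flux be paired with gradients that are merely locally integrable,
  and it makes the cutoff error proportional to \<open>grad \<phi>\<close> alone.\<close>

lemma norm_flux_le: "norm (flux p) \<le> 1"
proof -
  have "norm p \<le> sqrt (1 + (norm p)\<^sup>2)"
    by (rule real_le_rsqrt) simp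
  then show ?thesis
    by (simp add: flux_def divide_inverse[symmetric] mult.commute[of "inverse _"] divide_le_eq_1 add_pos_nonneg)
qed

text \<open>With \<open>W\<close> and \<open>V\<close> the area elements, the unit normals of the two graphs are \<open>(- flux \<xi>, 1/W)\<close> and
  \<open>(- flux \<eta>, 1/V)\<close>; \<open>c\<close> is their inner product and \<open>t\<close> the difference of their last components.\<close>

lemma flux_weighted_monotone:
  fixes \<xi> \<eta> :: "'a::euclidean_space"
  assumes "0 < \<alpha>" "0 < \<beta>"
  shows "(flux \<xi> - flux \<eta>) \<bullet> (\<alpha> *\<^sub>R \<xi> - \<beta> *\<^sub>R \<eta>) \<ge> - (\<alpha> - \<beta>)\<^sup>2 / (2 * (\<alpha> + \<beta>))"
proof -
  define W V where "W = sqrt (1 + (norm \<xi>)\<^sup>2)" and "V = sqrt (1 + (norm \<eta>)\<^sup>2)"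
  define c where "c = (\<xi> \<bullet> \<eta> + 1) / (W * V)"
  define t where "t = 1 / W - 1 / V"
  have W: "1 \<le> W" "\<xi> \<bullet> \<xi> = W\<^sup>2 - 1" and V: "1 \<le> V" "\<eta> \<bullet> \<eta> = V\<^sup>2 - 1"
    by (simp_all add: W_def V_def power2_norm_eq_inner)
  have fl: "flux \<xi> = (1 / W) *\<^sub>R \<xi>" "flux \<eta> = (1 / V) *\<^sub>R \<eta>"
    by (simp_all add: flux_def W_def V_def divide_inverse)
  have in1: "\<xi> \<bullet> \<eta> = c * W * V - 1"
    using W V by (simp add: c_def)
  \<comment> \<open>The squared distance of the unit normals is \<open>2 * (1 - c)\<close>;
    discarding its horizontal part, which is this square, leaves
    \<open>t\<^sup>2 \<le> 2 * (1 - c)\<close>.\<close>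
  have "0 \<le> (flux \<xi> - flux \<eta>) \<bullet> (flux \<xi> - flux \<eta>)" by simp
  also have "\<dots> = (\<xi> \<bullet> \<xi>) / W\<^sup>2 + (\<eta> \<bullet> \<eta>) / V\<^sup>2 - 2 * (\<xi> \<bullet> \<eta>) / (W * V)"
    using W(1) V(1) unfolding fl
    by (simp add: inner_diff_left inner_diff_right inner_commute power2_eq_square)
  also have "\<dots> = 2 * (1 - c) - t\<^sup>2"
    unfolding W(2) V(2) in1 t_def using W(1) V(1) by (simp add: field_simps power2_eq_square)
  finally have ct: "t\<^sup>2 \<le> 2 * (1 - c)" by simp
  then have c1: "0 \<le> 1 - c" using order_trans[OF zero_le_power2 ct] by simp
  have "(flux \<xi> - flux \<eta>) \<bullet> (\<alpha> *\<^sub>R \<xi> - \<beta> *\<^sub>R \<eta>) =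
     \<alpha> * ((\<xi> \<bullet> \<xi>) / W - (\<xi> \<bullet> \<eta>) / V) + \<beta> * ((\<eta> \<bullet> \<eta>) / V - (\<xi> \<bullet> \<eta>) / W)"
    using W(1) V(1) unfolding fl
    by (simp add: inner_diff_left inner_diff_right inner_commute algebra_simps)
  also have "\<dots> = (\<alpha> * W + \<beta> * V) * (1 - c) - (\<alpha> - \<beta>) * t"
    unfolding W(2) V(2) in1 t_def using W(1) V(1) by (simp add: field_simps power2_eq_square)
  finally have eq: "(flux \<xi> - flux \<eta>) \<bullet> (\<alpha> *\<^sub>R \<xi> - \<beta> *\<^sub>R \<eta>) =
    (\<alpha> * W + \<beta> * V) * (1 - c) - (\<alpha> - \<beta>) * t" .
  have "\<alpha> + \<beta> \<le> \<alpha> * W + \<beta> * V"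
    using assms W(1) V(1) by (simp add: add_mono)
  then have "(\<alpha> + \<beta>) * (1 - c) \<le> (\<alpha> * W + \<beta> * V) * (1 - c)"
    using c1 by (rule mult_right_mono)
  moreover have "(\<alpha> + \<beta>) * (t\<^sup>2 / 2) \<le> (\<alpha> + \<beta>) * (1 - c)"
    using ct assms by (intro mult_left_mono) auto
  \<comment> \<open>The quadratic in \<open>t\<close> is minimised by completing the square; its
    minimum, at \<open>t = (\<alpha> - \<beta>) / (\<alpha> + \<beta>)\<close>, is the claimed
    bound.\<close>
  moreover have "- (\<alpha> - \<beta>)\<^sup>2 / (2 * (\<alpha> + \<beta>)) \<le> (\<alpha> + \<beta>) * (t\<^sup>2 / 2) - (\<alpha> - \<beta>) * t"
  proof -
    have "0 \<le> ((\<alpha> + \<beta>) * t - (\<alpha> - \<beta>))\<^sup>2 / (2 * (\<alpha> + \<beta>))" using assms by simp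
    also have "\<dots> = (\<alpha> + \<beta>) * (t\<^sup>2 / 2) - (\<alpha> - \<beta>) * t + (\<alpha> - \<beta>)\<^sup>2 / (2 * (\<alpha> + \<beta>))"
    proof -
      have "(s * t - r)\<^sup>2 / (2 * s) = s * (t\<^sup>2 / 2) - r * t + r\<^sup>2 / (2 * s)" if "s > 0" for s r :: real
        using that by (simp add: field_simps power2_eq_square)
      then show ?thesis using assms by (metis add_pos_pos)
    qed
    finally show ?thesis by simp
  qed
  ultimately show ?thesis unfolding eq by linarith
qed

section \<open>Signed powers and inequalities for real exponents\<close>

lemma signed_pow_nonneg: "0 \<le> t \<Longrightarrow> signed_pow q t = t powr q"
  by (cases "t = 0") (auto simp: signed_pow_def powr_diff)

lemma signed_pow_minus: "signed_pow q (- t) = - signed_pow q t"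
  by (simp add: signed_pow_def)

lemma abs_signed_pow: "\<bar>signed_pow q t\<bar> = \<bar>t\<bar> powr q"
  using signed_pow_nonneg[of "\<bar>t\<bar>" q] by (simp add: signed_pow_def abs_mult)

lemma signed_pow_strict_mono:
  assumes "0 < q" "v < u" shows "signed_pow q v < signed_pow q u"
proof -
  have pos: "signed_pow q v < signed_pow q u" if "0 \<le> v" "v < u" for u v
    using that assms(1) by (simp add: signed_pow_nonneg powr_less_mono2)
  consider "0 \<le> v" | "u \<le> 0" | "v < 0" "0 < u" by linarith
  then show ?thesis
  proof cases
    case 2
    then show ?thesis using pos[of "- u" "- v"] assms(2) by (simp add: signed_pow_minus)
  next
    case 3
    then have "signed_pow q 0 < signed_pow q u" "signed_pow q v < - signed_pow q 0"
      using pos[of 0 u] pos[of 0 "- v"] by (simp_all add: signed_pow_minus)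
    then show ?thesis by (simp add: signed_pow_def[of q 0])
  qed (use pos assms in auto)
qed

text \<open>Turns a constant bound on \<open>h\<close> into a constant solution of the equation, to
  serve as a barrier.\<close>

lemma signed_pow_surj:
  assumes "0 < q" obtains c where "signed_pow q c = y"
proof (cases "0 \<le> y")
  case True
  then have "signed_pow q (y powr (1 / q)) = y"
    using assms by (simp add: signed_pow_nonneg powr_powr)
  then show thesis by (rule that)
next
  case False
  then have "signed_pow q (- ((- y) powr (1 / q))) = y"
    using assms by (simp add: signed_pow_minus signed_pow_nonneg powr_powr)
  then show thesis by (rule that)
qed

text \<open>Write \<open>z powr q\<close> as \<open>z * z powr (q - 1)\<close> and use that the
  second factor is nondecreasing.\<close>

lemma powr_superadditive:
  fixes x y q :: real
  assumes "0 \<le> x" "0 \<le> y" "1 \<le> q"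
  shows "x powr q + y powr q \<le> (x + y) powr q"
proof -
  have eq: "z powr q = z * z powr (q - 1)" if "0 \<le> z" for z :: real
    using that by (cases "z = 0") (auto simp: powr_diff)
  have "x * x powr (q - 1) \<le> x * (x + y) powr (q - 1)" "y * y powr (q - 1) \<le> y * (x + y) powr (q - 1)"
    using assms by (auto intro!: mult_left_mono powr_mono2)
  then show ?thesis
    using eq[of x] eq[of y] eq[of "x + y"] assms by (simp add: algebra_simps)
qed

text \<open>On one side of 0 this is superadditivity. For opposite signs one of \<open>u\<close> and
  \<open>- v\<close> is at least half of \<open>u - v\<close>, whence the factor
  \<open>1/2\<close>.\<close>

lemma signed_pow_diff_ge:
  assumes "1 \<le> q" "v < u"
  shows "((u - v) / 2) powr q \<le> signed_pow q u - signed_pow q v"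
proof -
  have pos: "((u - v) / 2) powr q \<le> signed_pow q u - signed_pow q v" if "0 \<le> v" "v < u" for u v
  proof -
    have "((u - v) / 2) powr q \<le> (u - v) powr q"
      using that assms by (intro powr_mono2) auto
    then show ?thesis
      using powr_superadditive[of "u - v" v q] that assms by (simp add: signed_pow_nonneg)
  qed
  consider "0 \<le> v" | "u \<le> 0" | "v < 0" "0 < u" by linarith
  then show ?thesis
  proof cases
    case 2
    then show ?thesis using pos[of "- u" "- v"] assms(2) by (simp add: signed_pow_minus)
  next
    case 3
    have s: "signed_pow q u = u powr q" "signed_pow q v = - ((- v) powr q)"
      using 3 signed_pow_minus[of q "- v"] by (simp_all add: signed_pow_nonneg)
    show ?thesis
    proof (cases "(u - v) / 2 \<le> u")
      case True
      then have "((u - v) / 2) powr q \<le> u powr q" using assms by (intro powr_mono2) auto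
      then show ?thesis by (simp add: s add_increasing2)
    next
      case False
      then have "((u - v) / 2) powr q \<le> (- v) powr q" using assms by (intro powr_mono2) auto
      then show ?thesis by (simp add: s add_increasing)
    qed
  qed (use pos assms in auto)
qed

text \<open>With \<open>x = a / b\<close>, the left side is at most a multiple of
  \<open>(1 - x)\<^sup>2\<close> and the right side at least another multiple of it. The lemma is
  applied with \<open>a\<close> and \<open>b\<close> equal to \<open>M + \<bar>v\<bar>\<close> and
  \<open>M + \<bar>u\<bar>\<close> in increasing order.\<close>

lemma powr_weight_inequality:
  fixes a b K q :: real
  assumes q: "0 < q" "q < 1" and K: "K / q \<le> a" and a: "1 \<le> a" "a \<le> b"
  shows "K * (a powr (q - 1) - b powr (q - 1))\<^sup>2 \<le>
     (a powr (q - 1) + b powr (q - 1)) * ((b powr q - a powr q)\<^sup>2 / q)"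
proof (cases "K \<le> 0")
  case True
  then have "K * (a powr (q - 1) - b powr (q - 1))\<^sup>2 \<le> 0" by (simp add: mult_nonpos_nonneg)
  also have "\<dots> \<le> (a powr (q - 1) + b powr (q - 1)) * ((b powr q - a powr q)\<^sup>2 / q)"
    using q by simp
  finally show ?thesis .
next
  case False
  define x where "x = a / b"
  define A where "A = a powr q"
  have x: "0 < x" "x \<le> 1" using a by (auto simp: x_def)
  have A: "1 \<le> A" using a q by (simp add: A_def ge_one_powr_ge_zero)
  have r1: "a powr (q - 1) = A / a" using a by (simp add: A_def powr_diff)
  have "a powr (q - 1) - b powr (q - 1) = A / a * (1 - x powr (1 - q))"
  proof -
    have "b powr (q - 1) = a powr (q - 1) * x powr (1 - q)"
      using a q by (simp add: x_def powr_divide powr_diff field_simps flip: powr_add)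
    then show ?thesis by (simp add: r1 algebra_simps)
  qed
  also have "\<dots> \<le> A / a * (1 - x)"
    using x q A a powr_mono'[of "1 - q" 1 x] by (intro mult_left_mono) auto
  finally have d1: "a powr (q - 1) - b powr (q - 1) \<le> A / a * (1 - x)" .
  have d0: "0 \<le> a powr (q - 1) - b powr (q - 1)"
    using a q powr_mono2'[of "q - 1" a b] by auto
  \<comment> \<open>The two tangent inequalities \<open>ln x \<le> x - 1\<close> and
    \<open>1 + y \<le> exp y\<close> bound \<open>x powr (- q)\<close> from below.\<close>
  have "1 + q * (1 - x) \<le> 1 + (- (q * ln x))"
    using ln_le_minus_one[OF x(1)] q mult_left_mono[of "ln x" "x - 1" q] by (simp add: algebra_simps)
  also have "\<dots> \<le> exp (- (q * ln x))" by (rule exp_ge_add_one_self)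
  also have "\<dots> = x powr (- q)" using x by (simp add: powr_def)
  finally have e1: "1 + q * (1 - x) \<le> x powr (- q)" .
  have "b powr q = A * x powr (- q)"
    using a by (simp add: A_def x_def powr_divide powr_minus field_simps)
  then have "b powr q - a powr q = A * (x powr (- q) - 1)" by (simp add: A_def algebra_simps)
  moreover have "A * (q * (1 - x)) \<le> A * (x powr (- q) - 1)"
    using A e1 by (intro mult_left_mono) auto
  ultimately have d2: "A * (q * (1 - x)) \<le> b powr q - a powr q" by simp
  have "K * (a powr (q - 1) - b powr (q - 1))\<^sup>2 \<le> K * (A / a * (1 - x))\<^sup>2"
    using d0 d1 False by (intro mult_left_mono power_mono) auto
  also have "\<dots> = (A / a) * ((A / a) * K * (1 - x)\<^sup>2)" by (simp only: power2_eq_square mult_ac)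
  also have "\<dots> \<le> (A / a) * ((A * q * A) * (1 - x)\<^sup>2)"
  proof (intro mult_left_mono mult_right_mono)
    \<comment> \<open>The comparison of the two multiples of \<open>(1 - x)\<^sup>2\<close>: the
      largeness of \<open>a\<close> relative to \<open>K\<close> enters here.\<close>
    have "K \<le> a * q" using K q by (simp add: field_simps)
    also have "\<dots> \<le> a * q * A" using A a q by simp
    finally have "A * K \<le> A * (a * q * A)" using A by (intro mult_left_mono) auto
    then show "A / a * K \<le> A * q * A" using a by (simp add: field_simps)
  qed (use A a in auto)
  also have "\<dots> = (A / a) * ((A * (q * (1 - x)))\<^sup>2 / q)"
  proof -
    have "(A * q * A) * y\<^sup>2 = (A * (q * y))\<^sup>2 / q" for y
      using q by (simp add: power2_eq_square)
    then show ?thesis by simp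
  qed
  also have "\<dots> \<le> (A / a) * ((b powr q - a powr q)\<^sup>2 / q)"
    using d2 A a q x by (intro mult_left_mono divide_right_mono power_mono) auto
  also have "\<dots> \<le> (a powr (q - 1) + b powr (q - 1)) * ((b powr q - a powr q)\<^sup>2 / q)"
    using q by (intro mult_right_mono) (auto simp: r1)
  finally show ?thesis .
qed

text \<open>For \<open>q < 1\<close> the slope of \<open>t powr q\<close> decreases, so shifting to
  the right by \<open>M\<close> shrinks increments.\<close>

lemma powr_shift_mono:
  fixes M q :: real
  assumes q: "0 < q" "q < 1" and M: "0 < M" and uv: "0 \<le> v" "v < u"
  shows "(M + u) powr q - (M + v) powr q \<le> u powr q - v powr q"
proof -
  have "v powr q - (M + v) powr q \<le> u powr q - (M + u) powr q"
  \<comment> \<open>The derivative blows up at 0, which may be the left endpoint, so it is taken on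
    the open interval only and continuity covers the closed one.\<close>
  proof (rule DERIV_nonneg_imp_increasing_open[where f = "\<lambda>t. t powr q - (M + t) powr q"])
    fix x assume x: "v < x" "x < u"
    have "((\<lambda>t. t powr q - (M + t) powr q) has_real_derivative
        q * x powr (q - 1) - q * (M + x) powr (q - 1)) (at x)"
      using x uv M by (auto intro!: derivative_eq_intros)
    moreover have "(M + x) powr (q - 1) \<le> x powr (q - 1)"
      using x uv M q by (intro powr_mono2') auto
    ultimately show "\<exists>y. ((\<lambda>t. t powr q - (M + t) powr q) has_real_derivative y) (at x) \<and> 0 \<le> y"
      using q by (intro exI[of _ "q * x powr (q - 1) - q * (M + x) powr (q - 1)"]) auto
  next
    show "continuous_on {v..u} (\<lambda>t. t powr q - (M + t) powr q)"
      using uv M q by (intro continuous_on_diff continuous_on_powr' continuous_intros) auto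
  qed (use uv in auto)
  then show ?thesis by simp
qed

text \<open>The odd extension of \<open>P\<close> is an antiderivative of the even weight. At 0 the
  halves fit together because \<open>P 0 = 0\<close> and both one-sided slopes equal
  \<open>M powr (q - 1)\<close>.\<close>

lemma DERIV_odd_powr:
  fixes M q :: real
  assumes M: "0 < M" and q: "0 < q"
  defines "P \<equiv> \<lambda>t. ((M + t) powr q - M powr q) / q"
  shows "((\<lambda>t. if 0 \<le> t then P t else - P (- t)) has_real_derivative (M + \<bar>t\<bar>) powr (q - 1)) (at t)"
    (is "(?S has_real_derivative _) _")
proof -
  have dP: "(P has_real_derivative (M + t) powr (q - 1)) (at t)" if "0 \<le> t" for t
    unfolding P_def using that M q by (auto intro!: derivative_eq_intros)
  have dN: "((\<lambda>t. - P (- t)) has_real_derivative (M - t) powr (q - 1)) (at t)" if "t \<le> 0" for t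
    unfolding P_def using that M q by (auto intro!: derivative_eq_intros)
  have P0: "P 0 = 0" by (simp add: P_def)
  consider "t < 0" | "t > 0" | "t = 0" by linarith
  then show ?thesis
  proof cases
    case 1
    have "eventually (\<lambda>s. s < 0) (nhds t)"
      using 1 by (intro eventually_nhds_in_open[of "{..<0}", simplified]) auto
    then have "eventually (\<lambda>s. ?S s = - P (- s)) (nhds t)"
      by (auto elim!: eventually_mono)
    then show ?thesis
      using dN[of t] 1 by (subst DERIV_cong_ev[OF refl _ refl]) auto
  next
    case 2
    have "eventually (\<lambda>s. s > 0) (nhds t)"
      using 2 by (intro eventually_nhds_in_open[of "{0<..}", simplified]) auto
    then have "eventually (\<lambda>s. ?S s = P s) (nhds t)"
      by (auto elim!: eventually_mono)
    then show ?thesis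
      using dP[of t] 2 by (subst DERIV_cong_ev[OF refl _ refl]) auto
  next
    case 3
    have "((\<lambda>y. (?S y - ?S 0) / (y - 0)) \<longlongrightarrow> M powr (q - 1)) (at 0)"
      unfolding filterlim_at_split
    proof
      have "((\<lambda>y. (- P (- y) - - P (- 0)) / (y - 0)) \<longlongrightarrow> M powr (q - 1)) (at_left 0)"
        using dN[of 0] unfolding has_field_derivative_iff
        by (auto intro: filterlim_mono[OF _ order_refl] simp: at_le)
      then show "((\<lambda>y. (?S y - ?S 0) / (y - 0)) \<longlongrightarrow> M powr (q - 1)) (at_left 0)"
        by (rule Lim_transform_eventually) (auto simp: P0 eventually_at_filter)
      have "((\<lambda>y. (P y - P 0) / (y - 0)) \<longlongrightarrow> M powr (q - 1)) (at_right 0)"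
        using dP[of 0] unfolding has_field_derivative_iff
        by (auto intro: filterlim_mono[OF _ order_refl] simp: at_le)
      then show "((\<lambda>y. (?S y - ?S 0) / (y - 0)) \<longlongrightarrow> M powr (q - 1)) (at_right 0)"
        by (rule Lim_transform_eventually) (auto simp: P0 eventually_at_filter)
    qed
    then show ?thesis using 3 by (simp add: has_field_derivative_iff)
  qed
qed

section \<open>The change of variable \<open>S\<close> with weight \<open>\<rho>\<close>\<close>

text \<open>Collects what the comparison argument asks of \<open>S\<close>, independently of whether
  \<open>q\<close> exceeds 1. The inequality with \<open>K\<close> pays for the deficit in
  \<open>flux_weighted_monotone\<close>; the last clause makes the truncation small wherever the
  zero-order difference is small.\<close>

definition admissible :: "real \<Rightarrow> real \<Rightarrow> (real \<Rightarrow> real) \<Rightarrow> (real \<Rightarrow> real) \<Rightarrow> real \<Rightarrow> bool" where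
  "admissible q K S \<rho> C \<longleftrightarrow> 0 < C \<and> continuous_on UNIV \<rho> \<and>
     (\<forall>t. (S has_real_derivative \<rho> t) (at t)) \<and> (\<forall>t. 0 < \<rho> t \<and> \<rho> t \<le> 1) \<and>
     (\<forall>u v. v < u \<longrightarrow> S v < S u \<and>
        K * (\<rho> u - \<rho> v)\<^sup>2 \<le> (\<rho> u + \<rho> v) * ((signed_pow q u - signed_pow q v) * (S u - S v)) \<and>
        S u - S v \<le> C * (signed_pow q u - signed_pow q v) powr (min 1 (1 / q)))"

text \<open>With constant weight the inequality with \<open>K\<close> has left side 0; the constant
  2 undoes the halving in \<open>signed_pow_diff_ge\<close>.\<close>

lemma admissible_exists_ge1:
  assumes "1 \<le> q" shows "admissible q K (\<lambda>t. t) (\<lambda>t. 1) 2"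
  unfolding admissible_def
proof (intro conjI allI impI)
  fix u v :: real assume uv: "v < u"
  have pos: "0 < signed_pow q u - signed_pow q v"
    using signed_pow_strict_mono[of q v u] uv assms by simp
  then show "K * (1 - 1)\<^sup>2 \<le> (1 + 1) * ((signed_pow q u - signed_pow q v) * (u - v))"
    using uv by simp
  have le: "(((u - v) / 2) powr q) powr (1 / q) \<le> (signed_pow q u - signed_pow q v) powr (1 / q)"
    using signed_pow_diff_ge[OF assms uv] assms by (intro powr_mono2) auto
  show "u - v \<le> 2 * (signed_pow q u - signed_pow q v) powr min 1 (1 / q)"
  proof -
    have "min 1 (1 / q) = 1 / q" using assms by simp
    then show ?thesis using le assms uv by (simp add: powr_powr)
  qed
qed auto

text \<open>Increments of \<open>S\<close> lie between two quantities:
  \<open>q * (S u - S v)\<close> is at most the increment of \<open>signed_pow q\<close>, and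
  \<open>S u - S v\<close> is at least the change of \<open>(M + \<bar>t\<bar>) powr q\<close>
  divided by \<open>q\<close>. The first gives \<open>C = 1 / q\<close>; both together reduce the
  weight condition to \<open>powr_weight_inequality\<close>.\<close>

lemma admissible_exists_lt1:
  assumes q: "0 < q" "q < 1" shows "\<exists>S \<rho> C. admissible q K S \<rho> C"
proof -
  \<comment> \<open>The 1 ensures \<open>\<rho> \<le> 1\<close>, and \<open>K / q\<close> is the
    size required by \<open>powr_weight_inequality\<close>.\<close>
  define M where "M = max 1 (K / q)"
  have M: "1 \<le> M" "K / q \<le> M" "0 < M" by (auto simp: M_def)
  define P where "P = (\<lambda>t. ((M + t) powr q - M powr q) / q)"
  define S where "S = (\<lambda>t. if 0 \<le> t then P t else - P (- t))"
  define \<rho> where "\<rho> = (\<lambda>t. (M + \<bar>t\<bar>) powr (q - 1))"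
  have dS: "(S has_real_derivative \<rho> t) (at t)" for t
    using DERIV_odd_powr[OF M(3) q(1), of t] unfolding S_def \<rho>_def P_def .
  have P0: "P 0 = 0" by (simp add: P_def)
  have Pm: "P v < P u" if "0 \<le> v" "v < u" for u v
    using that M q by (simp add: P_def divide_strict_right_mono powr_less_mono2)
  have Sminus: "S (- t) = - S t" for t
    using P0 by (auto simp: S_def)
  have Ssgn: "S t = P t" if "0 \<le> t" for t using that by (simp add: S_def)
  have Sneg: "S t = - P (- t)" if "t \<le> 0" for t using that P0 by (auto simp: S_def)
  \<comment> \<open>The three sign patterns of a pair \<open>v < u\<close>, isolated because
    \<open>S\<close> and \<open>signed_pow q\<close> are odd functions given by a formula on the
    half-line.\<close>
  have cases3: "Q v u" if "v < u" "\<And>u v. 0 \<le> v \<Longrightarrow> v < u \<Longrightarrow> Q v u"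
     "\<And>u v. v < u \<Longrightarrow> u \<le> 0 \<Longrightarrow> Q v u" "\<And>u v. v < 0 \<Longrightarrow> 0 < u \<Longrightarrow> Q v u"
     for Q :: "real \<Rightarrow> real \<Rightarrow> bool" and u v
    using that by (metis linorder_not_le)
  have fz0: "q * (S u - S v) \<le> signed_pow q u - signed_pow q v" if "0 \<le> v" "v < u" for u v
  proof -
    have "q * (S u - S v) = (M + u) powr q - (M + v) powr q"
      using that q by (simp add: Ssgn P_def field_simps)
    then show ?thesis
      using powr_shift_mono[OF q M(3) that] that by (simp add: signed_pow_nonneg)
  qed
  have s0: "signed_pow q 0 = 0" "S 0 = 0" by (simp_all add: signed_pow_def Ssgn P0)
  have fz: "q * (S u - S v) \<le> signed_pow q u - signed_pow q v" if "v < u" for u v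
    using that
  proof (rule cases3[of v u "\<lambda>v u. q * (S u - S v) \<le> signed_pow q u - signed_pow q v"])
    fix u v :: real assume "v < u" "u \<le> 0"
    then show "q * (S u - S v) \<le> signed_pow q u - signed_pow q v"
      using fz0[of "- u" "- v"] by (simp add: signed_pow_minus Sminus)
  next
    fix u v :: real assume "v < 0" "0 < u"
    then show "q * (S u - S v) \<le> signed_pow q u - signed_pow q v"
      using fz0[of 0 u] fz0[of 0 "- v"] by (simp add: signed_pow_minus Sminus s0 algebra_simps)
  qed (use fz0 in blast)
  have Sm: "S v < S u" if "v < u" for u v
    using that
  proof (rule cases3[of v u "\<lambda>v u. S v < S u"])
    fix u v :: real assume "v < u" "u \<le> 0"
    then show "S v < S u" using Pm[of "- u" "- v"] by (simp add: Sneg)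
  next
    fix u v :: real assume "v < 0" "0 < u"
    then show "S v < S u" using Pm[of 0 u] Pm[of 0 "- v"] by (simp add: Sneg Ssgn P0)
  qed (use Pm in \<open>simp add: Ssgn\<close>)
  \<comment> \<open>For equal signs this is an equality. For opposite signs \<open>S\<close> adds
    the contributions of the two half-lines, whereas the left side takes their difference.\<close>
  have zb: "\<bar>(M + \<bar>u\<bar>) powr q - (M + \<bar>v\<bar>) powr q\<bar> / q \<le> S u - S v" if "v < u" for u v
    using that
  proof (rule cases3[of v u "\<lambda>v u. \<bar>(M + \<bar>u\<bar>) powr q - (M + \<bar>v\<bar>) powr q\<bar> / q \<le> S u - S v"])
    fix u v :: real assume uv: "0 \<le> v" "v < u"
    then have "(M + v) powr q \<le> (M + u) powr q" using M q by (intro powr_mono2) auto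
    then show "\<bar>(M + \<bar>u\<bar>) powr q - (M + \<bar>v\<bar>) powr q\<bar> / q \<le> S u - S v"
      using uv q by (simp add: Ssgn P_def field_simps)
  next
    fix u v :: real assume uv: "v < u" "u \<le> 0"
    then have "(M - u) powr q \<le> (M - v) powr q" using M q by (intro powr_mono2) auto
    then show "\<bar>(M + \<bar>u\<bar>) powr q - (M + \<bar>v\<bar>) powr q\<bar> / q \<le> S u - S v"
      using uv q by (simp add: Sneg P_def field_simps)
  next
    fix u v :: real assume uv: "v < 0" "0 < u"
    then have "M powr q \<le> (M + u) powr q" "M powr q \<le> (M - v) powr q"
      using M q by (auto intro!: powr_mono2)
    then have "\<bar>(M + u) powr q - (M - v) powr q\<bar> / q \<le>
        (((M + u) powr q - M powr q) + ((M - v) powr q - M powr q)) / q"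
      using q by (intro divide_right_mono) auto
    then show "\<bar>(M + \<bar>u\<bar>) powr q - (M + \<bar>v\<bar>) powr q\<bar> / q \<le> S u - S v"
      using uv by (simp add: Sneg Ssgn P_def algebra_simps flip: add_divide_distrib)
  qed
  have "admissible q K S \<rho> (1 / q)"
    unfolding admissible_def
  proof (intro conjI allI impI)
    show "continuous_on UNIV \<rho>"
      unfolding \<rho>_def using M by (intro continuous_intros) (auto simp: add_nonneg_eq_0_iff)
    show "0 < \<rho> t" "\<rho> t \<le> 1" for t
      unfolding \<rho>_def using M q powr_mono2'[of "q - 1" 1 "M + \<bar>t\<bar>"] by (auto simp: add_nonneg_eq_0_iff)
    fix u v :: real assume uv: "v < u"
    define a b where "a = M + \<bar>v\<bar>" and "b = M + \<bar>u\<bar>"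
    have sym: "K * (a powr (q - 1) - b powr (q - 1))\<^sup>2 \<le>
      (a powr (q - 1) + b powr (q - 1)) * ((b powr q - a powr q)\<^sup>2 / q)"
    proof (cases "a \<le> b")
      case True
      then show ?thesis using M q by (intro powr_weight_inequality) (auto simp: a_def)
    next
      case False
      then show ?thesis using powr_weight_inequality[of q K b a] M q
        by (auto simp: b_def power2_commute add.commute)
    qed
    \<comment> \<open>One factor \<open>S u - S v\<close> is bounded below by \<open>zb\<close> and
      the other above by \<open>fz\<close>, so the square of the difference of powers is controlled
      by the mixed product.\<close>
    have "(\<bar>b powr q - a powr q\<bar> / q)\<^sup>2 \<le> (S u - S v)\<^sup>2"
      using zb[OF uv] q by (intro power_mono) (auto simp: a_def b_def)
    then have "q * (\<bar>b powr q - a powr q\<bar> / q)\<^sup>2 \<le> q * (S u - S v)\<^sup>2"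
      using q by (intro mult_left_mono) auto
    also have "q * (S u - S v)\<^sup>2 \<le> (signed_pow q u - signed_pow q v) * (S u - S v)"
      using mult_right_mono[OF fz[OF uv], of "S u - S v"] Sm[OF uv] by (simp add: power2_eq_square)
    also have "q * (\<bar>b powr q - a powr q\<bar> / q)\<^sup>2 = (b powr q - a powr q)\<^sup>2 / q"
      using q by (simp add: power_divide power2_eq_square)
    finally have "(a powr (q - 1) + b powr (q - 1)) * ((b powr q - a powr q)\<^sup>2 / q) \<le>
       (a powr (q - 1) + b powr (q - 1)) * ((signed_pow q u - signed_pow q v) * (S u - S v))"
      by (intro mult_left_mono) auto
    with sym show "K * (\<rho> u - \<rho> v)\<^sup>2 \<le> (\<rho> u + \<rho> v) * ((signed_pow q u - signed_pow q v) * (S u - S v))"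
      by (simp add: \<rho>_def a_def b_def power2_commute add.commute)
    show "S u - S v \<le> 1 / q * (signed_pow q u - signed_pow q v) powr min 1 (1 / q)"
      using fz[OF uv] q signed_pow_strict_mono[OF q(1) uv] by (simp add: min_def field_simps)
  qed (use q dS Sm in auto)
  then show ?thesis by blast
qed

lemma admissible_exists:
  assumes "0 < q" shows "\<exists>S \<rho> C. admissible q K S \<rho> C"
  using admissible_exists_ge1[of q K] admissible_exists_lt1[of q K] assms by (cases "1 \<le> q") force+

section \<open>The bounded truncation of values\<close>

text \<open>A bounded function with algebraic decay at 0: besides vanishing to order
  \<open>k\<close> there, it satisfies \<open>z * trunc' k z \<le> real k * trunc k z\<close> for
  positive \<open>z\<close>, and for \<open>k \<ge> 2\<close> it stays \<open>C^1\<close>.\<close>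

definition trunc :: "nat \<Rightarrow> real \<Rightarrow> real" where
  "trunc k z = (max 0 z) ^ k / (1 + (max 0 z) ^ k)"

definition trunc' :: "nat \<Rightarrow> real \<Rightarrow> real" where
  "trunc' k z = real k * (max 0 z) ^ (k - 1) / (1 + (max 0 z) ^ k)\<^sup>2"

lemma one_plus_max_power_pos: "0 < 1 + (max 0 z) ^ k" for z :: real
  by (simp add: add_pos_nonneg)

lemma DERIV_trunc:
  assumes "2 \<le> k" shows "(trunc k has_real_derivative trunc' k z) (at z)"
proof -
  have "1 + (max 0 z) ^ k \<noteq> 0"
    using one_plus_max_power_pos[of z k] by simp
  from DERIV_divide[OF DERIV_max_power[OF assms, of z]
      DERIV_add[OF DERIV_const DERIV_max_power[OF assms, of z]] this]
  show ?thesis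
    unfolding trunc_def[abs_def] trunc'_def by (simp add: power2_eq_square algebra_simps)
qed

lemma continuous_trunc': "continuous_on UNIV (trunc' k)"
  unfolding trunc'_def[abs_def]
  using one_plus_max_power_pos[of _ k]
  by (intro continuous_intros) (auto simp: less_imp_neq[symmetric])

lemma trunc_nonneg: "0 \<le> trunc k z"
  using one_plus_max_power_pos[of z k] by (simp add: trunc_def)

lemma trunc_le_1: "trunc k z \<le> 1"
  using one_plus_max_power_pos[of z k] by (simp add: trunc_def divide_le_eq_1)

lemma trunc_le_power: "0 \<le> z \<Longrightarrow> trunc k z \<le> z ^ k"
  using one_plus_max_power_pos[of z k] by (simp add: trunc_def divide_le_eq algebra_simps)

lemma trunc_pos: "0 < z \<Longrightarrow> 0 < trunc k z"
  using one_plus_max_power_pos[of z k] by (simp add: trunc_def)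

lemma trunc'_nonneg: "0 \<le> trunc' k z"
  by (simp add: trunc'_def)

lemma trunc'_le: "trunc' k z \<le> real k"
proof -
  define y where "y = max 0 z"
  have y: "0 \<le> y" by (simp add: y_def)
  have "y ^ (k - 1) \<le> 1 + y ^ k"
  proof (cases "y \<le> 1")
    case True
    then have "y ^ (k - 1) \<le> 1" using y by (simp add: power_le_one)
    then show ?thesis using y zero_le_power[of y k] by linarith
  next
    case False
    then have "y ^ (k - 1) \<le> y ^ k" by (intro power_increasing) auto
    then show ?thesis by simp
  qed
  also have "\<dots> \<le> (1 + y ^ k)\<^sup>2"
    using y by (simp add: power2_eq_square algebra_simps)
  finally have "y ^ (k - 1) / (1 + y ^ k)\<^sup>2 \<le> 1"
    using y by (simp add: divide_le_eq_1 add_pos_nonneg)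
  from mult_left_mono[OF this, of "real k"] show ?thesis
    by (simp add: trunc'_def y_def)
qed

lemma trunc_le_0: "0 < k \<Longrightarrow> z \<le> 0 \<Longrightarrow> trunc k z = 0"
  by (simp add: trunc_def max_def zero_power)

lemma trunc'_le_0: "2 \<le> k \<Longrightarrow> z \<le> 0 \<Longrightarrow> trunc' k z = 0"
  by (simp add: trunc'_def max_def zero_power)

text \<open>Converts the deficit of the gradient term, which carries \<open>trunc'\<close>, into a
  multiple of \<open>trunc\<close> that the zero-order term can absorb.\<close>

lemma trunc'_mult_le:
  assumes "0 < z" "0 < k" shows "z * trunc' k z \<le> real k * trunc k z"
proof -
  have "z * trunc' k z = real k * (z ^ k / (1 + z ^ k)\<^sup>2)"
    using assms by (simp add: trunc'_def power_eq_if)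
  also have "\<dots> \<le> real k * (z ^ k / (1 + z ^ k))"
    using assms by (intro mult_left_mono divide_left_mono) (auto simp: power2_eq_square add_pos_nonneg)
  finally show ?thesis using assms by (simp add: trunc_def)
qed

section \<open>Absorption of the error terms\<close>

text \<open>The zero-order term is split: a quarter pays for the lack of monotonicity of the
  weighted flux, a quarter for the cutoff error \<open>2 * \<epsilon> * trunc\<close>, and half of
  it remains. Where the zero-order difference is too small to pay, the truncation is at most a high
  power of a small quantity.\<close>

lemma pointwise_bound:
  fixes \<xi> \<eta> :: "'a::euclidean_space"
  assumes q: "0 < q" and k: "2 \<le> k" and adm: "admissible q (2 * real k) S \<rho> C" and \<epsilon>: "0 < \<epsilon>"
  shows "(signed_pow q u - signed_pow q v) * trunc k (S u - S v) / 2
      - 2 * \<epsilon> * (C * (8 * \<epsilon>) powr (min 1 (1 / q))) ^ k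
    \<le> trunc' k (S u - S v) * ((flux \<xi> - flux \<eta>) \<bullet> (\<rho> u *\<^sub>R \<xi> - \<rho> v *\<^sub>R \<eta>))
      + (signed_pow q u - signed_pow q v) * trunc k (S u - S v) - 2 * \<epsilon> * trunc k (S u - S v)"
proof -
  define f z where "f = signed_pow q u - signed_pow q v" and "z = S u - S v"
  define E where "E = C * (8 * \<epsilon>) powr (min 1 (1 / q))"
  have C: "0 < C" using adm by (simp add: admissible_def)
  have E: "0 \<le> E" using C by (simp add: E_def)
  have "f * trunc k z / 2 - 2 * \<epsilon> * E ^ k
    \<le> trunc' k z * ((flux \<xi> - flux \<eta>) \<bullet> (\<rho> u *\<^sub>R \<xi> - \<rho> v *\<^sub>R \<eta>)) + f * trunc k z - 2 * \<epsilon> * trunc k z"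
  proof (cases "v < u")
    case False
    then have "z \<le> 0"
      using adm unfolding admissible_def z_def by (metis diff_le_0_iff_le less_eq_real_def linorder_neqE_linordered_idom)
    then show ?thesis
      using k E \<epsilon> by (simp add: trunc_le_0 trunc'_le_0)
  next
    case True
    have z: "0 < z" and f: "0 < f"
      and w: "2 * real k * (\<rho> u - \<rho> v)\<^sup>2 \<le> (\<rho> u + \<rho> v) * (f * z)" and h: "z \<le> C * f powr (min 1 (1 / q))"
      using adm True signed_pow_strict_mono[OF q True] unfolding admissible_def f_def z_def by auto
    have \<rho>: "0 < \<rho> u" "0 < \<rho> v" using adm by (simp_all add: admissible_def)
    \<comment> \<open>The choice \<open>K = 2 * real k\<close> is tuned so that, after
      \<open>trunc'_mult_le\<close> removes the factor \<open>real k\<close>, exactly a quarter of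
      \<open>f * trunc k z\<close> is spent.\<close>
    have "- (f * z / (4 * real k)) \<le> - (\<rho> u - \<rho> v)\<^sup>2 / (2 * (\<rho> u + \<rho> v))"
      using w \<rho> k by (simp add: field_simps)
    also have "\<dots> \<le> (flux \<xi> - flux \<eta>) \<bullet> (\<rho> u *\<^sub>R \<xi> - \<rho> v *\<^sub>R \<eta>)"
      by (rule flux_weighted_monotone[OF \<rho>])
    finally have "trunc' k z * (- (f * z / (4 * real k))) \<le>
        trunc' k z * ((flux \<xi> - flux \<eta>) \<bullet> (\<rho> u *\<^sub>R \<xi> - \<rho> v *\<^sub>R \<eta>))"
      using trunc'_nonneg by (rule mult_left_mono)
    moreover have "- (f * trunc k z / 4) \<le> trunc' k z * (- (f * z / (4 * real k)))"
    proof -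
      have "(f / (4 * real k)) * (z * trunc' k z) \<le> (f / (4 * real k)) * (real k * trunc k z)"
        using f k trunc'_mult_le[OF z, of k] by (intro mult_left_mono) auto
      then show ?thesis using k by (simp add: mult_ac)
    qed
    \<comment> \<open>Above the threshold \<open>8 * \<epsilon>\<close> a quarter of
      \<open>f\<close> exceeds \<open>2 * \<epsilon>\<close>. Below it the growth clause of
      \<open>admissible\<close> gives \<open>z \<le> E\<close>, and the order of vanishing of
      \<open>trunc\<close> takes over.\<close>
    moreover have "2 * \<epsilon> * trunc k z \<le> f * trunc k z / 4 + 2 * \<epsilon> * E ^ k"
    proof (cases "8 * \<epsilon> \<le> f")
      case True
      have "8 * \<epsilon> * trunc k z \<le> f * trunc k z"
        using True trunc_nonneg by (rule mult_right_mono)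
      moreover have "0 \<le> 2 * \<epsilon> * E ^ k" using E \<epsilon> by simp
      ultimately show ?thesis by linarith
    next
      case False
      have "f powr (min 1 (1 / q)) \<le> (8 * \<epsilon>) powr (min 1 (1 / q))"
        using False f q by (intro powr_mono2) auto
      then have "z \<le> E"
        using h C unfolding E_def by (meson less_imp_le mult_left_mono order_trans)
      then have "trunc k z \<le> E ^ k"
        using trunc_le_power[of z k] power_mono[of z E k] z by linarith
      then have "2 * \<epsilon> * trunc k z \<le> 2 * \<epsilon> * E ^ k" using \<epsilon> by simp
      moreover have "0 \<le> f * trunc k z" using f trunc_nonneg by simp
      ultimately show ?thesis by linarith
    qed
    ultimately show ?thesis by linarith
  qed
  then show ?thesis by (simp add: f_def z_def E_def)
qed

text \<open>With base \<open>y\<close> the gradient is at most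
  \<open>2 * real m * \<epsilon>\<^sup>2 * y ^ (m - 1)\<close>. If
  \<open>y \<ge> 2 * real m * \<epsilon>\<close>, one factor \<open>2 * real m * \<epsilon>\<close>
  is traded for \<open>y\<close>; otherwise every \<open>y\<close> is replaced by
  \<open>2 * real m * \<epsilon>\<close>.\<close>

lemma norm_grad_cutoff_le:
  fixes x :: "'a::euclidean_space"
  assumes m: "2 \<le> m" and \<epsilon>: "0 < \<epsilon>"
  shows "norm (grad (cutoff m (1 / \<epsilon>\<^sup>2)) x) \<le>
    \<epsilon> * cutoff m (1 / \<epsilon>\<^sup>2) x + (2 * real m) ^ m * \<epsilon> ^ (m + 1)"
proof -
  define R where "R = 1 / \<epsilon>\<^sup>2"
  define y where "y = max 0 (1 - (norm x)\<^sup>2 / R\<^sup>2)"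
  have R: "0 < R" using \<epsilon> by (simp add: R_def)
  have y: "0 \<le> y" by (simp add: y_def)
  have m1: "m = Suc (m - 1)" using m by simp
  have g: "norm (grad (cutoff m R) x) = 2 * real m / R\<^sup>2 * y ^ (m - 1) * norm x"
    using y by (simp add: is_C1_cutoff(2)[OF m] y_def[symmetric])
  have "2 * real m / R\<^sup>2 * y ^ (m - 1) * norm x \<le> 2 * real m * \<epsilon>\<^sup>2 * y ^ (m - 1)"
  proof (cases "norm x \<le> R")
    case True
    then have "2 * real m / R\<^sup>2 * y ^ (m - 1) * norm x \<le> 2 * real m / R\<^sup>2 * y ^ (m - 1) * R"
      using y by (intro mult_left_mono) auto
    also have "\<dots> = 2 * real m * (1 / R) * y ^ (m - 1)" using R by (simp add: power2_eq_square)
    finally show ?thesis by (simp add: R_def)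
  next
    case False
    then have "R\<^sup>2 \<le> (norm x)\<^sup>2" using R by (intro power_mono) auto
    then have "y = 0" using R by (simp add: y_def field_simps)
    then show ?thesis using m by (simp add: zero_power)
  qed
  also have "\<dots> \<le> \<epsilon> * y ^ m + (2 * real m) ^ m * \<epsilon> ^ (m + 1)"
  proof (cases "2 * real m * \<epsilon> \<le> y")
    case True
    have "2 * real m * \<epsilon> * (\<epsilon> * y ^ (m - 1)) \<le> y * (\<epsilon> * y ^ (m - 1))"
      using True y \<epsilon> by (intro mult_right_mono) auto
    also have "\<dots> = \<epsilon> * y ^ m" by (subst (2) m1) simp
    finally have "2 * real m * \<epsilon>\<^sup>2 * y ^ (m - 1) \<le> \<epsilon> * y ^ m"
      by (simp add: power2_eq_square mult_ac)
    moreover have "0 \<le> (2 * real m) ^ m * \<epsilon> ^ (m + 1)" using \<epsilon> by simp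
    ultimately show ?thesis by linarith
  next
    case False
    then have "2 * real m * \<epsilon>\<^sup>2 * y ^ (m - 1) \<le> 2 * real m * \<epsilon>\<^sup>2 * (2 * real m * \<epsilon>) ^ (m - 1)"
      using y by (intro mult_left_mono power_mono) auto
    also have "\<dots> = \<epsilon> * ((2 * real m * \<epsilon>) * (2 * real m * \<epsilon>) ^ (m - 1))"
      by (simp add: power2_eq_square)
    also have "\<dots> = \<epsilon> * (2 * real m * \<epsilon>) ^ m"
      by (subst (4) m1) simp
    also have "\<dots> = (2 * real m) ^ m * \<epsilon> ^ (m + 1)"
      by (simp add: power_mult_distrib)
    finally show ?thesis
      using y \<epsilon> by (simp add: add_increasing)
  qed
  finally show ?thesis
    using g by (simp add: R_def cutoff_def y_def)
qed

subsection \<open>Convergence in \<open>L\<^sup>1\<close> on balls\<close>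

text \<open>Integrability is part of the notion: a nonintegrable function has Bochner integral 0, so
  the limit alone would say nothing.\<close>

definition L1conv :: "real \<Rightarrow> (nat \<Rightarrow> 'a::euclidean_space \<Rightarrow> 'b::euclidean_space) \<Rightarrow> ('a \<Rightarrow> 'b) \<Rightarrow> bool" where
  "L1conv r G g \<longleftrightarrow> (\<forall>n. G n \<in> borel_measurable lebesgue) \<and> g \<in> borel_measurable lebesgue \<and>
     (\<forall>n. integrable lebesgue (\<lambda>x. indicat_real (cball 0 r) x *\<^sub>R G n x)) \<and>
     integrable lebesgue (\<lambda>x. indicat_real (cball 0 r) x *\<^sub>R g x) \<and>
     (\<lambda>n. \<integral>x. indicat_real (cball 0 r) x * norm (G n x - g x) \<partial>lebesgue) \<longlonglongrightarrow> 0"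

lemma L1conv_integrable_diff:
  assumes "L1conv r G g"
  shows "integrable lebesgue (\<lambda>x. indicat_real (cball 0 r) x * norm (G n x - g x))"
proof -
  have "integrable lebesgue (\<lambda>x. norm (indicat_real (cball 0 r) x *\<^sub>R G n x - indicat_real (cball 0 r) x *\<^sub>R g x))"
    using assms unfolding L1conv_def by (intro integrable_norm Bochner_Integration.integrable_diff) auto
  then show ?thesis by (simp flip: scaleR_diff_right)
qed

lemma L1conv_subseq:
  assumes "L1conv r G g" "strict_mono s" shows "L1conv r (\<lambda>n. G (s n)) g"
  using assms LIMSEQ_subseq_LIMSEQ[of _ 0 s] unfolding L1conv_def o_def by fast

lemma L1conv_add:
  assumes G: "L1conv r G g" and H: "L1conv r H h"
  shows "L1conv r (\<lambda>n x. G n x + H n x) (\<lambda>x. g x + h x)"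
proof -
  have lim: "(\<lambda>n. \<integral>x. indicat_real (cball 0 r) x * norm ((G n x + H n x) - (g x + h x)) \<partial>lebesgue) \<longlonglongrightarrow> 0"
  proof (rule Lim_null_comparison[OF always_eventually])
    show "(\<lambda>n. (\<integral>x. indicat_real (cball 0 r) x * norm (G n x - g x) \<partial>lebesgue) +
        (\<integral>x. indicat_real (cball 0 r) x * norm (H n x - h x) \<partial>lebesgue)) \<longlonglongrightarrow> 0"
      using G H by (intro tendsto_add_zero) (auto simp: L1conv_def)
    show "\<forall>n. norm (\<integral>x. indicat_real (cball 0 r) x * norm ((G n x + H n x) - (g x + h x)) \<partial>lebesgue) \<le>
      (\<integral>x. indicat_real (cball 0 r) x * norm (G n x - g x) \<partial>lebesgue) +
        (\<integral>x. indicat_real (cball 0 r) x * norm (H n x - h x) \<partial>lebesgue)"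
    proof
      fix n
      have "(\<integral>x. indicat_real (cball 0 r) x * norm ((G n x + H n x) - (g x + h x)) \<partial>lebesgue) \<le>
        (\<integral>x. indicat_real (cball 0 r) x * norm (G n x - g x) + indicat_real (cball 0 r) x * norm (H n x - h x) \<partial>lebesgue)"
      proof (rule Bochner_Integration.integral_mono')
        fix x
        show "indicat_real (cball 0 r) x * norm ((G n x + H n x) - (g x + h x)) \<le>
          indicat_real (cball 0 r) x * norm (G n x - g x) + indicat_real (cball 0 r) x * norm (H n x - h x)"
          unfolding distrib_left[symmetric] add_diff_add
          by (intro mult_left_mono norm_triangle_ineq) auto
      qed (use L1conv_integrable_diff[OF G] L1conv_integrable_diff[OF H] in auto)
      also have "\<dots> = (\<integral>x. indicat_real (cball 0 r) x * norm (G n x - g x) \<partial>lebesgue) +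
        (\<integral>x. indicat_real (cball 0 r) x * norm (H n x - h x) \<partial>lebesgue)"
        using L1conv_integrable_diff[OF G] L1conv_integrable_diff[OF H] by simp
      finally show "norm (\<integral>x. indicat_real (cball 0 r) x * norm ((G n x + H n x) - (g x + h x)) \<partial>lebesgue) \<le>
        (\<integral>x. indicat_real (cball 0 r) x * norm (G n x - g x) \<partial>lebesgue) +
        (\<integral>x. indicat_real (cball 0 r) x * norm (H n x - h x) \<partial>lebesgue)"
        by (simp add: abs_of_nonneg Bochner_Integration.integral_nonneg)
    qed
  qed
  show ?thesis
    using G H lim unfolding L1conv_def
    by (auto simp: scaleR_add_right intro!: borel_measurable_add)
qed

text \<open>Split \<open>A G - a g\<close> as \<open>A (G - g) + (A - a) g\<close>: the first part
  is controlled by the bound on \<open>A\<close>, the second by dominated convergence with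
  \<open>2 * C * norm (g x)\<close>.\<close>

lemma L1conv_scaleR:
  fixes a :: "'a::euclidean_space \<Rightarrow> real"
  assumes G: "L1conv r G g"
    and m: "\<And>n. A n \<in> borel_measurable lebesgue" "a \<in> borel_measurable lebesgue"
    and bd: "\<And>n x. \<bar>A n x\<bar> \<le> C" "\<And>x. \<bar>a x\<bar> \<le> C"
    and conv: "AE x in lebesgue. x \<in> cball 0 r \<longrightarrow> (\<lambda>n. A n x) \<longlonglongrightarrow> a x"
  shows "L1conv r (\<lambda>n x. A n x *\<^sub>R G n x) (\<lambda>x. a x *\<^sub>R g x)"
proof -
  let ?I = "indicat_real (cball 0 r)"
  have C: "0 \<le> C" using bd(2)[of undefined] by linarith
  have Gm: "G n \<in> borel_measurable lebesgue" and gm: "g \<in> borel_measurable lebesgue"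
    and iG: "integrable lebesgue (\<lambda>x. ?I x *\<^sub>R G n x)" and ig: "integrable lebesgue (\<lambda>x. ?I x *\<^sub>R g x)" for n
    using G by (auto simp: L1conv_def)
  have Im: "?I \<in> borel_measurable lebesgue" by (rule borel_measurable_indicator) simp
  have prod: "integrable lebesgue (\<lambda>x. ?I x *\<^sub>R (b x *\<^sub>R h x))"
    if "integrable lebesgue (\<lambda>x. ?I x *\<^sub>R h x)" "b \<in> borel_measurable lebesgue" "\<And>x. \<bar>b x\<bar> \<le> C"
      "h \<in> borel_measurable lebesgue"
    for b and h :: "'a \<Rightarrow> 'b"
  proof (rule Bochner_Integration.integrable_bound)
    show "integrable lebesgue (\<lambda>x. C *\<^sub>R (?I x *\<^sub>R h x))"
      by (intro integrable_scaleR_right that(1))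
    show "(\<lambda>x. ?I x *\<^sub>R (b x *\<^sub>R h x)) \<in> borel_measurable lebesgue"
      by (intro borel_measurable_scaleR that Im)
    show "AE x in lebesgue. norm (?I x *\<^sub>R (b x *\<^sub>R h x)) \<le> norm (C *\<^sub>R (?I x *\<^sub>R h x))"
    proof (rule AE_I2)
      fix x
      show "norm (?I x *\<^sub>R (b x *\<^sub>R h x)) \<le> norm (C *\<^sub>R (?I x *\<^sub>R h x))"
        using mult_right_mono[OF that(3)[of x], of "norm (h x)"] C by (cases "x \<in> cball 0 r") auto
    qed
  qed
  have ign: "integrable lebesgue (\<lambda>x. ?I x * norm (g x))"
    using integrable_norm[OF ig] by simp
  have dct: "(\<lambda>n. \<integral>x. ?I x * (\<bar>A n x - a x\<bar> * norm (g x)) \<partial>lebesgue) \<longlonglongrightarrow> (\<integral>x. 0 \<partial>(lebesgue :: 'a measure))"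
  proof (rule integral_dominated_convergence[where w = "\<lambda>x. 2 * C * (?I x * norm (g x))"])
    show "(\<lambda>x. ?I x * (\<bar>A n x - a x\<bar> * norm (g x))) \<in> borel_measurable lebesgue" for n
      using m gm by (intro borel_measurable_times Im borel_measurable_abs borel_measurable_diff
          measurable_compose[OF _ borel_measurable_norm])
    show "AE x in lebesgue. (\<lambda>n. ?I x * (\<bar>A n x - a x\<bar> * norm (g x))) \<longlonglongrightarrow> 0"
      using conv
    proof eventually_elim
      case (elim x)
      show ?case
      proof (cases "x \<in> cball 0 r")
        case True
        then have "(\<lambda>n. A n x) \<longlonglongrightarrow> a x" using elim by blast
        then have "(\<lambda>n. A n x - a x) \<longlonglongrightarrow> 0" by (simp add: LIM_zero)
        then have "(\<lambda>n. \<bar>A n x - a x\<bar>) \<longlonglongrightarrow> 0" by (rule tendsto_rabs_zero)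
        then show ?thesis by (intro tendsto_mult_right_zero tendsto_mult_left_zero)
      qed simp
    qed
    show "AE x in lebesgue. norm (?I x * (\<bar>A n x - a x\<bar> * norm (g x))) \<le> 2 * C * (?I x * norm (g x))" for n
    proof (rule AE_I2)
      fix x
      have "\<bar>A n x - a x\<bar> \<le> 2 * C" using bd(1)[of n x] bd(2)[of x] by linarith
      from mult_right_mono[OF this, of "norm (g x)"]
      show "norm (?I x * (\<bar>A n x - a x\<bar> * norm (g x))) \<le> 2 * C * (?I x * norm (g x))"
        by (cases "x \<in> cball 0 r") auto
    qed
  qed (use ign in auto)
  have i2: "integrable lebesgue (\<lambda>x. ?I x * (\<bar>A n x - a x\<bar> * norm (g x)))" for n
  proof (rule Bochner_Integration.integrable_bound)
    show "integrable lebesgue (\<lambda>x. 2 * C * (?I x * norm (g x)))" using ign by simp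
    show "(\<lambda>x. ?I x * (\<bar>A n x - a x\<bar> * norm (g x))) \<in> borel_measurable lebesgue"
      using m gm by (intro borel_measurable_times Im borel_measurable_abs borel_measurable_diff
          measurable_compose[OF _ borel_measurable_norm])
    show "AE x in lebesgue. norm (?I x * (\<bar>A n x - a x\<bar> * norm (g x))) \<le> norm (2 * C * (?I x * norm (g x)))"
    proof (rule AE_I2)
      fix x
      have "\<bar>A n x - a x\<bar> \<le> 2 * C" using bd(1)[of n x] bd(2)[of x] by linarith
      from mult_right_mono[OF this, of "norm (g x)"]
      show "norm (?I x * (\<bar>A n x - a x\<bar> * norm (g x))) \<le> norm (2 * C * (?I x * norm (g x)))"
        using C by (cases "x \<in> cball 0 r") auto
    qed
  qed
  have lim: "(\<lambda>n. \<integral>x. ?I x * norm (A n x *\<^sub>R G n x - a x *\<^sub>R g x) \<partial>lebesgue) \<longlonglongrightarrow> 0"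
  proof (rule Lim_null_comparison[OF always_eventually])
    show "(\<lambda>n. C * (\<integral>x. ?I x * norm (G n x - g x) \<partial>lebesgue) +
        (\<integral>x. ?I x * (\<bar>A n x - a x\<bar> * norm (g x)) \<partial>lebesgue)) \<longlonglongrightarrow> 0"
      using G dct by (intro tendsto_add_zero tendsto_mult_right_zero) (auto simp: L1conv_def)
    show "\<forall>n. norm (\<integral>x. ?I x * norm (A n x *\<^sub>R G n x - a x *\<^sub>R g x) \<partial>lebesgue) \<le>
      C * (\<integral>x. ?I x * norm (G n x - g x) \<partial>lebesgue) +
        (\<integral>x. ?I x * (\<bar>A n x - a x\<bar> * norm (g x)) \<partial>lebesgue)"
    proof
      fix n
      have "(\<integral>x. ?I x * norm (A n x *\<^sub>R G n x - a x *\<^sub>R g x) \<partial>lebesgue) \<le>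
        (\<integral>x. C * (?I x * norm (G n x - g x)) + ?I x * (\<bar>A n x - a x\<bar> * norm (g x)) \<partial>lebesgue)"
      proof (rule Bochner_Integration.integral_mono')
        fix x
        have "A n x *\<^sub>R G n x - a x *\<^sub>R g x = A n x *\<^sub>R (G n x - g x) + (A n x - a x) *\<^sub>R g x"
          by (simp add: algebra_simps)
        then have "norm (A n x *\<^sub>R G n x - a x *\<^sub>R g x) \<le> \<bar>A n x\<bar> * norm (G n x - g x) + \<bar>A n x - a x\<bar> * norm (g x)"
          using norm_triangle_ineq[of "A n x *\<^sub>R (G n x - g x)" "(A n x - a x) *\<^sub>R g x"] by simp
        also have "\<dots> \<le> C * norm (G n x - g x) + \<bar>A n x - a x\<bar> * norm (g x)"
          using bd(1) by (intro add_right_mono mult_right_mono) auto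
        finally show "?I x * norm (A n x *\<^sub>R G n x - a x *\<^sub>R g x) \<le>
          C * (?I x * norm (G n x - g x)) + ?I x * (\<bar>A n x - a x\<bar> * norm (g x))"
          by (cases "x \<in> cball 0 r") auto
      qed (use L1conv_integrable_diff[OF G] i2 C in auto)
      also have "\<dots> = C * (\<integral>x. ?I x * norm (G n x - g x) \<partial>lebesgue) +
        (\<integral>x. ?I x * (\<bar>A n x - a x\<bar> * norm (g x)) \<partial>lebesgue)"
        using L1conv_integrable_diff[OF G] i2 by simp
      finally show "norm (\<integral>x. ?I x * norm (A n x *\<^sub>R G n x - a x *\<^sub>R g x) \<partial>lebesgue) \<le>
        C * (\<integral>x. ?I x * norm (G n x - g x) \<partial>lebesgue) +
        (\<integral>x. ?I x * (\<bar>A n x - a x\<bar> * norm (g x)) \<partial>lebesgue)"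
        by (simp add: abs_of_nonneg Bochner_Integration.integral_nonneg)
    qed
  qed
  show ?thesis
    unfolding L1conv_def using lim m Gm gm prod[OF iG m(1) bd(1) Gm] prod[OF ig m(2) bd(2) gm]
    by (auto intro!: borel_measurable_scaleR)
qed

lemma L1conv_const:
  assumes "g \<in> borel_measurable lebesgue" "integrable lebesgue (\<lambda>x. indicat_real (cball 0 r) x *\<^sub>R g x)"
  shows "L1conv r (\<lambda>n. g) g"
  using assms by (simp add: L1conv_def)

lemma integrable_inner_bounded:
  fixes w g :: "'a::euclidean_space \<Rightarrow> 'b::euclidean_space"
  assumes "integrable lebesgue (\<lambda>x. indicat_real (cball 0 r) x *\<^sub>R g x)" "g \<in> borel_measurable lebesgue"
    "w \<in> borel_measurable lebesgue" "\<And>x. norm (w x) \<le> C"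
  shows "integrable lebesgue (\<lambda>x. indicat_real (cball 0 r) x * (w x \<bullet> g x))"
proof (rule Bochner_Integration.integrable_bound)
  show "integrable lebesgue (\<lambda>x. C *\<^sub>R (indicat_real (cball 0 r) x *\<^sub>R g x))"
    by (intro integrable_scaleR_right assms(1))
  show "(\<lambda>x. indicat_real (cball 0 r) x * (w x \<bullet> g x)) \<in> borel_measurable lebesgue"
    using assms by (intro borel_measurable_times borel_measurable_inner borel_measurable_indicator) auto
  show "AE x in lebesgue. norm (indicat_real (cball 0 r) x * (w x \<bullet> g x)) \<le>
      norm (C *\<^sub>R (indicat_real (cball 0 r) x *\<^sub>R g x))"
  proof (rule AE_I2)
    fix x
    have C: "0 \<le> C" using assms(4)[of x] norm_ge_zero[of "w x"] by linarith
    have "\<bar>w x \<bullet> g x\<bar> \<le> C * norm (g x)"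
      using Cauchy_Schwarz_ineq2[of "w x" "g x"] mult_right_mono[OF assms(4)[of x], of "norm (g x)"] by simp
    then show "norm (indicat_real (cball 0 r) x * (w x \<bullet> g x)) \<le>
        norm (C *\<^sub>R (indicat_real (cball 0 r) x *\<^sub>R g x))"
      using C by (cases "x \<in> cball 0 r") auto
  qed
qed

text \<open>Bounded measurable fields act continuously on L1; this passes the flux term and the
  zero-order term to the limit.\<close>

lemma L1conv_inner:
  fixes w :: "'a::euclidean_space \<Rightarrow> 'b::euclidean_space"
  assumes G: "L1conv r G g" and w: "w \<in> borel_measurable lebesgue" "\<And>x. norm (w x) \<le> C"
  shows "(\<lambda>n. \<integral>x. indicat_real (cball 0 r) x * (w x \<bullet> G n x) \<partial>lebesgue) \<longlonglongrightarrow>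
    (\<integral>x. indicat_real (cball 0 r) x * (w x \<bullet> g x) \<partial>lebesgue)"
proof (rule LIM_zero_cancel, rule Lim_null_comparison[OF always_eventually])
  let ?I = "indicat_real (cball 0 r)"
  show "(\<lambda>n. C * (\<integral>x. ?I x * norm (G n x - g x) \<partial>lebesgue)) \<longlonglongrightarrow> 0"
    using G by (intro tendsto_mult_right_zero) (simp add: L1conv_def)
  have C: "0 \<le> C" using w(2)[of undefined] norm_ge_zero[of "w undefined"] by linarith
  have i1: "integrable lebesgue (\<lambda>x. ?I x * (w x \<bullet> G n x))" "integrable lebesgue (\<lambda>x. ?I x * (w x \<bullet> g x))" for n
    using G w by (auto intro!: integrable_inner_bounded simp: L1conv_def)
  show "\<forall>n. norm ((\<integral>x. ?I x * (w x \<bullet> G n x) \<partial>lebesgue) - (\<integral>x. ?I x * (w x \<bullet> g x) \<partial>lebesgue)) \<le>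
      C * (\<integral>x. ?I x * norm (G n x - g x) \<partial>lebesgue)"
  proof
    fix n
    have "norm ((\<integral>x. ?I x * (w x \<bullet> G n x) \<partial>lebesgue) - (\<integral>x. ?I x * (w x \<bullet> g x) \<partial>lebesgue)) =
      norm (\<integral>x. ?I x * (w x \<bullet> G n x) - ?I x * (w x \<bullet> g x) \<partial>lebesgue)"
      using i1 by simp
    also have "\<dots> \<le> (\<integral>x. norm (?I x * (w x \<bullet> G n x) - ?I x * (w x \<bullet> g x)) \<partial>lebesgue)"
      by (rule integral_norm_bound)
    also have "\<dots> \<le> (\<integral>x. C * (?I x * norm (G n x - g x)) \<partial>lebesgue)"
    proof (rule Bochner_Integration.integral_mono')
      fix x
      have "\<bar>w x \<bullet> (G n x - g x)\<bar> \<le> C * norm (G n x - g x)"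
        using Cauchy_Schwarz_ineq2[of "w x" "G n x - g x"] mult_right_mono[OF w(2)[of x], of "norm (G n x - g x)"]
        by simp
      then show "norm (?I x * (w x \<bullet> G n x) - ?I x * (w x \<bullet> g x)) \<le> C * (?I x * norm (G n x - g x))"
        by (cases "x \<in> cball 0 r") (auto simp: inner_diff_right)
    qed (use L1conv_integrable_diff[OF G] C in auto)
    finally show "norm ((\<integral>x. ?I x * (w x \<bullet> G n x) \<partial>lebesgue) - (\<integral>x. ?I x * (w x \<bullet> g x) \<partial>lebesgue)) \<le>
      C * (\<integral>x. ?I x * norm (G n x - g x) \<partial>lebesgue)" by simp
  qed
qed

lemma L1conv_AE_subseq:
  fixes U :: "nat \<Rightarrow> 'a::euclidean_space \<Rightarrow> 'b::euclidean_space"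
  assumes "L1conv r U u"
  obtains s where "strict_mono s" "AE x in lebesgue. x \<in> cball 0 r \<longrightarrow> (\<lambda>n. U (s n) x) \<longlonglongrightarrow> u x"
proof -
  let ?d = "\<lambda>n x. indicat_real (cball 0 r) x *\<^sub>R U n x - indicat_real (cball 0 r) x *\<^sub>R u x"
  have int: "integrable lebesgue (?d n)" for n
    using assms by (auto simp: L1conv_def)
  have "norm (?d n x) = indicat_real (cball 0 r) x * norm (U n x - u x)" for n x
    by (simp flip: scaleR_diff_right)
  then have "(\<lambda>n. \<integral>x. norm (?d n x) \<partial>lebesgue) \<longlonglongrightarrow> 0"
    using assms by (simp add: L1conv_def)
  from tendsto_L1_AE_subseq[OF int this] obtain s where s: "strict_mono s"
    "AE x in lebesgue. (\<lambda>n. ?d (s n) x) \<longlonglongrightarrow> 0" by blast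
  from s(2) have "AE x in lebesgue. x \<in> cball 0 r \<longrightarrow> (\<lambda>n. U (s n) x) \<longlonglongrightarrow> u x"
    by eventually_elim (auto simp: LIM_zero_iff)
  with s(1) that show thesis by blast
qed

subsection \<open>Nonlinear test functions\<close>

text \<open>Stated through approximation rather than \<open>is_weak_grad\<close>, so that a constant qualifies trivially,
  without having to integrate a gradient by parts.\<close>

definition approximable :: "('a::euclidean_space \<Rightarrow> real) \<Rightarrow> ('a \<Rightarrow> 'a) \<Rightarrow> bool" where
  "approximable u g \<longleftrightarrow> (\<exists>U. \<forall>r. (\<forall>n. is_C1 (U n)) \<and> L1conv r U u \<and> L1conv r (\<lambda>n. grad (U n)) g)"

lemma continuous_integrable_ball:
  fixes f :: "'a::euclidean_space \<Rightarrow> 'b::euclidean_space"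
  assumes "continuous_on UNIV f"
  shows "integrable lebesgue (\<lambda>x. indicat_real (cball 0 r) x *\<^sub>R f x)"
    "f \<in> borel_measurable lebesgue"
proof -
  have "f \<in> borel_measurable borel" using assms by (rule borel_measurable_continuous_onI)
  then show m: "f \<in> borel_measurable lebesgue" by (simp add: measurable_completion)
  have "integrable lborel (\<lambda>x. indicat_real (cball 0 r) x *\<^sub>R f x)"
    by (intro borel_integrable_compact compact_cball continuous_on_subset[OF assms] subset_UNIV)
  then show "integrable lebesgue (\<lambda>x. indicat_real (cball 0 r) x *\<^sub>R f x)"
    by (subst integrable_completion) (simp_all only: borel_measurable_integrable)
qed

lemma is_weak_grad_approximable:
  assumes u: "u \<in> Lp_loc 1" and g: "is_weak_grad u g"
  shows "approximable u g"
proof -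
  obtain U where U: "\<And>n. is_C1 (U n)"
    "\<And>r. (\<lambda>n. \<integral>x. indicat_real (cball 0 r) x * norm (U n x - u x) \<partial>lebesgue) \<longlonglongrightarrow> 0"
    "\<And>r. (\<lambda>n. \<integral>x. indicat_real (cball 0 r) x * norm (grad (U n) x - g x) \<partial>lebesgue) \<longlonglongrightarrow> 0"
    by (rule weak_grad_approx[OF u g], rule that)
  have g1: "g \<in> Lp_loc 1" using g by (simp add: is_weak_grad_def)
  have m: "u \<in> borel_measurable lebesgue" "g \<in> borel_measurable lebesgue"
    using u g1 by (simp_all add: Lp_loc_def)
  show ?thesis
    unfolding approximable_def L1conv_def
    by (intro exI[of _ U] allI conjI U m Lp_loc_1_integrable[OF u] Lp_loc_1_integrable[OF g1]
      continuous_integrable_ball[OF is_C1_continuous[OF U(1)]]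
      continuous_integrable_ball[OF is_C1_continuous_grad[OF U(1)]])
qed

lemma L1conv_const_continuous: "continuous_on UNIV f \<Longrightarrow> L1conv r (\<lambda>n. f) f"
  by (intro L1conv_const continuous_integrable_ball)

lemma approximable_const: "approximable (\<lambda>x. c) (\<lambda>x. 0)"
  unfolding approximable_def
  by (intro exI[of _ "\<lambda>n x. c"]) (simp add: is_C1_const grad_const L1conv_const_continuous)

text \<open>The second subsequence is extracted along the first, so that one index sequence gives
  almost everywhere convergence of both functions.\<close>

lemma approximable_common:
  assumes "approximable u gu" "approximable v gv"
  obtains U V where "\<And>n. is_C1 (U n)" "\<And>n. is_C1 (V n)"
    "L1conv r (\<lambda>n. grad (U n)) gu" "L1conv r (\<lambda>n. grad (V n)) gv"
    "AE x in lebesgue. x \<in> cball 0 r \<longrightarrow> (\<lambda>n. U n x) \<longlonglongrightarrow> u x \<and> (\<lambda>n. V n x) \<longlonglongrightarrow> v x"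
proof -
  obtain U where U: "\<And>n. is_C1 (U n)" "L1conv r U u" "L1conv r (\<lambda>n. grad (U n)) gu"
    using assms(1) unfolding approximable_def by blast
  obtain V where V: "\<And>n. is_C1 (V n)" "L1conv r V v" "L1conv r (\<lambda>n. grad (V n)) gv"
    using assms(2) unfolding approximable_def by blast
  obtain s where s: "strict_mono s" "AE x in lebesgue. x \<in> cball 0 r \<longrightarrow> (\<lambda>n. U (s n) x) \<longlonglongrightarrow> u x"
    using L1conv_AE_subseq[OF U(2)] .
  obtain t where t: "strict_mono t" "AE x in lebesgue. x \<in> cball 0 r \<longrightarrow> (\<lambda>n. V (s (t n)) x) \<longlonglongrightarrow> v x"
    using L1conv_AE_subseq[OF L1conv_subseq[OF V(2) s(1)]] .
  have st: "strict_mono (\<lambda>n. s (t n))"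
    using s(1) t(1) by (simp add: strict_mono_def)
  show thesis
  proof (rule that[of "\<lambda>n. U (s (t n))" "\<lambda>n. V (s (t n))"])
    show "AE x in lebesgue. x \<in> cball 0 r \<longrightarrow> (\<lambda>n. U (s (t n)) x) \<longlonglongrightarrow> u x \<and> (\<lambda>n. V (s (t n)) x) \<longlonglongrightarrow> v x"
      using s(2) t(2)
    proof eventually_elim
      case (elim x)
      then show ?case
        using LIMSEQ_subseq_LIMSEQ[of "\<lambda>n. U (s n) x" "u x" t] t(1) by (auto simp: o_def)
    qed
  qed (use U V L1conv_subseq[OF U(3) st] L1conv_subseq[OF V(3) st] in auto)
qed

text \<open>Testing with the smooth functions built from \<open>U n\<close> and \<open>V n\<close>
  is legitimate. Their gradients are sums of L1-convergent fields with coefficients that are bounded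
  and converge almost everywhere, so they converge in L1 on the ball; \<open>w\<close> is bounded
  and \<open>b\<close> locally integrable, so both terms pass to the limit.\<close>

lemma test_limit:
  fixes u v :: "'a::euclidean_space \<Rightarrow> real" and w :: "'a \<Rightarrow> 'a"
  assumes u: "approximable u gu" "u \<in> borel_measurable lebesgue"
    and v: "approximable v gv" "v \<in> borel_measurable lebesgue"
    and w: "w \<in> borel_measurable lebesgue" "\<And>x. norm (w x) \<le> C"
    and b: "b \<in> borel_measurable lebesgue" "\<And>r. integrable lebesgue (\<lambda>x. indicat_real (cball 0 r) x *\<^sub>R b x)"
    and eq: "\<And>\<psi>. \<psi> \<in> C1_0 \<Longrightarrow> (\<integral>x. w x \<bullet> grad \<psi> x \<partial>lebesgue) + (\<integral>x. b x * \<psi> x \<partial>lebesgue) = 0"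
    and \<phi>: "is_C1 \<phi>" "\<And>x. x \<notin> cball 0 r \<Longrightarrow> \<phi> x = 0" "\<And>x. \<bar>\<phi> x\<bar> \<le> 1"
    and S: "\<And>t. (S has_real_derivative \<rho> t) (at t)" "continuous_on UNIV \<rho>" "\<And>t. 0 < \<rho> t \<and> \<rho> t \<le> 1"
    and k: "2 \<le> k"
  defines "G \<equiv> \<lambda>x. trunc k (S (u x) - S (v x)) *\<^sub>R grad \<phi> x
      + (\<phi> x * trunc' k (S (u x) - S (v x))) *\<^sub>R (\<rho> (u x) *\<^sub>R gu x - \<rho> (v x) *\<^sub>R gv x)"
  shows "integrable lebesgue (\<lambda>x. w x \<bullet> G x)"
    "integrable lebesgue (\<lambda>x. b x * (trunc k (S (u x) - S (v x)) * \<phi> x))"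
    "(\<integral>x. w x \<bullet> G x \<partial>lebesgue) + (\<integral>x. b x * (trunc k (S (u x) - S (v x)) * \<phi> x) \<partial>lebesgue) = 0"
proof -
  let ?I = "indicat_real (cball 0 r :: 'a set)"
  obtain U V where U: "\<And>n. is_C1 (U n)" and V: "\<And>n. is_C1 (V n)"
    and cU: "L1conv r (\<lambda>n. grad (U n)) gu" and cV: "L1conv r (\<lambda>n. grad (V n)) gv"
    and ae: "AE x in lebesgue. x \<in> cball 0 r \<longrightarrow> (\<lambda>n. U n x) \<longlonglongrightarrow> u x \<and> (\<lambda>n. V n x) \<longlonglongrightarrow> v x"
    by (rule approximable_common[OF u(1) v(1), of r], rule that)
  \<comment> \<open>\<open>P\<close> and \<open>Q\<close> are the partial derivatives of
    \<open>T\<close>. Keeping them as separate coefficients lets each gradient be treated by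
    \<open>L1conv_scaleR\<close>.\<close>
  define T where "T a b = trunc k (S a - S b)" for a b
  define P where "P a b = trunc' k (S a - S b) * \<rho> a" for a b
  define Q where "Q a b = - (trunc' k (S a - S b) * \<rho> b)" for a b
  have cS: "isCont S t" for t using S(1) DERIV_isCont by blast
  have cT: "isCont (trunc k) t" for t using DERIV_trunc[OF k] DERIV_isCont by blast
  have cT': "isCont (trunc' k) t" for t
    using continuous_trunc'[of k] by (simp add: continuous_on_eq_continuous_at)
  have c\<rho>: "isCont \<rho> t" for t using S(2) by (simp add: continuous_on_eq_continuous_at)
  have lim: "(\<lambda>n. T (X n) (Y n)) \<longlonglongrightarrow> T a b" "(\<lambda>n. P (X n) (Y n)) \<longlonglongrightarrow> P a b" "(\<lambda>n. Q (X n) (Y n)) \<longlonglongrightarrow> Q a b"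
    if "X \<longlonglongrightarrow> a" "Y \<longlonglongrightarrow> b" for X Y a b
  proof -
    have z: "(\<lambda>n. S (X n) - S (Y n)) \<longlonglongrightarrow> S a - S b"
      by (intro tendsto_diff isCont_tendsto_compose[OF cS] that)
    show "(\<lambda>n. T (X n) (Y n)) \<longlonglongrightarrow> T a b"
      unfolding T_def by (rule isCont_tendsto_compose[OF cT z])
    show "(\<lambda>n. P (X n) (Y n)) \<longlonglongrightarrow> P a b"
      unfolding P_def
      by (rule tendsto_mult[OF isCont_tendsto_compose[OF cT' z] isCont_tendsto_compose[OF c\<rho> that(1)]])
    show "(\<lambda>n. Q (X n) (Y n)) \<longlonglongrightarrow> Q a b"
      unfolding Q_def
      by (rule tendsto_minus[OF tendsto_mult[OF isCont_tendsto_compose[OF cT' z] isCont_tendsto_compose[OF c\<rho> that(2)]]])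
  qed
  have bT: "\<bar>T a b\<bar> \<le> 1" for a b
    using trunc_nonneg[of k] trunc_le_1[of k] by (simp add: T_def abs_of_nonneg)
  have bP: "\<bar>P a b\<bar> \<le> real k" and bQ: "\<bar>Q a b\<bar> \<le> real k" for a b
    using mult_mono[OF trunc'_le[of k "S a - S b"], of "\<rho> a" 1] S(3)[of a]
      mult_mono[OF trunc'_le[of k "S a - S b"], of "\<rho> b" 1] S(3)[of b] trunc'_nonneg[of k "S a - S b"]
    by (simp_all add: P_def Q_def abs_mult)
  have mB: "S \<in> borel_measurable borel" "\<rho> \<in> borel_measurable borel"
    "trunc k \<in> borel_measurable borel" "trunc' k \<in> borel_measurable borel"
    using cS cT cT' c\<rho> by (auto intro!: borel_measurable_continuous_onI simp: continuous_on_eq_continuous_at)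
  have mTPQ: "(\<lambda>x. T (f x) (g x)) \<in> borel_measurable lebesgue" "(\<lambda>x. P (f x) (g x)) \<in> borel_measurable lebesgue"
    "(\<lambda>x. Q (f x) (g x)) \<in> borel_measurable lebesgue"
    if "f \<in> borel_measurable lebesgue" "g \<in> borel_measurable lebesgue" for f g :: "'a \<Rightarrow> real"
    unfolding T_def P_def Q_def using that mB
    by (auto intro!: borel_measurable_times borel_measurable_uminus borel_measurable_diff
        measurable_compose[of _ _ borel "trunc k"] measurable_compose[of _ _ borel "trunc' k"]
        measurable_compose[of _ _ borel S] measurable_compose[of _ _ borel \<rho>])
  have UV: "U n \<in> borel_measurable lebesgue" "V n \<in> borel_measurable lebesgue" for n
    using U V by (auto intro!: continuous_integrable_ball(2) is_C1_continuous)
  have \<phi>m: "\<phi> \<in> borel_measurable lebesgue" and g\<phi>m: "grad \<phi> \<in> borel_measurable lebesgue"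
    and ig\<phi>: "integrable lebesgue (\<lambda>x. ?I x *\<^sub>R grad \<phi> x)"
    using \<phi>(1) continuous_integrable_ball is_C1_continuous is_C1_continuous_grad by blast+
  define \<psi> where "\<psi> n x = T (U n x) (V n x) * \<phi> x" for n x
  have SU: "is_C1 (\<lambda>x. S (f x))" "grad (\<lambda>x. S (f x)) = (\<lambda>x. \<rho> (f x) *\<^sub>R grad f x)" if "is_C1 f" for f :: "'a \<Rightarrow> real"
    using is_C1_compose[OF that S(1,2)] by auto
  have Z: "is_C1 (\<lambda>x. S (U n x) - S (V n x))"
    "grad (\<lambda>x. S (U n x) - S (V n x)) = (\<lambda>x. \<rho> (U n x) *\<^sub>R grad (U n) x - \<rho> (V n x) *\<^sub>R grad (V n) x)" for n
    using is_C1_diff[OF SU(1)[OF U] SU(1)[OF V]] SU(2)[OF U] SU(2)[OF V] by auto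
  have TZ: "is_C1 (\<lambda>x. T (U n x) (V n x))"
    "grad (\<lambda>x. T (U n x) (V n x)) = (\<lambda>x. trunc' k (S (U n x) - S (V n x)) *\<^sub>R
      (\<rho> (U n x) *\<^sub>R grad (U n) x - \<rho> (V n x) *\<^sub>R grad (V n) x))" for n
    unfolding T_def using is_C1_compose[OF Z(1) DERIV_trunc[OF k] continuous_trunc'] Z(2) by auto
  have \<psi>1: "is_C1 (\<psi> n)" and g\<psi>: "grad (\<psi> n) = (\<lambda>x. T (U n x) (V n x) *\<^sub>R grad \<phi> x +
      ((\<phi> x * P (U n x) (V n x)) *\<^sub>R grad (U n) x + (\<phi> x * Q (U n x) (V n x)) *\<^sub>R grad (V n) x))" for n
    using is_C1_mult[OF TZ(1)[of n] \<phi>(1)] TZ(2)[of n] unfolding \<psi>_def[abs_def]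
    by (auto simp: P_def Q_def algebra_simps fun_eq_iff)
  have \<psi>0: "\<psi> n x = 0" if "x \<notin> cball 0 r" for n x using \<phi>(2)[OF that] by (simp add: \<psi>_def)
  have g\<psi>0: "grad (\<psi> n) x = 0" if "x \<notin> cball 0 r" for n x
    using grad_eq_0_outside[OF \<psi>1 \<psi>0 that] .
  have g\<phi>0: "grad \<phi> x = 0" if "x \<notin> cball 0 r" for x
    using grad_eq_0_outside[OF \<phi>(1,2) that] .
  have \<psi>C: "\<psi> n \<in> C1_0" for n
    using C1_0_I[OF \<psi>1 \<psi>0] .
  have aeT: "AE x in lebesgue. x \<in> cball 0 r \<longrightarrow> (\<lambda>n. T (U n x) (V n x)) \<longlonglongrightarrow> T (u x) (v x)"
    using ae by eventually_elim (auto intro: lim)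
  have aeP: "AE x in lebesgue. x \<in> cball 0 r \<longrightarrow> (\<lambda>n. \<phi> x * P (U n x) (V n x)) \<longlonglongrightarrow> \<phi> x * P (u x) (v x)"
    using ae by eventually_elim (auto intro!: lim tendsto_mult_left)
  have aeQ: "AE x in lebesgue. x \<in> cball 0 r \<longrightarrow> (\<lambda>n. \<phi> x * Q (U n x) (V n x)) \<longlonglongrightarrow> \<phi> x * Q (u x) (v x)"
    using ae by eventually_elim (auto intro!: lim tendsto_mult_left)
  have b\<phi>: "\<bar>\<phi> x * y\<bar> \<le> real k" if "\<bar>y\<bar> \<le> real k" for x y
    using mult_mono[OF \<phi>(3)[of x] that] by (simp add: abs_mult)
  have L1: "L1conv r (\<lambda>n. grad (\<psi> n)) (\<lambda>x. T (u x) (v x) *\<^sub>R grad \<phi> x +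
      ((\<phi> x * P (u x) (v x)) *\<^sub>R gu x + (\<phi> x * Q (u x) (v x)) *\<^sub>R gv x))"
    unfolding g\<psi>
  proof (intro L1conv_add)
    show "L1conv r (\<lambda>n x. T (U n x) (V n x) *\<^sub>R grad \<phi> x) (\<lambda>x. T (u x) (v x) *\<^sub>R grad \<phi> x)"
      by (rule L1conv_scaleR[OF L1conv_const[OF g\<phi>m ig\<phi>] mTPQ(1)[OF UV] mTPQ(1)[OF u(2) v(2)] bT bT aeT])
    show "L1conv r (\<lambda>n x. (\<phi> x * P (U n x) (V n x)) *\<^sub>R grad (U n) x) (\<lambda>x. (\<phi> x * P (u x) (v x)) *\<^sub>R gu x)"
      by (rule L1conv_scaleR[OF cU borel_measurable_times[OF \<phi>m mTPQ(2)[OF UV]]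
            borel_measurable_times[OF \<phi>m mTPQ(2)[OF u(2) v(2)]] b\<phi>[OF bP] b\<phi>[OF bP] aeP])
    show "L1conv r (\<lambda>n x. (\<phi> x * Q (U n x) (V n x)) *\<^sub>R grad (V n) x) (\<lambda>x. (\<phi> x * Q (u x) (v x)) *\<^sub>R gv x)"
      by (rule L1conv_scaleR[OF cV borel_measurable_times[OF \<phi>m mTPQ(3)[OF UV]]
            borel_measurable_times[OF \<phi>m mTPQ(3)[OF u(2) v(2)]] b\<phi>[OF bQ] b\<phi>[OF bQ] aeQ])
  qed
  have Geq: "G = (\<lambda>x. T (u x) (v x) *\<^sub>R grad \<phi> x +
      ((\<phi> x * P (u x) (v x)) *\<^sub>R gu x + (\<phi> x * Q (u x) (v x)) *\<^sub>R gv x))"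
    by (simp add: G_def T_def P_def Q_def algebra_simps)
  have L1: "L1conv r (\<lambda>n. grad (\<psi> n)) G" using L1 by (simp only: Geq)
  have G0: "G x = 0" if "x \<notin> cball 0 r" for x
    using \<phi>(2)[OF that] g\<phi>0[OF that] by (simp add: G_def)
  \<comment> \<open>Everything vanishes off the ball carrying \<open>\<phi>\<close>, so the
    indicators in the convergence lemmas can be inserted and removed freely.\<close>
  have IG: "?I x * (w x \<bullet> G x) = w x \<bullet> G x" "?I x * (w x \<bullet> grad (\<psi> n) x) = w x \<bullet> grad (\<psi> n) x" for x n
    using G0[of x] g\<psi>0[of x n] by (cases "x \<in> cball 0 r"; simp)+
  have "integrable lebesgue (\<lambda>x. ?I x * (w x \<bullet> G x))"
    using L1 w by (intro integrable_inner_bounded) (auto simp: L1conv_def)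
  then show "integrable lebesgue (\<lambda>x. w x \<bullet> G x)" by (simp only: IG)
  have lim1: "(\<lambda>n. \<integral>x. w x \<bullet> grad (\<psi> n) x \<partial>lebesgue) \<longlonglongrightarrow> (\<integral>x. w x \<bullet> G x \<partial>lebesgue)"
    using L1conv_inner[OF L1 w] by (simp only: IG)
  have bT\<phi>: "\<bar>T a b * \<phi> x\<bar> \<le> 1" for a b x
    using mult_mono[OF bT \<phi>(3)[of x]] by (simp add: abs_mult)
  have L2: "L1conv r (\<lambda>n x. (T (U n x) (V n x) * \<phi> x) *\<^sub>R b x) (\<lambda>x. (T (u x) (v x) * \<phi> x) *\<^sub>R b x)"
  proof (rule L1conv_scaleR[OF L1conv_const[OF b]])
    show "AE x in lebesgue. x \<in> cball 0 r \<longrightarrow> (\<lambda>n. T (U n x) (V n x) * \<phi> x) \<longlonglongrightarrow> T (u x) (v x) * \<phi> x"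
      using aeT by eventually_elim (auto intro!: tendsto_mult_right)
  qed (use bT\<phi> mTPQ(1)[OF UV] mTPQ(1)[OF u(2) v(2)] \<phi>m in \<open>auto intro!: borel_measurable_times\<close>)
  \<comment> \<open>Multiplication by a scalar is read as an inner product with the constant 1, so
    that the lemmas for vector fields apply to \<open>b\<close>.\<close>
  have Ib: "?I x * (1 \<bullet> ((T s t * \<phi> x) *\<^sub>R b x)) = b x * (T s t * \<phi> x)" for s t x
    using \<phi>(2)[of x] by (cases "x \<in> cball 0 r") auto
  have "integrable lebesgue (\<lambda>x. ?I x * (1 \<bullet> ((T (u x) (v x) * \<phi> x) *\<^sub>R b x)))"
    using L2 by (intro integrable_inner_bounded[where C = 1]) (auto simp: L1conv_def)
  then show "integrable lebesgue (\<lambda>x. b x * (trunc k (S (u x) - S (v x)) * \<phi> x))"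
    unfolding Ib by (simp only: T_def)
  have lim2: "(\<lambda>n. \<integral>x. b x * \<psi> n x \<partial>lebesgue) \<longlonglongrightarrow> (\<integral>x. b x * (T (u x) (v x) * \<phi> x) \<partial>lebesgue)"
    using L1conv_inner[OF L2, of "\<lambda>x. 1" 1] unfolding \<psi>_def by (simp only: Ib) simp
  have "(\<lambda>n. 0) \<longlonglongrightarrow> (\<integral>x. w x \<bullet> G x \<partial>lebesgue) + (\<integral>x. b x * (T (u x) (v x) * \<phi> x) \<partial>lebesgue)"
    using tendsto_add[OF lim1 lim2] eq[OF \<psi>C] by simp
  then show "(\<integral>x. w x \<bullet> G x \<partial>lebesgue) + (\<integral>x. b x * (trunc k (S (u x) - S (v x)) * \<phi> x) \<partial>lebesgue) = 0"
    using LIMSEQ_unique[OF _ tendsto_const] by (auto simp: T_def)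
qed

subsection \<open>The comparison principle\<close>

text \<open>The gradient is an explicit argument and enters through \<open>approximable\<close>,
  which puts constants with zero gradient on the same footing as weak solutions.\<close>

definition solves :: "real \<Rightarrow> ('a::euclidean_space \<Rightarrow> real) \<Rightarrow> ('a \<Rightarrow> real) \<Rightarrow> ('a \<Rightarrow> 'a) \<Rightarrow> bool" where
  "solves q h u g \<longleftrightarrow> u \<in> Lp_loc q \<and> g \<in> borel_measurable lebesgue \<and> approximable u g \<and>
     (\<forall>\<phi>\<in>C1_0. (LINT x|lebesgue. flux (g x) \<bullet> grad \<phi> x)
        + (LINT x|lebesgue. signed_pow q (u x) * \<phi> x) = (LINT x|lebesgue. h x * \<phi> x))"

lemma weak_solution_solves:
  assumes "weak_solution q h u" shows "solves q h u (weak_grad u)"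
proof -
  have u: "u \<in> Lp_loc 1" "u \<in> Lp_loc q" and ex: "\<exists>g. is_weak_grad u g"
    using assms by (auto simp: weak_solution_def W11_loc_def)
  have g: "is_weak_grad u (weak_grad u)"
    unfolding weak_grad_def using ex by (rule someI_ex)
  then have "weak_grad u \<in> borel_measurable lebesgue"
    by (simp add: is_weak_grad_def Lp_loc_def)
  then show ?thesis
    using assms u is_weak_grad_approximable[OF u(1) g]
    by (simp add: solves_def weak_solution_def flux_def divide_inverse mult.commute)
qed

lemma integrable_indicator_compact:
  fixes K :: "'a::euclidean_space set"
  assumes "compact K" shows "integrable lebesgue (indicat_real K)"
  using lmeasurable_compact[OF assms] by (intro integrable_real_indicator) (auto simp: fmeasurable_def)

text \<open>The flux of the zero gradient vanishes and the zero-order term is the right-hand side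
  itself; these constants are the barriers for both bounds.\<close>

lemma const_solves:
  assumes "0 < q" shows "solves q (\<lambda>x. signed_pow q c) (\<lambda>x::'a::euclidean_space. c) (\<lambda>x. 0)"
proof -
  have "set_integrable lebesgue K (\<lambda>x::'a. \<bar>c\<bar> powr q)" if "compact K" for K
    using integrable_indicator_compact[OF that] by (simp add: set_integrable_def)
  then show ?thesis
    using approximable_const[where 'a = 'a] by (simp add: solves_def Lp_loc_def flux_def)
qed

lemma C1_0_D:
  assumes "\<psi> \<in> C1_0" obtains r where "is_C1 \<psi>" "\<And>x. x \<notin> cball 0 r \<Longrightarrow> \<psi> x = 0"
proof -
  have "bounded (closure (support_on UNIV \<psi>))"
    using assms by (simp add: C1_0_def compact_imp_bounded)
  then obtain r where r: "closure (support_on UNIV \<psi>) \<subseteq> cball 0 r"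
    using bounded_subset_ballD[of "closure (support_on UNIV \<psi>)" 0] ball_subset_cball by fast
  have "\<psi> x = 0" if "x \<notin> cball 0 r" for x
    using r that closure_subset[of "support_on UNIV \<psi>"] by (auto simp: support_on_def)
  moreover have "is_C1 \<psi>" using assms by (simp add: C1_0_def is_C1_def)
  ultimately show thesis using that by blast
qed

lemma integrable_mult_test:
  fixes b \<psi> :: "'a::euclidean_space \<Rightarrow> real"
  assumes "integrable lebesgue (\<lambda>x. indicat_real (cball 0 r) x *\<^sub>R b x)" "b \<in> borel_measurable lebesgue"
    "\<psi> \<in> borel_measurable lebesgue" "\<And>x. \<bar>\<psi> x\<bar> \<le> C" "\<And>x. x \<notin> cball 0 r \<Longrightarrow> \<psi> x = 0"
  shows "integrable lebesgue (\<lambda>x. b x * \<psi> x)"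
proof -
  have "integrable lebesgue (\<lambda>x. indicat_real (cball 0 r) x * (\<psi> x \<bullet> b x))"
    using assms by (intro integrable_inner_bounded[where C = C]) auto
  moreover have "(\<lambda>x. indicat_real (cball 0 r) x * (\<psi> x \<bullet> b x)) = (\<lambda>x. b x * \<psi> x)"
  proof
    fix x show "indicat_real (cball 0 r) x * (\<psi> x \<bullet> b x) = b x * \<psi> x"
      using assms(5)[of x] by (cases "x \<in> cball 0 r") auto
  qed
  ultimately show ?thesis by simp
qed

text \<open>The absolute value of \<open>signed_pow q (u x)\<close> is
  \<open>\<bar>u x\<bar> powr q\<close>, so membership in \<open>Lp_loc q\<close> is precisely what
  makes the zero-order term locally integrable.\<close>

lemma signed_pow_loc:
  fixes u :: "'a::euclidean_space \<Rightarrow> real"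
  assumes "u \<in> Lp_loc q"
  shows "(\<lambda>x. signed_pow q (u x)) \<in> borel_measurable lebesgue"
    "integrable lebesgue (\<lambda>x. indicat_real (cball 0 r) x *\<^sub>R signed_pow q (u x))"
proof -
  have um: "u \<in> borel_measurable lebesgue" using assms by (simp add: Lp_loc_def)
  have "signed_pow q \<in> borel_measurable borel"
    unfolding signed_pow_def[abs_def] by measurable
  with um show m: "(\<lambda>x. signed_pow q (u x)) \<in> borel_measurable lebesgue"
    by (rule measurable_compose)
  have "integrable lebesgue (\<lambda>x. indicat_real (cball 0 r) x *\<^sub>R (norm (u x) powr q))"
    using assms by (simp add: Lp_loc_def set_integrable_def)
  then show "integrable lebesgue (\<lambda>x. indicat_real (cball 0 r) x *\<^sub>R signed_pow q (u x))"
  proof (rule Bochner_Integration.integrable_bound)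
    show "(\<lambda>x. indicat_real (cball 0 r) x *\<^sub>R signed_pow q (u x)) \<in> borel_measurable lebesgue"
      using m by (intro borel_measurable_scaleR borel_measurable_indicator) auto
  qed (simp add: abs_mult abs_signed_pow)
qed

lemma flux_measurable:
  assumes "g \<in> borel_measurable lebesgue"
  shows "(\<lambda>x. flux (g x)) \<in> borel_measurable lebesgue"
proof -
  have "flux \<in> borel_measurable borel"
    unfolding flux_def[abs_def] by measurable
  with assms show ?thesis by (rule measurable_compose)
qed

lemma trunc_measurable:
  fixes u v :: "'a::euclidean_space \<Rightarrow> real"
  assumes adm: "admissible q K S \<rho> C" and k: "2 \<le> k"
    and uv: "u \<in> borel_measurable lebesgue" "v \<in> borel_measurable lebesgue"
  shows "(\<lambda>x. trunc k (S (u x) - S (v x))) \<in> borel_measurable lebesgue"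
proof -
  have "isCont S t" for t
    using adm DERIV_isCont unfolding admissible_def by blast
  then have "S \<in> borel_measurable borel"
    by (intro borel_measurable_continuous_onI) (simp add: continuous_on_eq_continuous_at)
  moreover have "isCont (trunc k) t" for t
    using DERIV_trunc[OF k] DERIV_isCont by blast
  then have "trunc k \<in> borel_measurable borel"
    by (intro borel_measurable_continuous_onI) (simp add: continuous_on_eq_continuous_at)
  ultimately show ?thesis
    using uv by (auto intro!: measurable_compose[of _ _ borel "trunc k"] borel_measurable_diff
        measurable_compose[of _ _ borel S])
qed

text \<open>Subtracting the two equations under the integral sign requires every single term to be
  integrable, which boundedness of the flux and local integrability of the remaining data
  provide.\<close>

lemma solves_diff:
  fixes u v :: "'a::euclidean_space \<Rightarrow> real"
  assumes u: "solves q h1 u gu" and v: "solves q h2 v gv" and h: "h1 \<in> Lp_loc 1" "h2 \<in> Lp_loc 1"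
    and \<psi>: "\<psi> \<in> C1_0"
  shows "(\<integral>x. (flux (gu x) - flux (gv x)) \<bullet> grad \<psi> x \<partial>lebesgue) +
     (\<integral>x. ((signed_pow q (u x) - signed_pow q (v x)) - (h1 x - h2 x)) * \<psi> x \<partial>lebesgue) = 0"
proof -
  obtain r where \<psi>1: "is_C1 \<psi>" and \<psi>0: "\<And>x. x \<notin> cball 0 r \<Longrightarrow> \<psi> x = 0"
    by (rule C1_0_D[OF \<psi>], rule that)
  have cont: "continuous_on UNIV \<psi>" "continuous_on UNIV (grad \<psi>)"
    using \<psi>1 by (simp_all add: is_C1_continuous is_C1_continuous_grad)
  obtain L where L: "\<And>x. norm (\<psi> x) \<le> L"
    by (rule bounded_of_support[OF cont(1), of r]) (use \<psi>0 that in auto)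
  have test: "integrable lebesgue (\<lambda>x. b x * \<psi> x)"
    if "b \<in> borel_measurable lebesgue" "integrable lebesgue (\<lambda>x. indicat_real (cball 0 r) x *\<^sub>R b x)" for b
    using that L \<psi>0 continuous_integrable_ball(2)[OF cont(1)]
    by (intro integrable_mult_test[where C = L]) auto
  have gtest: "integrable lebesgue (\<lambda>x. flux (g x) \<bullet> grad \<psi> x)" if "g \<in> borel_measurable lebesgue" for g :: "'a \<Rightarrow> 'a"
  proof -
    have "integrable lebesgue (\<lambda>x. indicat_real (cball 0 r) x * (flux (g x) \<bullet> grad \<psi> x))"
      using that norm_flux_le continuous_integrable_ball[OF cont(2)] flux_measurable
      by (intro integrable_inner_bounded[where C = 1]) auto
    moreover have "indicat_real (cball 0 r) x * (flux (g x) \<bullet> grad \<psi> x) = flux (g x) \<bullet> grad \<psi> x" for x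
      using grad_eq_0_outside[of \<psi> 0 r x, OF \<psi>1 \<psi>0] by (cases "x \<in> cball 0 r") auto
    ultimately show ?thesis by (simp only:)
  qed
  have hm: "h1 \<in> borel_measurable lebesgue" "h2 \<in> borel_measurable lebesgue"
    using h by (simp_all add: Lp_loc_def)
  have ih: "integrable lebesgue (\<lambda>x. h1 x * \<psi> x)" "integrable lebesgue (\<lambda>x. h2 x * \<psi> x)"
    using test hm Lp_loc_1_integrable[OF h(1)] Lp_loc_1_integrable[OF h(2)] by auto
  have isp: "integrable lebesgue (\<lambda>x. signed_pow q (u x) * \<psi> x)" "integrable lebesgue (\<lambda>x. signed_pow q (v x) * \<psi> x)"
    using u v by (auto intro!: test signed_pow_loc simp: solves_def simp del: real_scaleR_def)
  have ig: "integrable lebesgue (\<lambda>x. flux (gu x) \<bullet> grad \<psi> x)" "integrable lebesgue (\<lambda>x. flux (gv x) \<bullet> grad \<psi> x)"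
    using gtest u v by (auto simp: solves_def)
  have "(\<integral>x. (flux (gu x) - flux (gv x)) \<bullet> grad \<psi> x \<partial>lebesgue) =
      (\<integral>x. flux (gu x) \<bullet> grad \<psi> x \<partial>lebesgue) - (\<integral>x. flux (gv x) \<bullet> grad \<psi> x \<partial>lebesgue)"
    using ig by (simp add: inner_diff_left)
  moreover have "(\<integral>x. ((signed_pow q (u x) - signed_pow q (v x)) - (h1 x - h2 x)) * \<psi> x \<partial>lebesgue) =
     ((\<integral>x. signed_pow q (u x) * \<psi> x \<partial>lebesgue) - (\<integral>x. signed_pow q (v x) * \<psi> x \<partial>lebesgue)) -
     ((\<integral>x. h1 x * \<psi> x \<partial>lebesgue) - (\<integral>x. h2 x * \<psi> x \<partial>lebesgue))"
    using ih isp by (simp add: left_diff_distrib)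
  moreover have "(\<integral>x. flux (gu x) \<bullet> grad \<psi> x \<partial>lebesgue) + (\<integral>x. signed_pow q (u x) * \<psi> x \<partial>lebesgue)
       = (\<integral>x. h1 x * \<psi> x \<partial>lebesgue)"
     "(\<integral>x. flux (gv x) \<bullet> grad \<psi> x \<partial>lebesgue) + (\<integral>x. signed_pow q (v x) * \<psi> x \<partial>lebesgue)
       = (\<integral>x. h2 x * \<psi> x \<partial>lebesgue)"
    using u v \<psi> by (auto simp: solves_def)
  ultimately show ?thesis by linarith
qed

section \<open>Decay of the error and passage to the limit\<close>

text \<open>Division by \<open>\<epsilon> ^ m\<close> accounts for the volume of the support.
  Choosing \<open>k\<close> with \<open>a * real k \<ge> real m\<close> makes each error of order
  \<open>\<epsilon> ^ (m + 1)\<close>, so one power of \<open>\<epsilon>\<close> survives.\<close>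

lemma scaled_error_bound:
  fixes a C \<epsilon> :: real
  assumes \<epsilon>: "0 < \<epsilon>" "\<epsilon> \<le> 1" and C: "0 < C" and ak: "real m \<le> a * real k"
  shows "(2 * \<epsilon> * (C * (8 * \<epsilon>) powr a) ^ k + 2 * ((2 * real m) ^ m * \<epsilon> ^ (m + 1))) / \<epsilon> ^ m \<le>
    (2 * C ^ k * 8 powr (a * real k) + 2 * (2 * real m) ^ m) * \<epsilon>"
proof -
  have "((8 * \<epsilon>) powr a) ^ k = (8 * \<epsilon>) powr (a * real k)"
    using \<epsilon> by (simp add: powr_powr flip: powr_realpow)
  also have "\<dots> = 8 powr (a * real k) * \<epsilon> powr (a * real k)"
    using \<epsilon> by (simp add: powr_mult)
  also have "\<dots> \<le> 8 powr (a * real k) * \<epsilon> powr real m"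
    using \<epsilon> ak by (intro mult_left_mono powr_mono') auto
  finally have 1: "((8 * \<epsilon>) powr a) ^ k \<le> 8 powr (a * real k) * \<epsilon> ^ m"
    using \<epsilon> by (simp add: powr_realpow)
  have "2 * \<epsilon> * (C * (8 * \<epsilon>) powr a) ^ k = 2 * \<epsilon> * C ^ k * ((8 * \<epsilon>) powr a) ^ k"
    by (simp add: power_mult_distrib)
  also have "\<dots> \<le> 2 * \<epsilon> * C ^ k * (8 powr (a * real k) * \<epsilon> ^ m)"
    using 1 \<epsilon> C by (intro mult_left_mono) auto
  finally have "2 * \<epsilon> * (C * (8 * \<epsilon>) powr a) ^ k + 2 * ((2 * real m) ^ m * \<epsilon> ^ (m + 1)) \<le>
     (2 * C ^ k * 8 powr (a * real k) + 2 * (2 * real m) ^ m) * \<epsilon> * \<epsilon> ^ m"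
    by (simp add: algebra_simps)
  then show ?thesis using \<epsilon> by (simp add: divide_le_eq)
qed

text \<open>Integrates the pointwise bound against the cutoff. The order of \<open>h1\<close> and
  \<open>h2\<close> gives the difference of the data a favourable sign, and
  \<open>m = 2 * DIM('a)\<close> turns the volume of the ball of radius
  \<open>1 / \<epsilon>\<^sup>2\<close> into a multiple of
  \<open>1 / \<epsilon> ^ m\<close>.\<close>

lemma comparison_estimate:
  fixes u v :: "'a::euclidean_space \<Rightarrow> real"
  assumes q: "0 < q" and u: "solves q h1 u gu" and v: "solves q h2 v gv"
    and h: "h1 \<in> Lp_loc 1" "h2 \<in> Lp_loc 1" "AE x in lebesgue. h1 x \<le> h2 x"
    and k: "2 \<le> k" and adm: "admissible q (2 * real k) S \<rho> C"
    and m: "m = 2 * DIM('a)" and \<epsilon>: "0 < \<epsilon>"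
  defines "F \<equiv> \<lambda>x. (signed_pow q (u x) - signed_pow q (v x)) * trunc k (S (u x) - S (v x))"
  shows "integrable lebesgue (\<lambda>x. F x * cutoff m (1 / \<epsilon>\<^sup>2) x)"
    "(\<integral>x. F x * cutoff m (1 / \<epsilon>\<^sup>2) x \<partial>lebesgue) \<le>
      2 * unit_ball_vol (DIM('a)) *
      ((2 * \<epsilon> * (C * (8 * \<epsilon>) powr (min 1 (1 / q))) ^ k + 2 * ((2 * real m) ^ m * \<epsilon> ^ (m + 1))) / \<epsilon> ^ m)"
proof -
  have m2: "2 \<le> m" using m DIM_positive[where 'a = 'a] by linarith
  define R where "R = 1 / \<epsilon>\<^sup>2"
  have R: "0 < R" using \<epsilon> by (simp add: R_def)
  define \<phi> :: "'a \<Rightarrow> real" where "\<phi> = cutoff m R"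
  have \<phi>1: "is_C1 \<phi>" unfolding \<phi>_def using m2 by (rule is_C1_cutoff)
  have \<phi>0: "\<phi> x = 0" if "x \<notin> cball 0 R" for x
    unfolding \<phi>_def using cutoff_eq_0[OF R _ that] m2 by simp
  have \<phi>b: "0 \<le> \<phi> x" "\<phi> x \<le> 1" for x
    unfolding \<phi>_def by (simp_all add: cutoff_nonneg cutoff_le_1)
  have g\<phi>0: "grad \<phi> x = 0" if "x \<notin> cball 0 R" for x
    using grad_eq_0_outside[OF \<phi>1 \<phi>0 that] .
  have S: "\<And>t. (S has_real_derivative \<rho> t) (at t)" "continuous_on UNIV \<rho>" "\<And>t. 0 < \<rho> t \<and> \<rho> t \<le> 1"
    using adm by (auto simp: admissible_def)
  define w where "w x = flux (gu x) - flux (gv x)" for x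
  define T where "T x = trunc k (S (u x) - S (v x))" for x
  define f where "f x = signed_pow q (u x) - signed_pow q (v x)" for x
  define b where "b x = f x - (h1 x - h2 x)" for x
  have um: "u \<in> borel_measurable lebesgue" "v \<in> borel_measurable lebesgue"
    using u v by (auto simp: solves_def Lp_loc_def)
  have wm: "w \<in> borel_measurable lebesgue"
    unfolding w_def using u v by (auto intro!: borel_measurable_diff flux_measurable simp: solves_def)
  have wb: "norm (w x) \<le> 2" for x
    unfolding w_def using norm_triangle_ineq4[of "flux (gu x)" "flux (gv x)"] norm_flux_le[of "gu x"] norm_flux_le[of "gv x"]
    by linarith
  have fm: "f \<in> borel_measurable lebesgue" and fi: "integrable lebesgue (\<lambda>x. indicat_real (cball 0 r) x *\<^sub>R f x)" for r
    unfolding f_def using signed_pow_loc[of u q] signed_pow_loc[of v q] u v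
    by (auto intro!: borel_measurable_diff simp: solves_def scaleR_diff_right simp del: real_scaleR_def)
  have hm: "h1 \<in> borel_measurable lebesgue" "h2 \<in> borel_measurable lebesgue"
    using h by (simp_all add: Lp_loc_def)
  have bm: "b \<in> borel_measurable lebesgue" and bi: "integrable lebesgue (\<lambda>x. indicat_real (cball 0 r) x *\<^sub>R b x)" for r
    unfolding b_def using fm hm fi[of r] Lp_loc_1_integrable[OF h(1)] Lp_loc_1_integrable[OF h(2)]
    by (auto intro!: borel_measurable_diff simp: scaleR_diff_right simp del: real_scaleR_def)
  have eq: "(\<integral>x. w x \<bullet> grad \<psi> x \<partial>lebesgue) + (\<integral>x. b x * \<psi> x \<partial>lebesgue) = 0" if "\<psi> \<in> C1_0" for \<psi>
    using solves_diff[OF u v h(1,2) that] by (simp add: w_def b_def f_def)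
  define Q where "Q x = \<rho> (u x) *\<^sub>R gu x - \<rho> (v x) *\<^sub>R gv x" for x
  define G where "G x = T x *\<^sub>R grad \<phi> x + (\<phi> x * trunc' k (S (u x) - S (v x))) *\<^sub>R Q x" for x
  have tl: "integrable lebesgue (\<lambda>x. w x \<bullet> G x)" "integrable lebesgue (\<lambda>x. b x * (T x * \<phi> x))"
    "(\<integral>x. w x \<bullet> G x \<partial>lebesgue) + (\<integral>x. b x * (T x * \<phi> x) \<partial>lebesgue) = 0"
    unfolding G_def T_def Q_def
    by (rule test_limit[OF _ um(1) _ um(2) wm wb bm bi eq \<phi>1 \<phi>0 _ S k];
        use u v \<phi>b in \<open>auto simp: solves_def abs_of_nonneg\<close>)+
  have T: "0 \<le> T x" "T x \<le> 1" for x by (simp_all add: T_def trunc_nonneg trunc_le_1)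
  have Tm: "T \<in> borel_measurable lebesgue"
    unfolding T_def by (rule trunc_measurable[OF adm k um])
  have \<phi>m: "\<phi> \<in> borel_measurable lebesgue"
    using continuous_integrable_ball(2)[OF is_C1_continuous[OF \<phi>1]] .
  have "integrable lebesgue (\<lambda>x. f x * (T x * \<phi> x))"
  proof (rule integrable_mult_test[OF fi[of R] fm, where C = 1])
    show "\<bar>T x * \<phi> x\<bar> \<le> 1" for x
      using T[of x] \<phi>b[of x] by (simp add: abs_mult mult_le_one)
  qed (use Tm \<phi>m \<phi>0 in auto)
  then have iF: "integrable lebesgue (\<lambda>x. F x * \<phi> x)"
    by (simp add: F_def f_def T_def mult.assoc)
  then show "integrable lebesgue (\<lambda>x. F x * cutoff m (1 / \<epsilon>\<^sup>2) x)"
    by (simp add: \<phi>_def R_def)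
  \<comment> \<open>The first summand is the error of \<open>pointwise_bound\<close>; the second is
    the error of \<open>norm_grad_cutoff_le\<close>, doubled by the bound 2 on
    \<open>w\<close>.\<close>
  define E where "E = 2 * \<epsilon> * (C * (8 * \<epsilon>) powr (min 1 (1 / q))) ^ k + 2 * ((2 * real m) ^ m * \<epsilon> ^ (m + 1))"
  have C: "0 < C" using adm by (simp add: admissible_def)
  have ptw: "F x * \<phi> x / 2 - E * indicat_real (cball 0 R) x \<le> w x \<bullet> G x + b x * (T x * \<phi> x)"
    if "h1 x \<le> h2 x" for x
  proof (cases "x \<in> cball 0 R")
    case False
    then show ?thesis by (simp add: \<phi>0 g\<phi>0 G_def)
  next
    case True
    \<comment> \<open>The summand \<open>- 2 * \<epsilon> * T x\<close> reserves room for the cutoff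
      gradient: it is added back in the decomposition below and there offsets the main part of the
      flux against \<open>grad \<phi>\<close>.\<close>
    define A where "A = trunc' k (S (u x) - S (v x)) * (w x \<bullet> Q x) + f x * T x - 2 * \<epsilon> * T x"
    define e1 where "e1 = 2 * \<epsilon> * (C * (8 * \<epsilon>) powr (min 1 (1 / q))) ^ k"
    define e2 where "e2 = (2 * real m) ^ m * \<epsilon> ^ (m + 1)"
    have e: "0 \<le> e1" "0 \<le> e2" using \<epsilon> C by (simp_all add: e1_def e2_def)
    have "F x / 2 - e1 \<le> A"
      using pointwise_bound[OF q k adm \<epsilon>, of "u x" "v x" "gu x" "gv x"]
      by (simp add: A_def e1_def F_def f_def T_def w_def Q_def)
    then have "\<phi> x * (F x / 2 - e1) \<le> \<phi> x * A"
      using \<phi>b(1) by (rule mult_left_mono)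
    moreover have "\<phi> x * e1 \<le> e1"
      using \<phi>b(2)[of x] e(1) by (simp add: mult_left_le_one_le \<phi>b(1))
    moreover have "- (2 * (\<epsilon> * \<phi> x * T x + e2)) \<le> T x * (w x \<bullet> grad \<phi> x)"
    proof -
      have "norm (grad \<phi> x) \<le> \<epsilon> * \<phi> x + e2"
        using norm_grad_cutoff_le[OF m2 \<epsilon>, of x] by (simp add: \<phi>_def R_def e2_def)
      moreover have "\<bar>w x \<bullet> grad \<phi> x\<bar> \<le> 2 * norm (grad \<phi> x)"
        using Cauchy_Schwarz_ineq2[of "w x" "grad \<phi> x"] mult_right_mono[OF wb[of x], of "norm (grad \<phi> x)"]
        by simp
      ultimately have "\<bar>w x \<bullet> grad \<phi> x\<bar> \<le> 2 * (\<epsilon> * \<phi> x + e2)"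
        by (smt (verit))
      then have "- (2 * (\<epsilon> * \<phi> x + e2)) \<le> w x \<bullet> grad \<phi> x"
        by (simp add: abs_le_iff)
      then have "T x * (- (2 * (\<epsilon> * \<phi> x + e2))) \<le> T x * (w x \<bullet> grad \<phi> x)"
        using T(1) by (rule mult_left_mono)
      moreover have "T x * e2 \<le> e2" using T[of x] e(2) by (simp add: mult_left_le_one_le)
      ultimately show ?thesis by (simp add: algebra_simps)
    qed
    moreover have "0 \<le> (h2 x - h1 x) * (T x * \<phi> x)"
      using that T(1) \<phi>b(1) by (intro mult_nonneg_nonneg) auto
    moreover have "w x \<bullet> G x + b x * (T x * \<phi> x) =
       \<phi> x * A + T x * (w x \<bullet> grad \<phi> x) + 2 * (\<epsilon> * \<phi> x * T x) + (h2 x - h1 x) * (T x * \<phi> x)"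
      by (simp add: G_def A_def b_def inner_add_right algebra_simps)
    moreover have "F x * \<phi> x / 2 - \<phi> x * e1 = \<phi> x * (F x / 2 - e1)" by (simp add: algebra_simps)
    moreover have "E * indicat_real (cball 0 R) x = e1 + 2 * e2"
      using True by (simp add: E_def e1_def e2_def)
    ultimately show ?thesis by argo
  qed
  have iball: "integrable lebesgue (indicat_real (cball (0::'a) R))"
    by (rule integrable_indicator_compact) simp
  have "(\<integral>x. F x * \<phi> x / 2 - E * indicat_real (cball 0 R) x \<partial>lebesgue) \<le>
      (\<integral>x. w x \<bullet> G x + b x * (T x * \<phi> x) \<partial>lebesgue)"
  proof (rule integral_mono_AE)
    show "AE x in lebesgue. F x * \<phi> x / 2 - E * indicat_real (cball 0 R) x \<le> w x \<bullet> G x + b x * (T x * \<phi> x)"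
      using h(3) by eventually_elim (rule ptw)
  qed (use iF iball tl in auto)
  also have "\<dots> = 0" using tl by simp
  also have "(\<integral>x. F x * \<phi> x / 2 - E * indicat_real (cball 0 R) x \<partial>lebesgue) =
      (\<integral>x. F x * \<phi> x \<partial>lebesgue) / 2 - E * measure lebesgue (cball (0::'a) R)"
    using iF iball by simp
  finally have "(\<integral>x. F x * \<phi> x \<partial>lebesgue) \<le> 2 * (E * measure lebesgue (cball (0::'a) R))" by simp
  also have "measure lebesgue (cball (0::'a) R) = unit_ball_vol (DIM('a)) * R ^ DIM('a)"
    using content_cball[of R "0::'a"] R by simp
  also have "R ^ DIM('a) = 1 / \<epsilon> ^ m"
    by (simp add: R_def m power_one_over power_mult)
  finally show "(\<integral>x. F x * cutoff m (1 / \<epsilon>\<^sup>2) x \<partial>lebesgue) \<le>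
      2 * unit_ball_vol (DIM('a)) *
      ((2 * \<epsilon> * (C * (8 * \<epsilon>) powr (min 1 (1 / q))) ^ k + 2 * ((2 * real m) ^ m * \<epsilon> ^ (m + 1))) / \<epsilon> ^ m)"
    by (simp add: E_def \<phi>_def R_def mult_ac)
qed

text \<open>The nonnegative function \<open>F\<close> can vanish only where
  \<open>u \<le> v\<close>. Its integral over a fixed ball is bounded by a multiple of
  \<open>\<epsilon>\<close> for all small \<open>\<epsilon>\<close>, hence is 0.\<close>

lemma comparison:
  fixes u v :: "'a::euclidean_space \<Rightarrow> real"
  assumes q: "0 < q" and u: "solves q h1 u gu" and v: "solves q h2 v gv"
    and h: "h1 \<in> Lp_loc 1" "h2 \<in> Lp_loc 1" "AE x in lebesgue. h1 x \<le> h2 x"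
  shows "AE x in lebesgue. u x \<le> v x"
proof -
  define a where "a = min 1 (1 / q)"
  have a: "0 < a" using q by (simp add: a_def)
  define m where "m = 2 * DIM('a)"
  \<comment> \<open>The order of vanishing has to beat the volume growth,
    \<open>a * k \<ge> m\<close>; the maximum with 2 below keeps the truncation
    \<open>C^1\<close>.\<close>
  obtain k0 :: nat where k0: "real m / a \<le> real k0" using real_arch_simple by blast
  define k where "k = max 2 k0"
  have k: "2 \<le> k" by (simp add: k_def)
  have "real m / a \<le> real k" using k0 by (simp add: k_def)
  then have ak: "real m \<le> a * real k" using a by (simp add: field_simps)
  obtain S \<rho> C where adm: "admissible q (2 * real k) S \<rho> C"
    using admissible_exists[OF q] by blast
  have C: "0 < C" using adm by (simp add: admissible_def)
  define F where "F x = (signed_pow q (u x) - signed_pow q (v x)) * trunc k (S (u x) - S (v x))" for x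
  have F1: "u x \<le> v x" if "F x = 0" for x
  proof (rule ccontr)
    assume "\<not> u x \<le> v x"
    then have uv: "v x < u x" by simp
    then have "S (v x) < S (u x)" using adm by (simp add: admissible_def)
    then have "0 < F x"
      using signed_pow_strict_mono[OF q uv] by (simp add: F_def trunc_pos)
    with that show False by simp
  qed
  have F0: "0 \<le> F x" for x
  proof (cases "v x < u x")
    case True
    then show ?thesis
      using signed_pow_strict_mono[OF q True] trunc_nonneg by (simp add: F_def)
  next
    case False
    then have "S (u x) - S (v x) \<le> 0"
      using adm unfolding admissible_def by (cases "u x = v x") (auto simp: less_le)
    then show ?thesis using k by (simp add: F_def trunc_le_0)
  qed
  define D where "D = 2 * unit_ball_vol (DIM('a)) * (2 * C ^ k * 8 powr (a * real k) + 2 * (2 * real m) ^ m)"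
  have est: "integrable lebesgue (\<lambda>x. F x * cutoff m (1 / \<epsilon>\<^sup>2) x)"
    "(\<integral>x. F x * cutoff m (1 / \<epsilon>\<^sup>2) x \<partial>lebesgue) \<le> D * \<epsilon>" if \<epsilon>: "0 < \<epsilon>" "\<epsilon> \<le> 1" for \<epsilon>
  proof -
    note ce = comparison_estimate[OF q u v h k adm m_def \<epsilon>(1), folded F_def a_def]
    show "integrable lebesgue (\<lambda>x. F x * cutoff m (1 / \<epsilon>\<^sup>2) x)" by (rule ce(1))
    have "2 * unit_ball_vol (DIM('a)) * ((2 * \<epsilon> * (C * (8 * \<epsilon>) powr a) ^ k + 2 * ((2 * real m) ^ m * \<epsilon> ^ (m + 1))) / \<epsilon> ^ m)
      \<le> 2 * unit_ball_vol (DIM('a)) * ((2 * C ^ k * 8 powr (a * real k) + 2 * (2 * real m) ^ m) * \<epsilon>)"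
      using scaled_error_bound[OF \<epsilon> C ak] by (intro mult_left_mono) auto
    then show "(\<integral>x. F x * cutoff m (1 / \<epsilon>\<^sup>2) x \<partial>lebesgue) \<le> D * \<epsilon>"
      using ce(2) by (simp add: D_def mult.assoc)
  qed
  have Fm: "F \<in> borel_measurable lebesgue"
  proof -
    have um: "u \<in> borel_measurable lebesgue" "v \<in> borel_measurable lebesgue"
      using u v by (auto simp: solves_def Lp_loc_def)
    show ?thesis
      unfolding F_def[abs_def] using u v
      by (intro borel_measurable_times borel_measurable_diff trunc_measurable[OF adm k um] signed_pow_loc(1))
        (simp_all add: solves_def)
  qed
  have ball: "AE x in lebesgue. x \<in> cball 0 (real r) \<longrightarrow> F x = 0" for r :: nat
  proof -
    define c where "c = ((3/4)::real) ^ m"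
    have c: "0 < c" by (simp add: c_def)
    \<comment> \<open>The condition on \<open>\<epsilon>\<close> says that the fixed ball lies
      within half the cutoff radius \<open>1 / \<epsilon>\<^sup>2\<close>, where the cutoff is at
      least \<open>(3/4) ^ m\<close>.\<close>
    have low: "c * (indicat_real (cball 0 (real r)) x * F x) \<le> F x * cutoff m (1 / \<epsilon>\<^sup>2) x"
      if "0 < \<epsilon>" "\<epsilon>\<^sup>2 * (2 * real r) \<le> 1" for \<epsilon> x
    proof (cases "x \<in> cball 0 (real r)")
      case True
      have "real r \<le> 1 / \<epsilon>\<^sup>2 / 2" using that by (simp add: field_simps)
      then have "norm x \<le> 1 / \<epsilon>\<^sup>2 / 2" using True by simp
      then have "c \<le> cutoff m (1 / \<epsilon>\<^sup>2) x"
        unfolding c_def using that(1) by (intro cutoff_ge) auto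
      from mult_left_mono[OF this F0[of x]] show ?thesis using True by (simp add: mult.commute)
    next
      case False
      then show ?thesis using F0[of x] by (simp add: cutoff_nonneg)
    qed
    have Im: "(\<lambda>x. indicat_real (cball 0 (real r)) x * F x) \<in> borel_measurable lebesgue"
      using Fm by (intro borel_measurable_times borel_measurable_indicator) auto
    have bnd: "integrable lebesgue (\<lambda>x. indicat_real (cball 0 (real r)) x * F x)"
      "c * (\<integral>x. indicat_real (cball 0 (real r)) x * F x \<partial>lebesgue) \<le> D * \<epsilon>"
      if \<epsilon>: "0 < \<epsilon>" "\<epsilon> \<le> 1" "\<epsilon>\<^sup>2 * (2 * real r) \<le> 1" for \<epsilon>
    proof -
      have "integrable lebesgue (\<lambda>x. c * (indicat_real (cball 0 (real r)) x * F x))"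
      proof (rule Bochner_Integration.integrable_bound[OF est(1)[OF \<epsilon>(1,2)]])
        show "AE x in lebesgue. norm (c * (indicat_real (cball 0 (real r)) x * F x)) \<le> norm (F x * cutoff m (1 / \<epsilon>\<^sup>2) x)"
        proof (rule AE_I2)
          fix x
          have "0 \<le> c * (indicat_real (cball 0 (real r)) x * F x)" using c F0 by simp
          then show "norm (c * (indicat_real (cball 0 (real r)) x * F x)) \<le> norm (F x * cutoff m (1 / \<epsilon>\<^sup>2) x)"
            using low[OF \<epsilon>(1,3), of x] by simp
        qed
      qed (use Im in auto)
      then show i: "integrable lebesgue (\<lambda>x. indicat_real (cball 0 (real r)) x * F x)"
        using c by simp
      have "(\<integral>x. c * (indicat_real (cball 0 (real r)) x * F x) \<partial>lebesgue) \<le>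
         (\<integral>x. F x * cutoff m (1 / \<epsilon>\<^sup>2) x \<partial>lebesgue)"
        using i est(1)[OF \<epsilon>(1,2)] low[OF \<epsilon>(1,3)] by (intro integral_mono) auto
      also have "\<dots> \<le> D * \<epsilon>" by (rule est(2)[OF \<epsilon>(1,2)])
      finally show "c * (\<integral>x. indicat_real (cball 0 (real r)) x * F x \<partial>lebesgue) \<le> D * \<epsilon>" by simp
    qed
    \<comment> \<open>The \<open>+ 1\<close> makes the threshold meaningful for \<open>r = 0\<close>
      and also forces \<open>\<epsilon> \<le> 1\<close>.\<close>
    have small: "\<epsilon>\<^sup>2 * (2 * real r) \<le> 1" if "0 < \<epsilon>" "\<epsilon> \<le> 1 / (2 * real r + 1)" for \<epsilon>
    proof -
      have "\<epsilon> * (2 * real r + 1) \<le> 1" using that by (simp add: field_simps)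
      moreover have "\<epsilon> \<le> 1" using that(2) by (rule order_trans) simp
      then have "\<epsilon>\<^sup>2 * (2 * real r) \<le> \<epsilon> * (2 * real r)"
        using that(1) by (intro mult_right_mono) (auto simp: power2_eq_square)
      ultimately show ?thesis using that(1) by (simp add: algebra_simps)
    qed
    have "c * (\<integral>x. indicat_real (cball 0 (real r)) x * F x \<partial>lebesgue) \<le> 0"
    proof (rule tendsto_lowerbound)
      show "((\<lambda>\<epsilon>. D * \<epsilon>) \<longlongrightarrow> 0) (at_right 0)"
        by (auto intro!: tendsto_eq_intros)
      have "eventually (\<lambda>\<epsilon>. \<epsilon> \<in> {0<..<1 / (2 * real r + 1)}) (at_right (0::real))"
        by (rule eventually_at_right_real) simp
      then show "eventually (\<lambda>\<epsilon>. c * (\<integral>x. indicat_real (cball 0 (real r)) x * F x \<partial>lebesgue) \<le> D * \<epsilon>) (at_right 0)"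
      proof eventually_elim
        case (elim \<epsilon>)
        then have e: "0 < \<epsilon>" "\<epsilon> \<le> 1 / (2 * real r + 1)" by auto
        have "\<epsilon> \<le> 1" using e(2) by (rule order_trans) simp
        then show ?case using bnd(2)[OF e(1) _ small[OF e]] by simp
      qed
    qed simp
    moreover have "0 \<le> (\<integral>x. indicat_real (cball 0 (real r)) x * F x \<partial>lebesgue)"
      using F0 by (intro Bochner_Integration.integral_nonneg) simp
    ultimately have "(\<integral>x. indicat_real (cball 0 (real r)) x * F x \<partial>lebesgue) = 0"
      using c by (simp add: mult_le_0_iff)
    \<comment> \<open>A vanishing Bochner integral says something only for integrable functions; the
      largest admissible \<open>\<epsilon>\<close> supplies integrability.\<close>
    moreover have "integrable lebesgue (\<lambda>x. indicat_real (cball 0 (real r)) x * F x)"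
    proof -
      have e: "0 < 1 / (2 * real r + 1)" "1 / (2 * real r + 1) \<le> 1" by (auto simp: field_simps)
      show ?thesis by (rule bnd(1)[OF e small[OF e(1) order_refl]])
    qed
    ultimately have "AE x in lebesgue. indicat_real (cball 0 (real r)) x * F x = 0"
      using F0 by (subst (asm) integral_nonneg_eq_0_iff_AE) auto
    then show ?thesis by eventually_elim auto
  qed
  \<comment> \<open>Countably many balls exhaust the space, so the exceptional null sets can be
    united.\<close>
  have "AE x in lebesgue. \<forall>r::nat. x \<in> cball 0 (real r) \<longrightarrow> F x = 0"
    unfolding AE_all_countable using ball by blast
  then show ?thesis
  proof eventually_elim
    case (elim x)
    obtain r :: nat where "norm x \<le> real r" using real_arch_simple by blast
    then have "F x = 0" using elim by auto
    then show ?case by (rule F1)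
  qed
qed

lemma Lp_loc_1_const: "(\<lambda>x::'a::euclidean_space. c::real) \<in> Lp_loc 1"
proof -
  have "set_integrable lebesgue K (\<lambda>x::'a. \<bar>c\<bar>)" if "compact K" for K
    using integrable_indicator_compact[OF that] by (simp add: set_integrable_def)
  then show ?thesis by (simp add: Lp_loc_def)
qed

theorem theorem1p2:
  fixes q :: real and h :: "'a::euclidean_space \<Rightarrow> real"
  assumes "q > 0" and "h \<in> Lp_loc 1"
  shows "(\<forall>u v. weak_solution q h u \<longrightarrow> weak_solution q h v \<longrightarrow> (AE x in lebesgue. u x = v x)) \<and>
    (\<forall>v. weak_solution q h v \<longrightarrow>
      (AE x in lebesgue. essinf lebesgue (\<lambda>y. ereal (h y)) \<le> ereal (signed_pow q (v x)) \<and>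
         ereal (signed_pow q (v x)) \<le> esssup lebesgue (\<lambda>y. ereal (h y))))"
proof (intro conjI allI impI)
  fix u v assume "weak_solution q h u" "weak_solution q h v"
  then have s: "solves q h u (weak_grad u)" "solves q h v (weak_grad v)"
    by (simp_all add: weak_solution_solves)
  \<comment> \<open>Comparison is applied in both orders with the same right-hand side.\<close>
  have "AE x in lebesgue. u x \<le> v x" "AE x in lebesgue. v x \<le> u x"
    using comparison[OF assms(1) s assms(2,2)] comparison[OF assms(1) s(2,1) assms(2,2)] by auto
  then show "AE x in lebesgue. u x = v x"
    by eventually_elim simp
next
  fix v assume "weak_solution q h v"
  then have s: "solves q h v (weak_grad v)" by (rule weak_solution_solves)
  have mono: "signed_pow q a \<le> signed_pow q b" if "a \<le> b" for a b
    using signed_pow_strict_mono[OF assms(1), of a b] that by (cases "a = b") auto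
  \<comment> \<open>Lebesgue measure is not zero, so a real-valued \<open>h\<close> cannot lie below
    minus infinity almost everywhere; this rules out the degenerate values of the essential
    bounds.\<close>
  have notfalse: "\<not> (AE x in lebesgue :: 'a measure. False)"
    by (simp add: AE_iff_null null_sets_def emeasure_lborel_UNIV)
  \<comment> \<open>The constant \<open>c\<close> solves the equation with right-hand side
    \<open>H\<close>, so comparison gives \<open>v \<le> c\<close>, and monotonicity of
    \<open>signed_pow q\<close> translates this back.\<close>
  have up: "AE x in lebesgue. signed_pow q (v x) \<le> H" if "AE x in lebesgue. h x \<le> H" for H
  proof -
    obtain c where c: "signed_pow q c = H" using signed_pow_surj[OF assms(1)] .
    have "AE x in lebesgue. v x \<le> c"
      using comparison[OF assms(1) s const_solves[OF assms(1), of c] assms(2) Lp_loc_1_const] that c by simp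
    then show ?thesis by eventually_elim (use mono c in auto)
  qed
  have down: "AE x in lebesgue. H \<le> signed_pow q (v x)" if "AE x in lebesgue. H \<le> h x" for H
  proof -
    obtain c where c: "signed_pow q c = H" using signed_pow_surj[OF assms(1)] .
    have "AE x in lebesgue. c \<le> v x"
      using comparison[OF assms(1) const_solves[OF assms(1), of c] s Lp_loc_1_const assms(2)] that c by simp
    then show ?thesis by eventually_elim (use mono c in auto)
  qed
  have 1: "AE x in lebesgue. ereal (signed_pow q (v x)) \<le> esssup lebesgue (\<lambda>y. ereal (h y))"
  proof (cases "esssup lebesgue (\<lambda>y. ereal (h y))")
    case (real H)
    then have "AE x in lebesgue. h x \<le> H"
      using esssup_AE[where M = lebesgue and f = "\<lambda>y. ereal (h y)"] by simp
    then show ?thesis using up real by simp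
  next
    case MInf
    then show ?thesis
      using esssup_AE[where M = lebesgue and f = "\<lambda>y. ereal (h y)"] notfalse by simp
  qed simp
  have 2: "AE x in lebesgue. essinf lebesgue (\<lambda>y. ereal (h y)) \<le> ereal (signed_pow q (v x))"
  \<comment> \<open>The essential infimum is read off from the essential supremum of
    \<open>- h\<close>: the value plus infinity there makes the lower bound trivial, and minus
    infinity is excluded by \<open>notfalse\<close>.\<close>
  proof (cases "esssup lebesgue (\<lambda>y. - ereal (h y))")
    case (real H)
    have "AE x in lebesgue. - ereal (h x) \<le> ereal H"
      using esssup_AE[where M = lebesgue and f = "\<lambda>y. - ereal (h y)"] real by simp
    then have "AE x in lebesgue. - H \<le> h x"
      by eventually_elim simp
    from down[OF this] show ?thesis
      unfolding essinf_def real by simp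
  next
    case MInf
    then show ?thesis
      using esssup_AE[where M = lebesgue and f = "\<lambda>y. - ereal (h y)"] notfalse by simp
  qed (simp add: essinf_def)
  show "AE x in lebesgue. essinf lebesgue (\<lambda>y. ereal (h y)) \<le> ereal (signed_pow q (v x)) \<and>
      ereal (signed_pow q (v x)) \<le> esssup lebesgue (\<lambda>y. ereal (h y))"
    using 1 2 by eventually_elim simp
qed

end
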